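(* Let $k$ be an algebraically closed field of characteristic $p>2$ and let $V$ be an $n$-dimensional vector space over $k$ equipped with a symmetric non-degenerate bilinear form. For $m\ge 1$ let $A_m$ be the coordinate ring of $V_m:=V^{\oplus m}$, with the action of $\mathrm{SO}(V)$ induced by the diagonal action of $\mathrm{SO}(V)$ on $V^{\oplus m}$. Then the invariant ring $A_m^{\mathrm{SO}(V)}$ is Frobenius split for all $m\geq 1$.
   Context: $\mathrm{SO}(V)$ is the group of determinant-one linear automorphisms of $V$ preserving the given bilinear form. A commutative $k$-algebra $R$ (with $\mathrm{char}\,k=p>0$) is called Frobenius split if there is an additive map $\varphi\colon R\to R$ such that $\varphi(a^pb)=a\varphi(b)$ for all $a,b\in R$ and $\varphi(1)=1$. *)

theory Defs
  imports
    "HOL-Algebra.Subrings"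
    "HOL-Computational_Algebra.Polynomial"
    "Jordan_Normal_Form.Determinant"
begin

section \<open>Frobenius splittings\<close>

definition frobenius_split :: "nat \<Rightarrow> ('a, 'b) ring_scheme \<Rightarrow> bool" where
  "frobenius_split p R \<longleftrightarrow>
    (\<exists>\<phi> \<in> carrier R \<rightarrow> carrier R.
       (\<forall>a\<in>carrier R. \<forall>b\<in>carrier R. \<phi> (a \<oplus>\<^bsub>R\<^esub> b) = \<phi> a \<oplus>\<^bsub>R\<^esub> \<phi> b) \<and>
       (\<forall>a\<in>carrier R. \<forall>b\<in>carrier R. \<phi> ((a [^]\<^bsub>R\<^esub> p) \<otimes>\<^bsub>R\<^esub> b) = a \<otimes>\<^bsub>R\<^esub> \<phi> b) \<and>
       \<phi> \<one>\<^bsub>R\<^esub> = \<one>\<^bsub>R\<^esub>)"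


section \<open>The determinant of an endomorphism of an abstract vector space\<close>

definition basis_list :: "('k::field \<Rightarrow> 'v::ab_group_add \<Rightarrow> 'v) \<Rightarrow> 'v list \<Rightarrow> bool" where
  "basis_list scale bs \<longleftrightarrow>
     distinct bs \<and> \<not> module.dependent scale (set bs) \<and> module.span scale (set bs) = UNIV"

text \<open>The matrix of \<open>f\<close> with respect to the basis \<open>bs\<close> of the source and \<open>cs\<close> of the target.\<close>

definition matrix_of ::
  "('k::field \<Rightarrow> 'v::ab_group_add \<Rightarrow> 'v) \<Rightarrow> 'v list \<Rightarrow> 'v list \<Rightarrow> ('v \<Rightarrow> 'v) \<Rightarrow> 'k mat" where
  "matrix_of scale cs bs f =
     mat (length cs) (length bs)
       (\<lambda>(i, j). module.representation scale (set cs) (f (bs ! j)) (cs ! i))"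

text \<open>Meaningful for finite-dimensional spaces only; the value does not depend on the choice of
  the basis, see \<open>lin_det_eq\<close> below.\<close>

definition lin_det :: "('k::field \<Rightarrow> 'v::ab_group_add \<Rightarrow> 'v) \<Rightarrow> ('v \<Rightarrow> 'v) \<Rightarrow> 'k" where
  "lin_det scale f = (let bs = (SOME bs. basis_list scale bs) in det (matrix_of scale bs bs f))"

lemma representation_linear_sum:
  assumes cs: "basis_list scale cs" and ds: "basis_list scale ds"
    and g: "Vector_Spaces.linear scale scale g"
  shows "module.representation scale (set ds) (g v) w =
    (\<Sum>k<length cs. module.representation scale (set ds) (g (cs ! k)) w *
       module.representation scale (set cs) v (cs ! k))"
proof -
  interpret g: Vector_Spaces.linear scale scale g by fact
  have c: "\<not> g.vs1.dependent (set cs)" "g.vs1.span (set cs) = UNIV" "distinct cs"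
    and d: "\<not> g.vs1.dependent (set ds)" "g.vs1.span (set ds) = UNIV"
    using cs ds by (auto simp: basis_list_def)
  have "v = (\<Sum>b\<in>set cs. scale (g.vs1.representation (set cs) v b) b)"
    using g.vs1.sum_representation_eq[of "set cs" v "set cs"] c by simp
  also have "\<dots> = (\<Sum>k<length cs. scale (g.vs1.representation (set cs) v (cs ! k)) (cs ! k))"
    using sum.reindex_bij_betw[OF bij_betw_nth[OF c(3) refl refl],
        of "\<lambda>b. scale (g.vs1.representation (set cs) v b) b"] by simp
  finally have v: "v = \<dots>" .
  have "g v = (\<Sum>k<length cs. scale (g.vs1.representation (set cs) v (cs ! k)) (g (cs ! k)))"
    by (subst v) (simp add: g.sum g.scale)
  then show ?thesis
    using d by (simp add: g.vs1.representation_sum g.vs1.representation_scale mult.commute)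
qed

lemma matrix_of_compose:
  assumes cs: "basis_list scale cs" and ds: "basis_list scale ds"
    and g: "Vector_Spaces.linear scale scale g"
  shows "matrix_of scale ds cs g * matrix_of scale cs bs f = matrix_of scale ds bs (g \<circ> f)"
proof (rule eq_matI)
  fix i j assume "i < dim_row (matrix_of scale ds bs (g \<circ> f))"
    "j < dim_col (matrix_of scale ds bs (g \<circ> f))"
  then show "(matrix_of scale ds cs g * matrix_of scale cs bs f) $$ (i, j) =
      matrix_of scale ds bs (g \<circ> f) $$ (i, j)"
    using representation_linear_sum[OF cs ds g, of "f (bs ! j)" "ds ! i"]
    by (simp add: matrix_of_def scalar_prod_def atLeast0LessThan)
qed (simp_all add: matrix_of_def)

lemma matrix_of_id:
  assumes "vector_space scale" "basis_list scale bs"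
  shows "matrix_of scale bs bs id = 1\<^sub>m (length bs)"
proof -
  interpret V: vector_space scale by fact
  show ?thesis
    using assms(2) by (intro eq_matI)
      (auto simp: matrix_of_def basis_list_def V.representation_basis nth_eq_iff_index_eq)
qed

lemma basis_list_length:
  assumes "vector_space scale" and bs: "basis_list scale bs" and cs: "basis_list scale cs"
  shows "length bs = length cs"
proof -
  interpret V: vector_space scale by fact
  have "card (set xs) = V.dim UNIV" if "basis_list scale xs" for xs
    using that V.dim_eq_card[of "set xs" UNIV] by (simp add: basis_list_def)
  from this[OF bs] this[OF cs] show ?thesis
    using bs cs by (auto simp: basis_list_def distinct_card)
qed

lemma det_matrix_of_eq:
  assumes bs: "basis_list scale bs" and cs: "basis_list scale cs"
    and f: "Vector_Spaces.linear scale scale f"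
  shows "det (matrix_of scale bs bs f) = det (matrix_of scale cs cs f)"
proof -
  interpret f: Vector_Spaces.linear scale scale f by fact
  note vs = f.vs1.vector_space_axioms
  define n where "n = length bs"
  have n: "length cs = n" using basis_list_length[OF vs bs cs] by (simp add: n_def)
  have id: "Vector_Spaces.linear scale scale id"
    by (rule f.vs1.linear_id)
  have carr: "matrix_of scale xs ys h \<in> carrier_mat n n" if "length xs = n" "length ys = n" for xs ys h
    using that by (simp add: matrix_of_def)
  note [simp] = carr n n_def[symmetric]
  let ?P = "matrix_of scale bs cs id" and ?Q = "matrix_of scale cs bs id"
  have "?Q * ?P = 1\<^sub>m n"
    using matrix_of_compose[OF bs cs id, of cs id] matrix_of_id[OF vs cs] by simp
  then have QP: "det ?Q * det ?P = 1"
    by (metis carr det_mult det_one n n_def)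
  have "matrix_of scale bs bs f = ?P * (matrix_of scale cs cs f * ?Q)"
    using matrix_of_compose[OF cs cs f, of bs id] matrix_of_compose[OF cs bs id, of bs f] by simp
  then have "det (matrix_of scale bs bs f) = det ?P * (det (matrix_of scale cs cs f) * det ?Q)"
    by (simp add: det_mult[OF carr mult_carrier_mat[OF carr carr]] det_mult[OF carr carr])
  also have "\<dots> = det (matrix_of scale cs cs f)"
    using QP by (simp add: mult.commute mult.left_commute)
  finally show ?thesis .
qed

lemma lin_det_eq:
  assumes "basis_list scale bs" "Vector_Spaces.linear scale scale f"
  shows "lin_det scale f = det (matrix_of scale bs bs f)"
  unfolding lin_det_def Let_def
  by (rule det_matrix_of_eq[OF someI[of "basis_list scale", OF assms(1)] assms])


section \<open>Orthogonal spaces\<close>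

definition symmetric_bilinear_form ::
  "('k::field \<Rightarrow> 'v::ab_group_add \<Rightarrow> 'v) \<Rightarrow> ('v \<Rightarrow> 'v \<Rightarrow> 'k) \<Rightarrow> bool" where
  "symmetric_bilinear_form scale \<beta> \<longleftrightarrow>
     (\<forall>x. Vector_Spaces.linear scale (*) (\<beta> x)) \<and>
     (\<forall>y. Vector_Spaces.linear scale (*) (\<lambda>x. \<beta> x y)) \<and>
     (\<forall>x y. \<beta> x y = \<beta> y x)"

definition nondegenerate_form :: "('v::zero \<Rightarrow> 'v \<Rightarrow> 'k::zero) \<Rightarrow> bool" where
  "nondegenerate_form \<beta> \<longleftrightarrow> (\<forall>x. (\<forall>y. \<beta> x y = 0) \<longrightarrow> x = 0)"

definition special_orthogonal ::
  "('k::field \<Rightarrow> 'v::ab_group_add \<Rightarrow> 'v) \<Rightarrow> ('v \<Rightarrow> 'v \<Rightarrow> 'k) \<Rightarrow> ('v \<Rightarrow> 'v) set" where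
  "special_orthogonal scale \<beta> =
     {g. Vector_Spaces.linear scale scale g \<and> bij g \<and>
         (\<forall>x y. \<beta> (g x) (g y) = \<beta> x y) \<and> lin_det scale g = 1}"


section \<open>The coordinate ring of a direct sum of copies of a vector space\<close>

definition function_ring :: "'x set \<Rightarrow> ('x \<Rightarrow> 'k::comm_ring_1) ring" where
  "function_ring D =
     \<lparr>carrier = D \<rightarrow>\<^sub>E UNIV,
      monoid.mult = (\<lambda>f g. \<lambda>x\<in>D. f x * g x), monoid.one = (\<lambda>x\<in>D. 1),
      ring.zero = (\<lambda>x\<in>D. 0), ring.add = (\<lambda>f g. \<lambda>x\<in>D. f x + g x)\<rparr>"

text \<open>The underlying set of \<open>V\<^sup>m\<close>, where \<open>V\<close> is the whole type \<open>'v\<close>.\<close>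

definition tuples :: "nat \<Rightarrow> (nat \<Rightarrow> 'v) set" where
  "tuples m = {..<m} \<rightarrow>\<^sub>E UNIV"

text \<open>The \<open>k\<close>-algebra of functions on \<open>V\<^sup>m\<close> generated by the dual space of \<open>V\<^sup>m\<close>, that is, by the
  linear forms on the \<open>m\<close> components. Over an infinite field, in particular over an algebraically
  closed one, these polynomial functions are the same as polynomials in the coordinates.\<close>

inductive_set regular_functions ::
  "('k::field \<Rightarrow> 'v::ab_group_add \<Rightarrow> 'v) \<Rightarrow> nat \<Rightarrow> ((nat \<Rightarrow> 'v) \<Rightarrow> 'k) set"
  for scale m where
  const: "(\<lambda>x\<in>tuples m. c) \<in> regular_functions scale m"
| linear_form: "Vector_Spaces.linear scale (*) l \<Longrightarrow> i < m \<Longrightarrow>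
    (\<lambda>x\<in>tuples m. l (x i)) \<in> regular_functions scale m"
| add: "f \<in> regular_functions scale m \<Longrightarrow> g \<in> regular_functions scale m \<Longrightarrow>
    (\<lambda>x\<in>tuples m. f x + g x) \<in> regular_functions scale m"
| mult: "f \<in> regular_functions scale m \<Longrightarrow> g \<in> regular_functions scale m \<Longrightarrow>
    (\<lambda>x\<in>tuples m. f x * g x) \<in> regular_functions scale m"

definition coordinate_ring ::
  "('k::field \<Rightarrow> 'v::ab_group_add \<Rightarrow> 'v) \<Rightarrow> nat \<Rightarrow> ((nat \<Rightarrow> 'v) \<Rightarrow> 'k) ring" where
  "coordinate_ring scale m = (function_ring (tuples m))\<lparr>carrier := regular_functions scale m\<rparr>"

definition diagonal_map :: "nat \<Rightarrow> ('v \<Rightarrow> 'v) \<Rightarrow> (nat \<Rightarrow> 'v) \<Rightarrow> (nat \<Rightarrow> 'v)" where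
  "diagonal_map m g x = (\<lambda>i\<in>{..<m}. g (x i))"

text \<open>The induced action on functions: \<open>(g f)(x) = f (g\<^sup>-\<^sup>1 x)\<close>.\<close>

definition act :: "nat \<Rightarrow> ('v \<Rightarrow> 'v) \<Rightarrow> ((nat \<Rightarrow> 'v) \<Rightarrow> 'k) \<Rightarrow> ((nat \<Rightarrow> 'v) \<Rightarrow> 'k)" where
  "act m g f = (\<lambda>x\<in>tuples m. f (diagonal_map m (inv_into UNIV g) x))"

definition SO_invariant_ring ::
  "('k::field \<Rightarrow> 'v::ab_group_add \<Rightarrow> 'v) \<Rightarrow> ('v \<Rightarrow> 'v \<Rightarrow> 'k) \<Rightarrow> nat \<Rightarrow> ((nat \<Rightarrow> 'v) \<Rightarrow> 'k) ring" where
  "SO_invariant_ring scale \<beta> m =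
     (coordinate_ring scale m)\<lparr>carrier :=
        {f \<in> carrier (coordinate_ring scale m). \<forall>g\<in>special_orthogonal scale \<beta>. act m g f = f}\<rparr>"

lemma cring_function_ring: "cring (function_ring D)"
proof (rule cringI)
  show "abelian_group (function_ring D)"
  proof (rule abelian_groupI)
    fix f assume "f \<in> carrier (function_ring D)"
    then show "\<exists>g\<in>carrier (function_ring D). g \<oplus>\<^bsub>function_ring D\<^esub> f = \<zero>\<^bsub>function_ring D\<^esub>"
      by (intro bexI[of _ "\<lambda>x\<in>D. - f x"]) (auto simp: function_ring_def)
  qed (auto simp: function_ring_def PiE_def extensional_def algebra_simps fun_eq_iff)
  show "comm_monoid (function_ring D)"
    by (rule comm_monoidI)
      (auto simp: function_ring_def PiE_def extensional_def algebra_simps fun_eq_iff)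
qed (auto simp: function_ring_def algebra_simps)

lemma regular_functions_extensional:
  "f \<in> regular_functions scale m \<Longrightarrow> f \<in> tuples m \<rightarrow>\<^sub>E UNIV"
  by (induction rule: regular_functions.induct) auto

lemma uminus_function_ring:
  assumes "f \<in> D \<rightarrow>\<^sub>E UNIV"
  shows "\<ominus>\<^bsub>function_ring D\<^esub> f = (\<lambda>x\<in>D. - f x)"
proof -
  interpret cring "function_ring D" by (rule cring_function_ring)
  show ?thesis
    using assms by (intro minus_equality) (auto simp: function_ring_def)
qed

lemma regular_functions_uminus:
  assumes "f \<in> regular_functions scale m"
  shows "(\<lambda>x\<in>tuples m. - f x) \<in> regular_functions scale m"
proof -
  have "(\<lambda>x\<in>tuples m. - f x) = (\<lambda>x\<in>tuples m. (\<lambda>x\<in>tuples m. - 1) x * f x)"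
    by (auto simp: fun_eq_iff)
  then show ?thesis
    by (metis assms regular_functions.const regular_functions.mult)
qed

lemma cring_coordinate_ring: "cring (coordinate_ring scale m)"
proof -
  interpret R: cring "function_ring (tuples m)" by (rule cring_function_ring)
  have "subring (regular_functions scale m) (function_ring (tuples m))"
    using regular_functions_uminus
    by (intro R.subringI)
      (auto simp: uminus_function_ring regular_functions_extensional,
       auto simp: function_ring_def intro: regular_functions.intros
         dest: regular_functions_extensional)
  then show ?thesis
    unfolding coordinate_ring_def
    by (intro R.subcring_iff[THEN iffD1] R.subcringI') (auto dest: subringE(1))
qed

lemma diagonal_map_tuples: "diagonal_map m g x \<in> tuples m"
  by (simp add: diagonal_map_def tuples_def)

lemma cring_SO_invariant_ring: "cring (SO_invariant_ring scale \<beta> m)"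
proof -
  let ?I = "{f \<in> regular_functions scale m. \<forall>g\<in>special_orthogonal scale \<beta>. act m g f = f}"
  interpret R: cring "function_ring (tuples m)" by (rule cring_function_ring)
  have act_simp: "act m g f x = f (diagonal_map m (inv_into UNIV g) x)" if "x \<in> tuples m"
    for g f x using that by (simp add: act_def)
  have inv: "f (diagonal_map m (inv_into UNIV g) x) = f x"
    if "f \<in> ?I" "g \<in> special_orthogonal scale \<beta>" "x \<in> tuples m" for f g x
    using that act_simp[of x g f] by simp
  have "subring ?I (function_ring (tuples m))"
  proof (rule R.subringI)
    show "?I \<subseteq> carrier (function_ring (tuples m))"
      by (auto simp: function_ring_def dest: regular_functions_extensional)
    show "\<one>\<^bsub>function_ring (tuples m)\<^esub> \<in> ?I"
      by (auto simp: function_ring_def act_def diagonal_map_tuples intro: regular_functions.const)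
  next
    fix f assume f: "f \<in> ?I"
    then show "\<ominus>\<^bsub>function_ring (tuples m)\<^esub> f \<in> ?I"
      using inv[OF f]
      by (auto simp: uminus_function_ring regular_functions_extensional regular_functions_uminus
          act_def diagonal_map_tuples fun_eq_iff)
  next
    fix f g assume fg: "f \<in> ?I" "g \<in> ?I"
    show "f \<otimes>\<^bsub>function_ring (tuples m)\<^esub> g \<in> ?I" "f \<oplus>\<^bsub>function_ring (tuples m)\<^esub> g \<in> ?I"
      using fg inv[OF fg(1)] inv[OF fg(2)]
      by (auto simp: function_ring_def act_def diagonal_map_tuples fun_eq_iff
          intro: regular_functions.intros)
  qed
  then have "cring ((function_ring (tuples m))\<lparr>carrier := ?I\<rparr>)"
    by (intro R.subcring_iff[THEN iffD1] R.subcringI') (auto dest: subringE(1))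
  then show ?thesis
    by (simp add: SO_invariant_ring_def coordinate_ring_def)
qed

end

theory Submission
  imports Defs
begin

text \<open>
  With respect to an orthonormal basis of \<open>V\<close> the ring \<open>A\<^sub>M\<close> is the polynomial ring in the
  entries \<open>X\<^sub>a\<^sub>j\<close> of an \<open>n \<times> M\<close> matrix. Let \<open>Tr\<close> be the \<open>p\<^sup>-\<^sup>1\<close>-linear map which sends
  \<open>c X\<^sup>E\<close> to the \<open>p\<close>-th root of \<open>c X\<^sup>E / \<Prod>X\<^sub>a\<^sub>j\<^sup>p\<^sup>-\<^sup>1\<close> if that is a monomial with exponents
  divisible by \<open>p\<close>, and to \<open>0\<close> otherwise. For \<open>M \<ge> n\<close> let \<open>h\<close> be the product of the minors
  supported on the diagonals of the matrix. Its leading monomial is the product of all variables,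
  so \<open>Tr(h\<^sup>p\<^sup>-\<^sup>1) = 1\<close>, and \<open>f \<mapsto> Tr(h\<^sup>p\<^sup>-\<^sup>1 f)\<close> is a splitting of \<open>A\<^sub>M\<close>.

  It maps invariants to invariants although \<open>h\<close> is not invariant. The rotations of the \<open>i\<close>-th
  coordinate plane (spanned by the basis vectors \<open>i\<close> and \<open>i + 1\<close>) form a torus, and exactly two
  factors of \<open>h\<close> have just one row in this plane, while the others are invariant under the torus.
  Hence the torus weights of \<open>h\<^sup>p\<^sup>-\<^sup>1\<close> are even and at most \<open>2(p - 1)\<close> in absolute value. As
  \<open>Tr\<close> commutes with the rotations, it kills the components whose weight is not divisible by
  \<open>p\<close>, so for invariant \<open>f\<close> only the component of weight \<open>0\<close> contributes to
  \<open>Tr(h\<^sup>p\<^sup>-\<^sup>1 f)\<close>, which is therefore invariant under all these tori. They generate \<open>SO(V)\<close>.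

  For arbitrary \<open>m\<close> one restricts the splitting of \<open>A\<^sub>n\<^sub>+\<^sub>m\<close> along the inclusion of
  \<open>A\<^sub>m\<close>, which has an equivariant retraction (set the last \<open>n\<close> vectors to \<open>0\<close>).
\<close>

section \<open>Polynomial functions\<close>

definition mon :: "'i set \<Rightarrow> ('i \<Rightarrow> nat) \<Rightarrow> ('i \<Rightarrow> 'k::comm_ring_1) \<Rightarrow> 'k" where
  "mon I E X = (\<Prod>i\<in>I. X i ^ E i)"

text \<open>Polynomials are treated as functions, spanned by monomials. The predicate on exponents
  carries degree or weight bounds, so homogeneous functions and lower-order remainders are instances
  of one notion.\<close>

inductive_set mspan :: "'i set \<Rightarrow> (('i \<Rightarrow> nat) \<Rightarrow> bool) \<Rightarrow> (('i \<Rightarrow> 'k::comm_ring_1) \<Rightarrow> 'k) set"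
  for I P where
  zero: "(\<lambda>X. 0) \<in> mspan I P"
| step: "f \<in> mspan I P \<Longrightarrow> P E \<Longrightarrow> (\<lambda>X. c * mon I E X + f X) \<in> mspan I P"

abbreviation polys :: "'i set \<Rightarrow> (('i \<Rightarrow> 'k::comm_ring_1) \<Rightarrow> 'k) set" where
  "polys I \<equiv> mspan I (\<lambda>_. True)"

lemma mon_mult: "mon I E X * mon I E' X = mon I (\<lambda>i. E i + E' i) X"
  by (simp add: mon_def power_add prod.distrib)

lemma mon_power: "mon I E X ^ p = mon I (\<lambda>i. p * E i) X"
  by (simp add: mon_def prod_power_distrib power_mult[symmetric] mult.commute)

lemma mspan_mono: "f \<in> mspan I P \<Longrightarrow> (\<And>E. P E \<Longrightarrow> Q E) \<Longrightarrow> f \<in> mspan I Q"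
  by (induction rule: mspan.induct) (auto intro: mspan.intros)

lemma mspan_polys: "f \<in> mspan I P \<Longrightarrow> f \<in> polys I"
  by (erule mspan_mono) simp

lemma mspan_term: "P E \<Longrightarrow> (\<lambda>X. c * mon I E X) \<in> mspan I P"
  using mspan.step[OF mspan.zero, where c = c and P = P and E = E and I = I] by simp

lemma mspan_mon: "P E \<Longrightarrow> mon I E \<in> mspan I P"
  using mspan_term[where c = 1, of P E I] by simp

lemma mspan_add:
  assumes "f \<in> mspan I P" "g \<in> mspan I P"
  shows "(\<lambda>X. f X + g X) \<in> mspan I P"
  using assms(1) by (induction rule: mspan.induct) (auto simp: assms(2) add.assoc intro: mspan.intros)

lemma mspan_cmult:
  assumes "f \<in> mspan I P"
  shows "(\<lambda>X. c * f X) \<in> mspan I P"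
  using assms
proof (induction rule: mspan.induct)
  case (step f E d)
  have "(\<lambda>X. (c * d) * mon I E X + c * f X) \<in> mspan I P"
    by (rule mspan.step) (use step in auto)
  then show ?case by (simp add: algebra_simps)
qed (auto intro: mspan.zero)

lemma mspan_term_mult:
  assumes "g \<in> mspan I Q" "P E" and R: "\<And>E E'. P E \<Longrightarrow> Q E' \<Longrightarrow> R (\<lambda>i. E i + E' i)"
  shows "(\<lambda>X. c * mon I E X * g X) \<in> mspan I R"
  using assms(1)
proof (induction rule: mspan.induct)
  case (step f E' d)
  have "(\<lambda>X. (c * d) * mon I (\<lambda>i. E i + E' i) X + c * mon I E X * f X) \<in> mspan I R"
    by (rule mspan.step[OF step.IH]) (rule R[OF assms(2) step.hyps(2)])
  then show ?case
    by (simp add: algebra_simps mon_mult[symmetric])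
qed (auto intro: mspan.zero)

lemma mspan_mult:
  assumes "f \<in> mspan I P" "g \<in> mspan I Q" and R: "\<And>E E'. P E \<Longrightarrow> Q E' \<Longrightarrow> R (\<lambda>i. E i + E' i)"
  shows "(\<lambda>X. f X * g X) \<in> mspan I R"
  using assms(1)
proof (induction rule: mspan.induct)
  case (step f E c)
  have "(\<lambda>X. c * mon I E X * g X + f X * g X) \<in> mspan I R"
  proof (rule mspan_add[OF _ step.IH])
    show "(\<lambda>X. c * mon I E X * g X) \<in> mspan I R"
      by (rule mspan_term_mult[where P = P and Q = Q]) (use assms(2) step.hyps(2) R in auto)
  qed
  then show ?case
    by (simp add: algebra_simps)
qed (auto intro: mspan.zero)

lemma polys_const: "(\<lambda>X. c) \<in> polys I"
  using mspan_term[of "\<lambda>_. True" "\<lambda>_. 0" c I] by (simp add: mon_def)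

lemma polys_mult: "f \<in> polys I \<Longrightarrow> g \<in> polys I \<Longrightarrow> (\<lambda>X. f X * g X) \<in> polys I"
  by (rule mspan_mult[where P = "\<lambda>_. True" and Q = "\<lambda>_. True"]) auto

lemma polys_uminus: "f \<in> polys I \<Longrightarrow> (\<lambda>X. - f X) \<in> polys I"
  using mspan_cmult[of f I _ "- 1"] by simp

lemma polys_diff: "f \<in> polys I \<Longrightarrow> g \<in> polys I \<Longrightarrow> (\<lambda>X. f X - g X) \<in> polys I"
  using mspan_add[OF _ polys_uminus, of f I g] by simp

lemma mspan_sum: "(\<And>s. s \<in> S \<Longrightarrow> f s \<in> mspan I P) \<Longrightarrow> (\<lambda>X. \<Sum>s\<in>S. f s X) \<in> mspan I P"
  by (induction S rule: infinite_finite_induct) (auto intro: mspan.zero mspan_add)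

lemma polys_prod: "(\<And>s. s \<in> S \<Longrightarrow> f s \<in> polys I) \<Longrightarrow> (\<lambda>X. \<Prod>s\<in>S. f s X) \<in> polys I"
  by (induction S rule: infinite_finite_induct) (auto intro: polys_const polys_mult)

lemma polys_power: "f \<in> polys I \<Longrightarrow> (\<lambda>X. f X ^ n) \<in> polys I"
  by (induction n) (auto intro: polys_const polys_mult)

lemma mon_single:
  assumes "finite I" "i \<in> I"
  shows "mon I (\<lambda>j. if j = i then 1 else 0) X = X i"
  using assms by (simp add: mon_def if_distrib[of "\<lambda>n. X _ ^ n"] cong: if_cong)

section \<open>Homogeneous polynomial functions and linear substitution\<close>

definition hom_deg :: "'i set \<Rightarrow> nat \<Rightarrow> ('i \<Rightarrow> nat) \<Rightarrow> bool" where
  "hom_deg I d E \<longleftrightarrow> (\<Sum>i\<in>I. E i) = d"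

lemma hom_deg_add: "hom_deg I d E \<Longrightarrow> hom_deg I d' E' \<Longrightarrow> hom_deg I (d + d') (\<lambda>i. E i + E' i)"
  by (simp add: hom_deg_def sum.distrib)

lemma coord_hom:
  assumes "finite I" "i \<in> I"
  shows "(\<lambda>X :: 'i \<Rightarrow> 'k::comm_ring_1. X i) \<in> mspan I (hom_deg I 1)"
proof -
  have "mon I (\<lambda>j. if j = i then 1 else 0) = (\<lambda>X :: 'i \<Rightarrow> 'k. X i)"
    using mon_single[of I i] assms by auto
  then show ?thesis
    using mspan_mon[of "hom_deg I 1" "\<lambda>j. if j = i then 1 else 0" I, where 'b = 'k] assms
    by (auto simp: hom_deg_def)
qed

lemma coord_polys: "finite I \<Longrightarrow> i \<in> I \<Longrightarrow> (\<lambda>X. X i) \<in> polys I"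
  by (rule mspan_polys[OF coord_hom])

lemma hom_one: "(\<lambda>X. 1) \<in> mspan I (hom_deg I 0)"
  using mspan_mon[of "hom_deg I 0" "\<lambda>j. 0" I] by (simp add: mon_def[abs_def] hom_deg_def)

lemma hom_mult:
  "f \<in> mspan I (hom_deg I d) \<Longrightarrow> g \<in> mspan I (hom_deg I d') \<Longrightarrow>
    (\<lambda>X. f X * g X) \<in> mspan I (hom_deg I (d + d'))"
  by (rule mspan_mult[where P = "hom_deg I d" and Q = "hom_deg I d'"]) (auto intro: hom_deg_add)

lemma hom_power: "f \<in> mspan I (hom_deg I d) \<Longrightarrow> (\<lambda>X. f X ^ n) \<in> mspan I (hom_deg I (n * d))"
  by (induction n) (auto intro: hom_one hom_mult)

lemma hom_prod:
  assumes "finite S" "\<And>s. s \<in> S \<Longrightarrow> f s \<in> mspan I (hom_deg I (d s))"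
  shows "(\<lambda>X. \<Prod>s\<in>S. f s X) \<in> mspan I (hom_deg I (\<Sum>s\<in>S. d s))"
  using assms by (induction S rule: finite_induct) (auto intro: hom_one hom_mult)

lemma mon_linear_subst:
  assumes "finite I" "\<And>i. i \<in> I \<Longrightarrow> (\<lambda>X. L X i) \<in> mspan I (hom_deg I 1)" "hom_deg I d E"
  shows "(\<lambda>X. mon I E (L X)) \<in> mspan I (hom_deg I d)"
proof -
  have "(\<lambda>X. \<Prod>i\<in>I. L X i ^ E i) \<in> mspan I (hom_deg I (\<Sum>i\<in>I. E i))"
    using assms hom_power[of "\<lambda>X. L X _" I 1] by (intro hom_prod) auto
  then show ?thesis using assms(3) by (simp add: mon_def hom_deg_def)
qed

lemma polys_linear_subst:
  assumes "finite I" "\<And>i. i \<in> I \<Longrightarrow> (\<lambda>X. L X i) \<in> mspan I (hom_deg I 1)" "f \<in> polys I"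
  shows "(\<lambda>X. f (L X)) \<in> polys I"
  using assms(3)
proof (induction rule: mspan.induct)
  case (step f E c)
  have "(\<lambda>X. mon I E (L X)) \<in> polys I"
    using mon_linear_subst[of I L "\<Sum>i\<in>I. E i" E] assms(1,2)
    by (simp add: hom_deg_def mspan_polys)
  then show ?case using step.IH by (intro mspan_add mspan_cmult)
qed (auto intro: mspan.zero)

section \<open>The Frobenius trace\<close>

definition frob_root :: "'k::alg_closed_field \<Rightarrow> 'k" where
  "frob_root c = (THE y. y ^ CHAR('k) = c)"

text \<open>The Hasse derivative of order \<open>q\<close> in the variable \<open>i\<close>: the
  coefficient of \<open>t ^ q\<close> in the Taylor expansion along that axis. The description is
  unique because the field is infinite in all uses.\<close>

definition hasse :: "'i \<Rightarrow> nat \<Rightarrow> (('i \<Rightarrow> 'k::field) \<Rightarrow> 'k) \<Rightarrow> ('i \<Rightarrow> 'k) \<Rightarrow> 'k" where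
  "hasse i q a X = coeff (THE P. \<forall>t. poly P t = a (X(i := X i + t))) q"

text \<open>Over a finite field, 1 plus the product of all linear factors would be a nonconstant
  polynomial with value 1 everywhere.\<close>

lemma infinite_alg_closed: "infinite (UNIV :: 'k::alg_closed_field set)"
proof
  assume fin: "finite (UNIV :: 'k set)"
  let ?P = "(\<Prod>a\<in>(UNIV::'k set). [:- a, 1:]) + 1"
  have "degree (\<Prod>a\<in>(UNIV::'k set). [:- a, 1:]) = card (UNIV :: 'k set)"
    by (subst degree_prod_eq_sum_degree) auto
  moreover have "card (UNIV :: 'k set) > 0" using fin by (simp add: card_gt_0_iff)
  ultimately have "degree ?P > 0" by (simp add: degree_add_eq_left)
  from alg_closed_imp_poly_has_root[OF this] obtain x where "poly ?P x = 0" by blast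
  moreover have "(\<Prod>a\<in>(UNIV::'k set). poly [:- a, 1:] x) = 0"
    using fin by (intro prod_zero) (auto intro!: bexI[of _ x])
  ultimately show False by (simp add: poly_prod)
qed

lemma poly_eqI_infinite:
  fixes P Q :: "'k::alg_closed_field poly"
  assumes "finite A" "\<And>t. t \<notin> A \<Longrightarrow> poly P t = poly Q t"
  shows "P = Q"
proof (rule ccontr)
  assume "P \<noteq> Q"
  then have "finite {t. poly (P - Q) t = 0}" by (intro poly_roots_finite) simp
  moreover have "UNIV = A \<union> {t. poly (P - Q) t = 0}" using assms(2) by auto
  ultimately show False using assms(1) infinite_alg_closed by (metis finite_Un)
qed

lemma hasse_eqI:
  fixes a :: "('i \<Rightarrow> 'k::alg_closed_field) \<Rightarrow> 'k"
  assumes "\<And>t. poly P t = a (X(i := X i + t))"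
  shows "hasse i q a X = coeff P q"
proof -
  have "(THE P. \<forall>t. poly P t = a (X(i := X i + t))) = P"
  proof (rule the_equality)
    fix Q assume "\<forall>t. poly Q t = a (X(i := X i + t))"
    then show "Q = P" using assms by (intro poly_eqI_infinite[of "{}"]) auto
  qed (use assms in blast)
  then show ?thesis by (simp add: hasse_def)
qed

lemma polys_line:
  fixes a :: "('i \<Rightarrow> 'k::alg_closed_field) \<Rightarrow> 'k"
  assumes "finite I" "a \<in> polys I"
  shows "\<exists>P. \<forall>t. poly P t = a (X(i := X i + t))"
  using assms(2)
proof (induction rule: mspan.induct)
  case (step f E c)
  then obtain P where P: "\<forall>t. poly P t = f (X(i := X i + t))" by blast
  let ?Q = "smult c (\<Prod>j\<in>I. (if j = i then [:X i, 1:] else [:X j:]) ^ E j) + P"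
  have "poly (\<Prod>j\<in>I. (if j = i then [:X i, 1:] else [:X j:]) ^ E j) t = mon I E (X(i := X i + t))" for t
    unfolding mon_def poly_prod by (rule prod.cong) auto
  then have "\<forall>t. poly ?Q t = c * mon I E (X(i := X i + t)) + f (X(i := X i + t))"
    using P by simp
  then show ?case by blast
qed (auto intro: exI[of _ 0])

section \<open>The Frobenius map and its inverse in characteristic p\<close>

locale char_p =
  fixes p :: nat and field_type :: "'k::alg_closed_field itself"
  assumes char: "CHAR('k::alg_closed_field) = p" and p: "prime p"
begin

lemma frob_add: "(x + y :: 'k) ^ p = x ^ p + y ^ p"
  by (rule freshmans_dream) (simp_all only: char p)

lemma frob_inj: "(x :: 'k) ^ p = y ^ p \<longleftrightarrow> x = y"
proof
  assume "x ^ p = y ^ p"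
  moreover have "x ^ p = (x - y) ^ p + y ^ p" using frob_add[of "x - y" y] by simp
  ultimately have "(x - y) ^ p = 0" by (metis add_cancel_left_left)
  then show "x = y" by simp
qed simp

lemma frob_root_power: "frob_root (c :: 'k) ^ p = c"
proof -
  obtain y :: 'k where "y ^ p = c" using nth_root_exists[of p c] p by (auto simp: prime_gt_0_nat)
  then have "(THE y. y ^ p = c) = y" using frob_inj by (intro the_equality) blast+
  then show ?thesis using \<open>y ^ p = c\<close> by (simp add: frob_root_def char)
qed

lemma frob_root_eqI: "(y :: 'k) ^ p = c \<Longrightarrow> frob_root c = y"
  using frob_root_power[of c] frob_inj[of y "frob_root c"] by metis

lemma frob_root_add: "frob_root (c + d :: 'k) = frob_root c + frob_root d"
  by (rule frob_root_eqI) (simp add: frob_add frob_root_power)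

lemma frob_root_mult: "frob_root (c * d :: 'k) = frob_root c * frob_root d"
  by (rule frob_root_eqI) (simp add: power_mult_distrib frob_root_power)

lemma frob_root_of_power: "frob_root (c ^ p :: 'k) = c"
  by (rule frob_root_eqI) simp

lemma frob_root_0: "frob_root (0 :: 'k) = 0" and frob_root_1: "frob_root (1 :: 'k) = 1"
  using p by (auto intro!: frob_root_eqI simp: prime_gt_0_nat)

text \<open>Writing \<open>P\<close> as \<open>c\<close> plus \<open>x\<close> times
  \<open>R\<close>, its \<open>p\<close>-th power is \<open>c ^ p\<close> plus a multiple of
  \<open>x ^ p\<close>, so only \<open>c ^ p\<close> contributes below degree \<open>p\<close>. This
  makes Hasse derivatives of order below \<open>p\<close> linear over \<open>p\<close>-th
  powers.\<close>

lemma coeff_frob_power_mult: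
  fixes P Q :: "'k poly"
  assumes "q < p"
  shows "coeff (P ^ p * Q) q = coeff P 0 ^ p * coeff Q q"
proof (cases P)
  case (pCons c R)
  have "P = [:c:] + [:0, 1:] * R" using pCons by simp
  then have "P ^ p = [:c:] ^ p + ([:0, 1:] * R) ^ p"
    by (simp only: freshmans_dream semiring_char_poly char p)
  then have "P ^ p = [:c ^ p:] + monom 1 p * R ^ p"
    unfolding power_mult_distrib poly_const_pow monom_altdef by simp
  then have "P ^ p * Q = smult (c ^ p) Q + monom 1 p * (R ^ p * Q)"
    by (simp add: distrib_right mult.assoc)
  then show ?thesis using assms pCons by (simp add: coeff_monom_mult)
qed

section \<open>Hasse derivatives of polynomial functions and their iterates\<close>

lemma hasse_add:
  fixes a b :: "('i \<Rightarrow> 'k) \<Rightarrow> 'k"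
  assumes "finite I" "a \<in> polys I" "b \<in> polys I"
  shows "hasse i q (\<lambda>X. a X + b X) X = hasse i q a X + hasse i q b X"
proof -
  obtain P Q where "\<And>t. poly P t = a (X(i := X i + t))" "\<And>t. poly Q t = b (X(i := X i + t))"
    using polys_line[OF assms(1,2)] polys_line[OF assms(1,3)] by meson
  note PQ = this
  have "hasse i q (\<lambda>X. a X + b X) X = coeff (P + Q) q"
    by (rule hasse_eqI) (simp add: PQ)
  then show ?thesis by (simp add: hasse_eqI[OF PQ(1)] hasse_eqI[OF PQ(2)])
qed

lemma hasse_frob_mult:
  fixes a b :: "('i \<Rightarrow> 'k) \<Rightarrow> 'k"
  assumes "finite I" "a \<in> polys I" "b \<in> polys I" "q < p"
  shows "hasse i q (\<lambda>X. b X ^ p * a X) X = b X ^ p * hasse i q a X"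
proof -
  obtain P Q where PQ: "\<And>t. poly P t = a (X(i := X i + t))" "\<And>t. poly Q t = b (X(i := X i + t))"
    using polys_line[OF assms(1,2)] polys_line[OF assms(1,3)] by meson
  then have "hasse i q (\<lambda>X. b X ^ p * a X) X = coeff (Q ^ p * P) q"
    by (intro hasse_eqI) simp
  moreover have "coeff Q 0 = b X" using PQ(2)[of 0] by (simp add: poly_0_coeff_0)
  ultimately show ?thesis using assms(4) by (simp add: coeff_frob_power_mult hasse_eqI[OF PQ(1)])
qed

lemma hasse_mon:
  fixes c :: 'k and X :: "'i \<Rightarrow> 'k"
  assumes "finite I" "i \<in> I"
  shows "hasse i q (\<lambda>X. c * mon I E X) X = c * of_nat (E i choose q) * mon I (E(i := E i - q)) X"
proof -
  let ?m = "\<lambda>Y. \<Prod>j\<in>I - {i}. Y j ^ E j"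
  have split1: "mon I E Y = Y i ^ E i * ?m Y" for Y :: "'i \<Rightarrow> 'k"
    using assms by (simp add: mon_def prod.remove)
  have "?m (X(i := u)) = ?m X" for u
    by (rule prod.cong) auto
  then have "poly (smult (c * ?m X) ([:X i, 1:] ^ E i)) t = c * mon I E (X(i := X i + t))" for t
    unfolding split1 by simp
  then have 1: "hasse i q (\<lambda>X. c * mon I E X) X = coeff (smult (c * ?m X) ([:X i, 1:] ^ E i)) q"
    by (intro hasse_eqI)
  have 2: "\<dots> = c * ?m X * (of_nat (E i choose q) * X i ^ (E i - q))"
  proof (cases "q \<le> E i")
    case True
    then show ?thesis by (simp add: coeff_linear_poly_power)
  next
    \<comment> \<open>The exponent \<open>E i - q\<close> is truncated here, but the binomial
      coefficient vanishes and both sides are zero.\<close>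
    case False
    then have "coeff ([:X i, 1:] ^ E i) q = 0"
      by (intro coeff_eq_0) (simp add: degree_linear_power)
    then show ?thesis using False by (simp add: binomial_eq_0)
  qed
  have 3: "X i ^ (E i - q) * ?m X = mon I (E(i := E i - q)) X"
  proof -
    have "(\<Prod>j\<in>I - {i}. X j ^ (E(i := E i - q)) j) = ?m X"
      by (rule prod.cong) auto
    then show ?thesis using assms by (simp add: mon_def prod.remove)
  qed
  show ?thesis unfolding 1 2 3[symmetric] by (simp only: ac_simps)
qed

lemma hasse_polys:
  fixes a :: "('i \<Rightarrow> 'k) \<Rightarrow> 'k"
  assumes "finite I" "i \<in> I" "a \<in> polys I"
  shows "hasse i q a \<in> polys I"
  using assms(3)
proof (induction rule: mspan.induct)
  case zero
  have "hasse i q (\<lambda>X :: 'i \<Rightarrow> 'k. 0) = (\<lambda>X. 0)"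
    by (rule ext) (use hasse_eqI[of 0 "\<lambda>X :: 'i \<Rightarrow> 'k. 0"] in simp)
  then show ?case by (simp add: mspan.zero)
next
  case (step f E c)
  have "hasse i q (\<lambda>X. c * mon I E X + f X) =
      (\<lambda>X. c * of_nat (E i choose q) * mon I (E(i := E i - q)) X + hasse i q f X)"
    by (rule ext) (simp only: hasse_add[OF assms(1) mspan_term[OF TrueI] step.hyps(1)] hasse_mon[OF assms(1,2)])
  then show ?case using mspan.step[OF step.IH, where c = "c * of_nat (E i choose q)"] by simp
qed

definition hasse_top :: "'i list \<Rightarrow> (('i \<Rightarrow> 'k) \<Rightarrow> 'k) \<Rightarrow> ('i \<Rightarrow> 'k) \<Rightarrow> 'k" where
  "hasse_top xs a = foldr (\<lambda>i. hasse i (p - 1)) xs a"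

lemma hasse_top_polys:
  fixes a :: "('i \<Rightarrow> 'k) \<Rightarrow> 'k"
  assumes "finite I" "set xs \<subseteq> I" "a \<in> polys I"
  shows "hasse_top xs a \<in> polys I"
  using assms(2) by (induction xs) (auto simp: hasse_top_def assms(3) hasse_polys[OF assms(1)])

lemma hasse_top_add:
  fixes a b :: "('i \<Rightarrow> 'k) \<Rightarrow> 'k"
  assumes "finite I" "set xs \<subseteq> I" "a \<in> polys I" "b \<in> polys I"
  shows "hasse_top xs (\<lambda>X. a X + b X) = (\<lambda>X. hasse_top xs a X + hasse_top xs b X)"
  using assms(2)
proof (induction xs)
  case (Cons i xs)
  have "hasse_top xs a \<in> polys I" "hasse_top xs b \<in> polys I"
    using Cons.prems assms hasse_top_polys by auto
  then have "hasse i (p - 1) (\<lambda>X. hasse_top xs a X + hasse_top xs b X) =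
      (\<lambda>X. hasse i (p - 1) (hasse_top xs a) X + hasse i (p - 1) (hasse_top xs b) X)"
    by (intro ext hasse_add[OF assms(1)])
  then show ?case using Cons by (simp add: hasse_top_def)
qed (simp add: hasse_top_def)

lemma hasse_top_frob_mult:
  fixes a b :: "('i \<Rightarrow> 'k) \<Rightarrow> 'k"
  assumes "finite I" "set xs \<subseteq> I" "a \<in> polys I" "b \<in> polys I"
  shows "hasse_top xs (\<lambda>X. b X ^ p * a X) = (\<lambda>X. b X ^ p * hasse_top xs a X)"
  using assms(2)
proof (induction xs)
  case (Cons i xs)
  have "hasse_top xs a \<in> polys I"
    using Cons.prems assms hasse_top_polys by auto
  then have "hasse i (p - 1) (\<lambda>X. b X ^ p * hasse_top xs a X) =
      (\<lambda>X. b X ^ p * hasse i (p - 1) (hasse_top xs a) X)"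
    using prime_gt_0_nat[OF p] by (intro ext hasse_frob_mult[OF assms(1) _ assms(4)]) auto
  then show ?case using Cons by (simp add: hasse_top_def)
qed (simp add: hasse_top_def)

lemma hasse_top_mon:
  fixes c :: 'k
  assumes "finite I" "set xs \<subseteq> I" "distinct xs" "\<And>i. i \<in> I \<Longrightarrow> r i < p"
  shows "hasse_top xs (\<lambda>X :: 'i \<Rightarrow> 'k. c * mon I r X) =
    (\<lambda>X. (if \<forall>i\<in>set xs. r i = p - 1 then c else 0) * mon I (\<lambda>i. if i \<in> set xs then 0 else r i) X)"
  using assms(2,3)
proof (induction xs)
  case (Cons i xs)
  let ?c = "if \<forall>i\<in>set xs. r i = p - 1 then c else 0"
  let ?r = "\<lambda>i. if i \<in> set xs then 0 else r i"
  have i: "i \<in> I" "i \<notin> set xs" "r i \<le> p - 1" using Cons.prems assms(4)[of i] by auto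
  have "hasse_top (i # xs) (\<lambda>X. c * mon I r X) = hasse i (p - 1) (\<lambda>X. ?c * mon I ?r X)"
    using Cons by (simp add: hasse_top_def)
  also have "\<dots> = (\<lambda>X. ?c * of_nat (r i choose (p - 1)) * mon I (?r(i := r i - (p - 1))) X)"
    by (rule ext) (use hasse_mon[OF assms(1) i(1), of "p - 1" ?c ?r] i(2) in simp)
  also have "?r(i := r i - (p - 1)) = (\<lambda>j. if j \<in> set (i # xs) then 0 else r j)"
    using i by auto
  \<comment> \<open>As \<open>r i\<close> is at most \<open>p - 1\<close>, the binomial coefficient
    is 1 in case of equality and 0 otherwise.\<close>
  also have "?c * of_nat (r i choose (p - 1)) = (if \<forall>j\<in>set (i # xs). r j = p - 1 then c else 0)"
    using i(3) by (auto simp: binomial_eq_0)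
  finally show ?case .
qed (simp add: hasse_top_def)

text \<open>This is \<open>Tr\<close> of the overview. The derivatives of order \<open>p - 1\<close>
  are composed one variable after another, hence the choice of an enumeration of \<open>I\<close>;
  the monomial formula \<open>frob_trace_mon\<close> shows that the result does not depend on it for
  finite \<open>I\<close>.\<close>

definition frob_trace :: "'i set \<Rightarrow> (('i \<Rightarrow> 'k) \<Rightarrow> 'k) \<Rightarrow> ('i \<Rightarrow> 'k) \<Rightarrow> 'k" where
  "frob_trace I a X = frob_root (hasse_top (SOME xs. distinct xs \<and> set xs = I) a X)"

section \<open>Values of the trace on monomials and on homogeneous functions\<close>

context
  fixes I :: "'i set"
  assumes fin: "finite I"
begin

lemma frob_trace_list: "\<exists>xs. distinct xs \<and> set xs = I \<and> (\<forall>a. frob_trace I a = (\<lambda>X. frob_root (hasse_top xs a X)))"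
proof -
  let ?xs = "SOME xs. distinct xs \<and> set xs = I"
  have "distinct ?xs \<and> set ?xs = I"
    by (rule someI_ex) (use finite_distinct_list[OF fin] in blast)
  then show ?thesis by (intro exI[of _ ?xs]) (simp add: frob_trace_def[abs_def])
qed

lemma frob_trace_add:
  assumes "a \<in> polys I" "b \<in> polys I"
  shows "frob_trace I (\<lambda>X. a X + b X) = (\<lambda>X. frob_trace I a X + frob_trace I b X)"
proof -
  obtain xs where xs: "set xs = I" "\<And>a. frob_trace I a = (\<lambda>X. frob_root (hasse_top xs a X))"
    using frob_trace_list by blast
  show ?thesis
    unfolding xs(2) using hasse_top_add[OF fin, of xs a b] xs(1) assms by (simp add: frob_root_add)
qed

lemma frob_trace_frob_mult:
  assumes "a \<in> polys I" "b \<in> polys I"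
  shows "frob_trace I (\<lambda>X. b X ^ p * a X) = (\<lambda>X. b X * frob_trace I a X)"
proof -
  obtain xs where xs: "set xs = I" "\<And>a. frob_trace I a = (\<lambda>X. frob_root (hasse_top xs a X))"
    using frob_trace_list by blast
  show ?thesis
    unfolding xs(2) using hasse_top_frob_mult[OF fin, of xs a b] xs(1) assms
    by (simp add: frob_root_mult frob_root_of_power)
qed

lemma frob_trace_cmult:
  assumes "a \<in> polys I"
  shows "frob_trace I (\<lambda>X. c ^ p * a X) = (\<lambda>X. c * frob_trace I a X)"
  using frob_trace_frob_mult[OF assms polys_const] .

lemma frob_trace_0: "frob_trace I (\<lambda>X. 0) = (\<lambda>X. 0)"
  using frob_trace_cmult[OF mspan.zero, of 0] prime_gt_0_nat[OF p] by simp

lemma frob_trace_sum: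
  assumes "finite S" "\<And>s. s \<in> S \<Longrightarrow> a s \<in> polys I"
  shows "frob_trace I (\<lambda>X. \<Sum>s\<in>S. a s X) = (\<lambda>X. \<Sum>s\<in>S. frob_trace I (a s) X)"
  using assms
proof (induction S rule: finite_induct)
  case (insert s S)
  have "frob_trace I (\<lambda>X. a s X + (\<Sum>s\<in>S. a s X)) =
      (\<lambda>X. frob_trace I (a s) X + frob_trace I (\<lambda>X. \<Sum>s\<in>S. a s X) X)"
    by (rule frob_trace_add) (auto intro: mspan_sum insert.prems)
  then show ?case using insert by simp
qed (simp add: frob_trace_0)

lemma frob_trace_mon_small:
  assumes "\<And>i. i \<in> I \<Longrightarrow> r i < p"
  shows "frob_trace I (\<lambda>X. c * mon I r X) = (\<lambda>X. if \<forall>i\<in>I. r i = p - 1 then frob_root c else 0)"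
proof -
  obtain xs where xs: "distinct xs" "set xs = I"
    "\<And>a. frob_trace I a = (\<lambda>X. frob_root (hasse_top xs a X))"
    using frob_trace_list by blast
  have "mon I (\<lambda>i. if i \<in> set xs then 0 else r i) = (\<lambda>X. 1 :: 'k)"
    using xs(2) by (simp add: mon_def fun_eq_iff)
  then show ?thesis
    unfolding xs(3) using hasse_top_mon[OF fin, of xs r c] xs(1,2) assms by (simp add: frob_root_0)
qed

text \<open>Division with remainder in each exponent splits off a \<open>p\<close>-th power, which
  the trace takes out; only exponents below \<open>p\<close> remain to be treated.\<close>

lemma mon_div_mod: "c * mon I E X = mon I (\<lambda>i. E i div p) X ^ p * (c * mon I (\<lambda>i. E i mod p) X)"
  unfolding mon_power mult.left_commute[of _ c] mon_mult by (simp add: mult.commute)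

lemma frob_trace_mon:
  "frob_trace I (\<lambda>X. c * mon I E X) =
    (\<lambda>X. (if \<forall>i\<in>I. E i mod p = p - 1 then frob_root c else 0) * mon I (\<lambda>i. E i div p) X)"
proof -
  have "frob_trace I (\<lambda>X. c * mon I E X) =
      (\<lambda>X. mon I (\<lambda>i. E i div p) X * frob_trace I (\<lambda>X. c * mon I (\<lambda>i. E i mod p) X) X)"
    unfolding mon_div_mod[of c E] by (intro frob_trace_frob_mult mspan_term mspan_mon TrueI)
  also have "frob_trace I (\<lambda>X. c * mon I (\<lambda>i. E i mod p) X) =
      (\<lambda>X. if \<forall>i\<in>I. E i mod p = p - 1 then frob_root c else 0)"
    by (rule frob_trace_mon_small) (use prime_gt_0_nat[OF p] in simp)
  finally show ?thesis by (simp only: mult.commute)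
qed

lemma frob_trace_step:
  assumes "f \<in> polys I"
  shows "frob_trace I (\<lambda>X. c * mon I E X + f X) =
    (\<lambda>X. (if \<forall>i\<in>I. E i mod p = p - 1 then frob_root c else 0) * mon I (\<lambda>i. E i div p) X
      + frob_trace I f X)"
  using frob_trace_add[OF mspan_term[OF TrueI] assms, of c E] by (simp only: frob_trace_mon)

lemma frob_trace_polys:
  assumes "a \<in> polys I"
  shows "frob_trace I a \<in> polys I"
  using assms
proof (induction rule: mspan.induct)
  case (step f E c)
  show ?case unfolding frob_trace_step[OF step.hyps(1)] by (rule mspan.step[OF step.IH TrueI])
qed (simp add: frob_trace_0 mspan.zero)

text \<open>A monomial survives the trace only if all its exponents are congruent to
  \<open>p - 1\<close>, and then each of them is at least \<open>p - 1\<close>, which the degree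
  bound excludes.\<close>

lemma frob_trace_hom_small:
  assumes "f \<in> mspan I (hom_deg I d)" "d < card I * (p - 1)"
  shows "frob_trace I f = (\<lambda>X. 0)"
  using assms(1)
proof (induction rule: mspan.induct)
  case (step f E c)
  have "\<not> (\<forall>i\<in>I. E i mod p = p - 1)"
  proof
    assume *: "\<forall>i\<in>I. E i mod p = p - 1"
    have "card I * (p - 1) = (\<Sum>i\<in>I. p - 1)" by simp
    also have "\<dots> = (\<Sum>i\<in>I. E i mod p)" using * by (intro sum.cong) auto
    also have "\<dots> \<le> (\<Sum>i\<in>I. E i)" by (intro sum_mono) simp
    finally show False using assms(2) step.hyps(2) by (simp add: hom_deg_def)
  qed
  then show ?case
    unfolding frob_trace_step[OF mspan_polys[OF step.hyps(1)]] step.IH by (simp only: if_False) simp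
qed (simp add: frob_trace_0)

text \<open>In this degree a surviving monomial has all exponents equal to \<open>p - 1\<close>, so
  the quotients \<open>E i div p\<close> are zero and a constant is left.\<close>

lemma frob_trace_hom_top:
  assumes "f \<in> mspan I (hom_deg I (card I * (p - 1)))"
  shows "\<exists>c. frob_trace I f = (\<lambda>X. c)"
  using assms
proof (induction rule: mspan.induct)
  case (step f E c)
  from step.IH obtain c' where c': "frob_trace I f = (\<lambda>X. c')" by blast
  have "mon I (\<lambda>i. E i div p) = (\<lambda>X. 1 :: 'k)" if *: "\<forall>i\<in>I. E i mod p = p - 1"
  proof -
    have "(\<Sum>i\<in>I. E i mod p) = (\<Sum>i\<in>I. p - 1)" using * by (intro sum.cong) auto
    moreover have "(\<Sum>i\<in>I. E i) = (\<Sum>i\<in>I. p * (E i div p)) + (\<Sum>i\<in>I. E i mod p)"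
      by (simp flip: sum.distrib)
    ultimately have "(\<Sum>i\<in>I. p * (E i div p)) = 0"
      using step.hyps(2) by (simp add: hom_deg_def)
    then have "\<forall>i\<in>I. E i div p = 0" using fin prime_gt_0_nat[OF p] by auto
    then show ?thesis by (simp add: mon_def fun_eq_iff)
  qed
  then show ?case
    by (cases "\<forall>i\<in>I. E i mod p = p - 1")
      (auto simp: frob_trace_step[OF mspan_polys[OF step.hyps(1)]] c')
qed (auto simp: frob_trace_0)

section \<open>Behaviour of the trace under linear substitutions\<close>

definition linear_subst :: "(('i \<Rightarrow> 'k) \<Rightarrow> 'i \<Rightarrow> 'k) \<Rightarrow> bool" where
  "linear_subst L \<longleftrightarrow> (\<forall>i\<in>I. (\<lambda>X. L X i) \<in> mspan I (hom_deg I 1))"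

text \<open>For a linear \<open>L\<close> this trace is a constant function by
  \<open>frob_trace_hom_top\<close>, and evaluation at the origin reads the constant off. It is the
  scalar by which \<open>L\<close> fails to commute with the trace.\<close>

definition subst_factor :: "(('i \<Rightarrow> 'k) \<Rightarrow> 'i \<Rightarrow> 'k) \<Rightarrow> 'k" where
  "subst_factor L = frob_trace I (\<lambda>X. mon I (\<lambda>_. p - 1) (L X)) (\<lambda>_. 0)"

lemma linear_subst_mon:
  assumes "linear_subst L" "hom_deg I d E"
  shows "(\<lambda>X. mon I E (L X)) \<in> mspan I (hom_deg I d)"
  using mon_linear_subst[OF fin _ assms(2), of L] assms(1) by (simp add: linear_subst_def)

lemma linear_subst_polys: "linear_subst L \<Longrightarrow> a \<in> polys I \<Longrightarrow> (\<lambda>X. a (L X)) \<in> polys I"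
  using polys_linear_subst[OF fin, of L a] by (simp add: linear_subst_def)

lemma linear_subst_hom:
  assumes "linear_subst L" "f \<in> mspan I (hom_deg I d)"
  shows "(\<lambda>X. f (L X)) \<in> mspan I (hom_deg I d)"
  using assms(2)
proof (induction rule: mspan.induct)
  case (step f E c)
  then show ?case by (intro mspan_add mspan_cmult linear_subst_mon[OF assms(1)])
qed (rule mspan.zero)

lemma linear_subst_comp: "linear_subst L \<Longrightarrow> linear_subst L' \<Longrightarrow> linear_subst (\<lambda>X. L (L' X))"
  using linear_subst_hom[of L'] by (auto simp: linear_subst_def)

text \<open>Modulo \<open>p\<close>-th powers only the monomial \<open>\<Prod>X\<^sub>i\<^sup>p\<^sup>-\<^sup>1\<close> matters, and the
  other monomials with exponents below \<open>p\<close> have degree too small to produce it after a linear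
  substitution.\<close>

lemma frob_trace_mon_subst:
  assumes L: "linear_subst L"
  shows "frob_trace I (\<lambda>X. c * mon I E (L X)) = (\<lambda>X. subst_factor L * frob_trace I (\<lambda>X. c * mon I E X) (L X))"
proof -
  let ?q = "\<lambda>i. E i div p" and ?r = "\<lambda>i. E i mod p" and ?d = "\<Sum>i\<in>I. E i mod p"
  have r_lt: "E i mod p < p" for i using prime_gt_0_nat[OF p] by simp
  have hom: "(\<lambda>X. mon I ?r (L X)) \<in> mspan I (hom_deg I ?d)"
    by (rule linear_subst_mon[OF L]) (simp add: hom_deg_def)
  have "frob_trace I (\<lambda>X. c * mon I E (L X)) =
      frob_trace I (\<lambda>X. mon I ?q (L X) ^ p * (c * mon I ?r (L X)))"
    by (subst mon_div_mod) simp
  also have "\<dots> = (\<lambda>X. mon I ?q (L X) * frob_trace I (\<lambda>X. c * mon I ?r (L X)) X)"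
    by (rule frob_trace_frob_mult) (intro mspan_cmult mspan_polys[OF hom] linear_subst_polys[OF L] mspan_mon TrueI)+
  also have "frob_trace I (\<lambda>X. c * mon I ?r (L X)) = (\<lambda>X. frob_root c * frob_trace I (\<lambda>X. mon I ?r (L X)) X)"
    using frob_trace_cmult[OF mspan_polys[OF hom], of "frob_root c"] by (simp only: frob_root_power)
  finally have 1: "frob_trace I (\<lambda>X. c * mon I E (L X)) =
      (\<lambda>X. mon I ?q (L X) * (frob_root c * frob_trace I (\<lambda>X. mon I ?r (L X)) X))" .
  show ?thesis
  proof (cases "\<forall>i\<in>I. ?r i = p - 1")
    case True
    then have r: "mon I ?r = (mon I (\<lambda>_. p - 1) :: ('i \<Rightarrow> 'k) \<Rightarrow> 'k)"
      by (simp add: mon_def fun_eq_iff)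
    \<comment> \<open>The remainder monomial is the top one, so its trace after substitution is
      constant and equals its value at the origin.\<close>
    have "?d = (\<Sum>i\<in>I. p - 1)" using True by (intro sum.cong) auto
    then have "?d = card I * (p - 1)" by simp
    then obtain c' where c': "frob_trace I (\<lambda>X. mon I ?r (L X)) = (\<lambda>X. c')"
      using frob_trace_hom_top hom by metis
    then have "c' = subst_factor L" by (simp add: subst_factor_def r)
    then show ?thesis unfolding 1 c' frob_trace_mon using True by (simp add: fun_eq_iff)
  next
    case False
    then have "?d < (\<Sum>i\<in>I. p - 1)"
    proof (intro sum_strict_mono_ex1[OF fin] ballI)
      show "?r i \<le> p - 1" for i using r_lt[of i] by linarith
      from False obtain i where "i \<in> I" "?r i \<noteq> p - 1" by blast
      then show "\<exists>i\<in>I. ?r i < p - 1" using r_lt[of i] by (intro bexI[of _ i]) linarith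
    qed
    then have "frob_trace I (\<lambda>X. mon I ?r (L X)) = (\<lambda>X. 0)"
      by (intro frob_trace_hom_small[OF hom]) simp
    then show ?thesis unfolding 1 frob_trace_mon by (simp only: False if_False) simp
  qed
qed

lemma frob_trace_subst:
  assumes L: "linear_subst L" and a: "a \<in> polys I"
  shows "frob_trace I (\<lambda>X. a (L X)) = (\<lambda>X. subst_factor L * frob_trace I a (L X))"
  using a
proof (induction rule: mspan.induct)
  case (step f E c)
  have "frob_trace I (\<lambda>X. c * mon I E (L X) + f (L X)) =
      (\<lambda>X. frob_trace I (\<lambda>X. c * mon I E (L X)) X + frob_trace I (\<lambda>X. f (L X)) X)"
    by (rule frob_trace_add) (intro mspan_cmult linear_subst_polys[OF L] mspan_mon TrueI step.hyps)+
  also have "\<dots> = (\<lambda>X. subst_factor L * (frob_trace I (\<lambda>X. c * mon I E X) (L X) + frob_trace I f (L X)))"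
    unfolding frob_trace_mon_subst[OF L] step.IH by (simp only: distrib_left)
  finally show ?case
    unfolding frob_trace_add[OF mspan_term[OF TrueI] step.hyps(1)] .
qed (simp add: frob_trace_0)

lemma frob_trace_top: "frob_trace I (mon I (\<lambda>_. p - 1)) = (\<lambda>X. 1)"
  using frob_trace_mon_small[of "\<lambda>_. p - 1" 1] prime_gt_0_nat[OF p] by (simp add: frob_root_1)

lemma subst_factor_eq:
  "(\<And>X i. i \<in> I \<Longrightarrow> L X i = L' X i) \<Longrightarrow> subst_factor L = subst_factor L'"
  by (simp add: subst_factor_def mon_def)

lemma subst_factor_id:
  "(\<And>X i. i \<in> I \<Longrightarrow> L X i = X i) \<Longrightarrow> subst_factor L = 1"
  using subst_factor_eq[of L "\<lambda>X. X"] by (simp only: subst_factor_def frob_trace_top)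

text \<open>The transformation rule is applied to \<open>L'\<close> and then to \<open>L\<close>, on
  the top monomial, whose own trace is 1.\<close>

lemma subst_factor_comp:
  assumes "linear_subst L" "linear_subst L'"
  shows "subst_factor (\<lambda>X. L (L' X)) = subst_factor L * subst_factor L'"
proof -
  let ?m = "mon I (\<lambda>_. p - 1) :: ('i \<Rightarrow> 'k) \<Rightarrow> 'k"
  have "frob_trace I (\<lambda>X. ?m (L (L' X))) = (\<lambda>X. subst_factor L' * frob_trace I (\<lambda>X. ?m (L X)) (L' X))"
    using frob_trace_subst[OF assms(2) linear_subst_polys[OF assms(1) mspan_mon[OF TrueI]]] .
  also have "frob_trace I (\<lambda>X. ?m (L X)) = (\<lambda>X. subst_factor L)"
    using frob_trace_subst[OF assms(1) mspan_mon[OF TrueI], of "\<lambda>_. p - 1"]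
    by (simp only: frob_trace_top mult_1_right)
  finally show ?thesis by (simp add: subst_factor_def mult.commute)
qed

end

end

section \<open>Determinants as functions of their rows\<close>

text \<open>Rows are functions of the column index, so that exchanging a row is a function update
  and the determinant can be expanded linearly in it.\<close>

definition dmat :: "nat \<Rightarrow> (nat \<Rightarrow> nat \<Rightarrow> 'k) \<Rightarrow> 'k::comm_ring_1" where
  "dmat k A = det (mat k k (\<lambda>(u, v). A u v))"

lemma dmat_cong: "(\<And>u v. u < k \<Longrightarrow> v < k \<Longrightarrow> A u v = B u v) \<Longrightarrow> dmat k A = dmat k B"
  unfolding dmat_def by (intro arg_cong[of _ _ det] cong_mat) auto

lemma dmat_leibniz:
  "dmat k A = (\<Sum>\<sigma> | \<sigma> permutes {0..<k}. signof \<sigma> * (\<Prod>u = 0..<k. A u (\<sigma> u)))"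
proof -
  have "(\<Prod>u = 0..<k. mat k k (\<lambda>(u, v). A u v) $$ (u, \<sigma> u)) = (\<Prod>u = 0..<k. A u (\<sigma> u))"
    if "\<sigma> permutes {0..<k}" for \<sigma>
    using permutes_in_image[OF that] by (intro prod.cong) auto
  then show ?thesis unfolding dmat_def det_def by simp
qed

lemma dmat_row_linear:
  assumes "w < k"
  shows "dmat k (A(w := (\<lambda>v. c * f v + d * g v))) = c * dmat k (A(w := f)) + d * dmat k (A(w := g))"
proof -
  have "(\<Prod>u = 0..<k. (A(w := f)) u (\<sigma> u)) = f (\<sigma> w) * (\<Prod>u\<in>{0..<k} - {w}. A u (\<sigma> u))" for f \<sigma>
    using assms by (subst prod.remove[of _ w]) (auto intro!: prod.cong)
  then show ?thesis
    unfolding dmat_leibniz by (simp add: algebra_simps sum.distrib sum_distrib_left)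
qed

lemma dmat_equal_rows:
  fixes A :: "nat \<Rightarrow> nat \<Rightarrow> 'k::comm_ring_1"
  assumes "u < k" "w < k" "u \<noteq> w" "A u = A w"
  shows "dmat k A = 0"
  unfolding dmat_def
  by (rule det_identical_rows[of _ k u w]) (use assms in \<open>auto intro!: eq_vecI\<close>)

text \<open>Bilinear expansion in the two rows leaves four terms: those with equal rows vanish, and
  the swapped one is the negative of the original determinant.\<close>

lemma dmat_rotate_rows:
  fixes A :: "nat \<Rightarrow> nat \<Rightarrow> 'k::comm_ring_1"
  assumes uw: "u < k" "w < k" "u \<noteq> w"
  shows "dmat k (A(u := (\<lambda>v. c * A u v - s * A w v), w := (\<lambda>v. s * A u v + c * A w v))) =
    (c * c + s * s) * dmat k A"
proof -
  let ?D = "\<lambda>f g. dmat k (A(u := f, w := g))"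
  have 1: "?D f (\<lambda>v. x * g v + y * g' v) = x * ?D f g + y * ?D f g'" for f g g' x y
    by (rule dmat_row_linear[OF uw(2)])
  have 2: "?D (\<lambda>v. x * f v + y * f' v) g = x * ?D f g + y * ?D f' g" for f f' g x y
    using dmat_row_linear[OF uw(1), of "A(w := g)"] uw(3) by (simp add: fun_upd_twist)
  have eq: "?D f f = 0" for f
    by (rule dmat_equal_rows[OF uw]) (use uw(3) in auto)
  \<comment> \<open>Antisymmetry comes from putting the sum of both rows in both places, where the
    determinant vanishes.\<close>
  have "?D (\<lambda>v. 1 * A u v + 1 * A w v) (\<lambda>v. 1 * A u v + 1 * A w v) = 0" by (rule eq)
  then have swap: "?D (A w) (A u) = - ?D (A u) (A w)"
    unfolding 1 2 eq by (simp add: add_eq_0_iff)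
  have "?D (\<lambda>v. c * A u v + (- s) * A w v) (\<lambda>v. s * A u v + c * A w v) = (c * c + s * s) * ?D (A u) (A w)"
    unfolding 1 2 eq swap by (simp add: algebra_simps)
  then show ?thesis using uw(3) by simp
qed

lemma dmat_polys:
  assumes "\<And>u v. u < k \<Longrightarrow> v < k \<Longrightarrow> (\<lambda>X. A X u v) \<in> polys I"
  shows "(\<lambda>X. dmat k (A X)) \<in> polys I"
  unfolding dmat_leibniz
proof (rule mspan_sum, rule mspan_cmult, rule polys_prod)
  fix \<sigma> u assume "\<sigma> \<in> {\<sigma>. \<sigma> permutes {0..<k}}" "u \<in> {0..<k}"
  then show "(\<lambda>X. A X u (\<sigma> u)) \<in> polys I"
    using assms permutes_in_image[of \<sigma> "{0..<k}" u] by auto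
qed

section \<open>Leading monomials\<close>

text \<open>A monic leading term for the order given by the weights \<open>w\<close>. The remainder
  must also have the same total degree: in \<open>frob_trace_leading\<close> this confines the
  exponents that could survive the trace.\<close>

definition leading :: "'i set \<Rightarrow> ('i \<Rightarrow> nat) \<Rightarrow> ('i \<Rightarrow> nat) \<Rightarrow> (('i \<Rightarrow> 'k::comm_ring_1) \<Rightarrow> 'k) \<Rightarrow> bool" where
  "leading I w E f \<longleftrightarrow> (\<exists>g \<in> mspan I (\<lambda>E'. (\<Sum>i\<in>I. E' i) = (\<Sum>i\<in>I. E i) \<and>
     (\<Sum>i\<in>I. w i * E' i) < (\<Sum>i\<in>I. w i * E i)). f = (\<lambda>X. mon I E X + g X))"

lemma leading_mult:
  assumes "leading I w E f" "leading I w E' f'"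
  shows "leading I w (\<lambda>i. E i + E' i) (\<lambda>X. f X * f' X)"
proof -
  let ?P = "\<lambda>E0 E'. (\<Sum>i\<in>I. E' i) = (\<Sum>i\<in>I. E0 i) \<and> (\<Sum>i\<in>I. w i * E' i) < (\<Sum>i\<in>I. w i * E0 i)"
  let ?Q = "\<lambda>E0 E'. (\<Sum>i\<in>I. E' i) = (\<Sum>i\<in>I. E0 i) \<and> (\<Sum>i\<in>I. w i * E' i) \<le> (\<Sum>i\<in>I. w i * E0 i)"
  obtain g g' where g: "g \<in> mspan I (?P E)" "f = (\<lambda>X. mon I E X + g X)"
    and g': "g' \<in> mspan I (?P E')" "f' = (\<lambda>X. mon I E' X + g' X)"
    using assms by (auto simp: leading_def)
  have f': "f' \<in> mspan I (?Q E')"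
    unfolding g'(2) by (intro mspan_add mspan_mon mspan_mono[OF g'(1)]) auto
  have m: "mon I E \<in> mspan I (?Q E)" by (intro mspan_mon) auto
  \<comment> \<open>The remainder of the product is the leading monomial of \<open>f\<close> times
    \<open>g'\<close>, plus \<open>g\<close> times all of \<open>f'\<close>; each summand combines a
    strict weight inequality with a weak one.\<close>
  have "(\<lambda>X. mon I E X * g' X) \<in> mspan I (?P (\<lambda>i. E i + E' i))"
    by (rule mspan_mult[OF m g'(1)]) (simp add: sum.distrib distrib_left)
  moreover have "(\<lambda>X. g X * f' X) \<in> mspan I (?P (\<lambda>i. E i + E' i))"
    by (rule mspan_mult[OF g(1) f']) (simp add: sum.distrib distrib_left)
  ultimately have "(\<lambda>X. mon I E X * g' X + g X * f' X) \<in> mspan I (?P (\<lambda>i. E i + E' i))"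
    by (rule mspan_add)
  moreover have "(\<lambda>X. f X * f' X) =
      (\<lambda>X. mon I (\<lambda>i. E i + E' i) X + (mon I E X * g' X + g X * f' X))"
    unfolding g(2) g'(2) mon_mult[symmetric] by (simp add: algebra_simps)
  ultimately show ?thesis
    unfolding leading_def by (intro bexI[where x = "\<lambda>X. mon I E X * g' X + g X * f' X"])
qed

lemma leading_one: "leading I w (\<lambda>_. 0) (\<lambda>X. 1)"
  unfolding leading_def by (intro bexI[OF _ mspan.zero]) (simp add: mon_def)

lemma leading_prod:
  assumes "finite S" "\<And>s. s \<in> S \<Longrightarrow> leading I w (E s) (f s)"
  shows "leading I w (\<lambda>i. \<Sum>s\<in>S. E s i) (\<lambda>X. \<Prod>s\<in>S. f s X)"
  using assms by (induction S rule: finite_induct) (auto intro: leading_one leading_mult)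

lemma leading_power:
  assumes "leading I w E f"
  shows "leading I w (\<lambda>i. q * E i) (\<lambda>X. f X ^ q)"
  using leading_prod[of "{..<q}" I w "\<lambda>_. E" "\<lambda>_. f"] assms by simp

lemma leading_polys: "leading I w E f \<Longrightarrow> f \<in> polys I"
  unfolding leading_def by (auto intro!: mspan_add mspan_mon elim: mspan_polys)

lemma leading_cong:
  assumes "leading I w E f" "\<And>i. i \<in> I \<Longrightarrow> E i = E' i"
  shows "leading I w E' f"
proof -
  have "mon I E = (mon I E' :: ('a \<Rightarrow> 'b) \<Rightarrow> 'b)" "(\<Sum>i\<in>I. E i) = (\<Sum>i\<in>I. E' i)"
    "(\<Sum>i\<in>I. w i * E i) = (\<Sum>i\<in>I. w i * E' i)"
    using assms(2) by (auto simp: mon_def fun_eq_iff intro!: sum.cong prod.cong)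
  then show ?thesis using assms(1) by (simp add: leading_def)
qed

text \<open>Twice the difference of the two sums is the sum of the squares of \<open>u\<close> minus
  its image: sums of the images and of their squares are invariant under the permutation, so the
  offsets \<open>r\<close> and \<open>c\<close> cancel. The sum is positive as some point
  moves.\<close>

lemma rearrangement_strict:
  fixes \<sigma> :: "nat \<Rightarrow> nat"
  assumes \<sigma>: "\<sigma> permutes {0..<k}" and "\<sigma> \<noteq> id"
  shows "(\<Sum>u = 0..<k. (r + u) * (c + \<sigma> u)) < (\<Sum>u = 0..<k. (r + u) * (c + u))"
proof -
  have S1: "(\<Sum>u = 0..<k. int (\<sigma> u)) = (\<Sum>u = 0..<k. int u)"
    using sum.permute[OF \<sigma>, of int] by (simp add: o_def)
  have S2: "(\<Sum>u = 0..<k. int (\<sigma> u) ^ 2) = (\<Sum>u = 0..<k. int u ^ 2)"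
    using sum.permute[OF \<sigma>, of "\<lambda>u. int u ^ 2"] by (simp add: o_def)
  obtain v where v: "\<sigma> v \<noteq> v" using assms(2) by (auto simp: fun_eq_iff)
  then have "v \<in> {0..<k}" using \<sigma> by (meson permutes_not_in)
  then have "0 < (\<Sum>u = 0..<k. (int u - int (\<sigma> u)) ^ 2)"
    using v by (intro sum_pos2[of _ v]) auto
  also have "\<dots> = (\<Sum>u = 0..<k. 2 * ((int r + int u) * (int c + int u)) - 2 * ((int r + int u) * (int c + int (\<sigma> u)))
      + (2 * int r) * (int (\<sigma> u) - int u) + (int (\<sigma> u) ^ 2 - int u ^ 2))"
    by (intro sum.cong) (auto simp: algebra_simps power2_eq_square)
  also have "\<dots> = 2 * (\<Sum>u = 0..<k. (int r + int u) * (int c + int u)) - 2 * (\<Sum>u = 0..<k. (int r + int u) * (int c + int (\<sigma> u)))"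
    by (simp add: sum.distrib sum_subtractf S1 S2 flip: sum_distrib_left)
  finally have "(\<Sum>u = 0..<k. (int r + int u) * (int c + int (\<sigma> u))) < (\<Sum>u = 0..<k. (int r + int u) * (int c + int u))"
    by simp
  also have "(\<Sum>u = 0..<k. (int r + int u) * (int c + int (\<sigma> u))) = int (\<Sum>u = 0..<k. (r + u) * (c + \<sigma> u))"
    by simp
  also have "(\<Sum>u = 0..<k. (int r + int u) * (int c + int u)) = int (\<Sum>u = 0..<k. (r + u) * (c + u))"
    by simp
  finally show ?thesis by linarith
qed

section \<open>Contiguous minors and their leading monomials\<close>

definition grid :: "nat \<Rightarrow> nat \<Rightarrow> (nat \<times> nat) set" where
  "grid n M = {..<n} \<times> {..<M}"

lemma finite_grid: "finite (grid n M)"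
  by (simp add: grid_def)

definition minor :: "nat \<Rightarrow> nat \<Rightarrow> nat \<Rightarrow> (nat \<times> nat \<Rightarrow> 'k::comm_ring_1) \<Rightarrow> 'k" where
  "minor r c k X = dmat k (\<lambda>u v. X (r + u, c + v))"

text \<open>With weight \<open>a * j\<close> on the variable at \<open>(a, j)\<close>, the
  rearrangement inequality makes the identity permutation dominate the Leibniz expansion. The
  equation \<open>j + r = c + a\<close> describes the main diagonal of the minor without truncated
  subtraction.\<close>

lemma minor_leading:
  assumes "r + k \<le> n" "c + k \<le> M"
  shows "leading (grid n M) (\<lambda>(a, j). a * j)
    (\<lambda>(a, j). if r \<le> a \<and> a < r + k \<and> j + r = c + a then 1 else 0)
    (minor r c k :: (nat \<times> nat \<Rightarrow> 'k::comm_ring_1) \<Rightarrow> 'k)"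
proof -
  let ?I = "grid n M" and ?w = "\<lambda>(a, j). a * j :: nat"
  \<comment> \<open>\<open>D\<close> collects the cells chosen by a permutation, and
    \<open>E\<close> is its indicator, the exponent of the corresponding Leibniz term.\<close>
  define D where "D \<sigma> = (\<lambda>u. (r + u, c + \<sigma> u)) ` {0..<k}" for \<sigma> :: "nat \<Rightarrow> nat"
  define E where "E \<sigma> i = (if i \<in> D \<sigma> then 1 else 0 :: nat)" for \<sigma> i
  have inj: "inj_on (\<lambda>u. (r + u, c + \<sigma> u)) {0..<k}" for \<sigma> :: "nat \<Rightarrow> nat"
    by (auto simp: inj_on_def)
  have sub: "D \<sigma> \<subseteq> ?I" if "\<sigma> permutes {0..<k}" for \<sigma>
  proof
    fix i assume "i \<in> D \<sigma>"
    then obtain u where "u < k" "i = (r + u, c + \<sigma> u)" by (auto simp: D_def)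
    moreover from this have "\<sigma> u < k" using permutes_in_image[OF that, of u] by simp
    ultimately show "i \<in> ?I" using assms by (simp add: grid_def)
  qed
  have mon: "mon ?I (E \<sigma>) X = (\<Prod>u = 0..<k. X (r + u, c + \<sigma> u))"
    if "\<sigma> permutes {0..<k}" for \<sigma> and X :: "nat \<times> nat \<Rightarrow> 'k"
  proof -
    have "mon ?I (E \<sigma>) X = (\<Prod>i\<in>D \<sigma>. X i ^ E \<sigma> i)"
      unfolding mon_def by (rule prod.mono_neutral_right[OF finite_grid sub[OF that]]) (simp add: E_def)
    also have "\<dots> = (\<Prod>i\<in>D \<sigma>. X i)" by (simp add: E_def)
    also have "\<dots> = (\<Prod>u = 0..<k. X (r + u, c + \<sigma> u))"
      unfolding D_def by (subst prod.reindex[OF inj]) simp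
    finally show ?thesis .
  qed
  have sum: "(\<Sum>i\<in>?I. f i * E \<sigma> i) = (\<Sum>u = 0..<k. f (r + u, c + \<sigma> u))"
    if "\<sigma> permutes {0..<k}" for \<sigma> and f :: "nat \<times> nat \<Rightarrow> nat"
  proof -
    have "(\<Sum>i\<in>?I. f i * E \<sigma> i) = (\<Sum>i\<in>D \<sigma>. f i * E \<sigma> i)"
      by (rule sum.mono_neutral_right[OF finite_grid sub[OF that]]) (simp add: E_def)
    also have "\<dots> = (\<Sum>i\<in>D \<sigma>. f i)" by (simp add: E_def)
    also have "\<dots> = (\<Sum>u = 0..<k. f (r + u, c + \<sigma> u))"
      unfolding D_def by (subst sum.reindex[OF inj]) simp
    finally show ?thesis .
  qed
  have deg: "(\<Sum>i\<in>?I. E \<sigma> i) = k" if "\<sigma> permutes {0..<k}" for \<sigma>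
    using sum[OF that, of "\<lambda>_. 1"] by simp
  have wt: "(\<Sum>i\<in>?I. ?w i * E \<sigma> i) = (\<Sum>u = 0..<k. (r + u) * (c + \<sigma> u))"
    if "\<sigma> permutes {0..<k}" for \<sigma>
    using sum[OF that, of ?w] by simp
  let ?P = "\<lambda>E'. (\<Sum>i\<in>?I. E' i) = (\<Sum>i\<in>?I. E id i) \<and> (\<Sum>i\<in>?I. ?w i * E' i) < (\<Sum>i\<in>?I. ?w i * E id i)"
  let ?g = "\<lambda>X :: nat \<times> nat \<Rightarrow> 'k. \<Sum>\<sigma> \<in> {\<sigma>. \<sigma> permutes {0..<k}} - {id}. signof \<sigma> * mon ?I (E \<sigma>) X"
  have g: "?g \<in> mspan ?I ?P"
  proof (rule mspan_sum, rule mspan_term)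
    fix \<sigma> assume "\<sigma> \<in> {\<sigma>. \<sigma> permutes {0..<k}} - {id}"
    then have \<sigma>: "\<sigma> permutes {0..<k}" "\<sigma> \<noteq> id" by auto
    show "?P (E \<sigma>)"
      unfolding deg[OF \<sigma>(1)] deg[OF permutes_id] wt[OF \<sigma>(1)] wt[OF permutes_id]
      using rearrangement_strict[OF \<sigma>, of r c] by simp
  qed
  have "minor r c k X = mon ?I (E id) X + ?g X" for X :: "nat \<times> nat \<Rightarrow> 'k"
  proof -
    have "minor r c k X = (\<Sum>\<sigma> | \<sigma> permutes {0..<k}. signof \<sigma> * mon ?I (E \<sigma>) X)"
      unfolding minor_def dmat_leibniz by (intro sum.cong) (auto simp: mon)
    also have "\<dots> = signof id * mon ?I (E id) X + ?g X"
      by (rule sum.remove) (auto simp: finite_permutations permutes_id)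
    finally show ?thesis by simp
  qed
  then have "leading ?I ?w (E id) (minor r c k :: (nat \<times> nat \<Rightarrow> 'k) \<Rightarrow> 'k)"
    unfolding leading_def using g by (intro bexI[of _ ?g]) auto
  moreover have "E id i = (case i of (a, j) \<Rightarrow> if r \<le> a \<and> a < r + k \<and> j + r = c + a then 1 else 0)" for i
  proof (cases i)
    case (Pair a j)
    have "(a, j) \<in> D id \<longleftrightarrow> r \<le> a \<and> a < r + k \<and> j + r = c + a"
      unfolding D_def by (auto simp: image_iff intro!: bexI[of _ "a - r"])
    then show ?thesis by (simp add: E_def Pair)
  qed
  ultimately show ?thesis by (rule leading_cong)
qed

lemma minor_polys:
  "r + k \<le> n \<Longrightarrow> c + k \<le> M \<Longrightarrow> minor r c k \<in> polys (grid n M)"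
  by (rule leading_polys[OF minor_leading])

text \<open>One factor for each diagonal of the \<open>n \<times> M\<close> matrix of variables: the largest minor which has
  it as its main diagonal.\<close>

definition corner_product :: "nat \<Rightarrow> nat \<Rightarrow> (nat \<times> nat \<Rightarrow> 'k::comm_ring_1) \<Rightarrow> 'k" where
  "corner_product n M X =
    (\<Prod>r\<in>{1..<n}. minor 0 (M - r) r X * minor r 0 (n - r) X) * (\<Prod>c\<le>M - n. minor 0 c n X)"

text \<open>The main diagonals of the minors partition the grid. A cell with \<open>a > j\<close>
  lies on the one for \<open>r = a - j\<close>, a cell with \<open>j - a > M - n\<close> on the one
  for \<open>r = M + a - j\<close>, and any other cell on the one for
  \<open>c = j - a\<close>.\<close>

lemma corner_product_leading:
  assumes "n \<le> M"
  shows "leading (grid n M) (\<lambda>(a, j). a * j) (\<lambda>_. 1)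
    (corner_product n M :: (nat \<times> nat \<Rightarrow> 'k::comm_ring_1) \<Rightarrow> 'k)"
proof -
  let ?E = "\<lambda>r c k. \<lambda>(a, j). if r \<le> a \<and> a < r + k \<and> j + r = c + a then 1 else 0 :: nat"
  have "leading (grid n M) (\<lambda>(a, j). a * j)
      (\<lambda>i. (\<Sum>r\<in>{1..<n}. ?E 0 (M - r) r i + ?E r 0 (n - r) i) + (\<Sum>c\<in>{..M - n}. ?E 0 c n i))
      (corner_product n M :: (nat \<times> nat \<Rightarrow> 'k) \<Rightarrow> 'k)"
    unfolding corner_product_def[abs_def]
    by (intro leading_mult leading_prod minor_leading) (use assms in auto)
  then show ?thesis
  proof (rule leading_cong)
    fix i assume "i \<in> grid n M"
    then obtain a j where i: "i = (a, j)" "a < n" "j < M" by (auto simp: grid_def)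
    have "0 \<le> a \<and> a < 0 + r \<and> j + 0 = M - r + a \<longleftrightarrow> r = M + a - j" if "r \<in> {1..<n}" for r
      using i(2,3) assms that by auto
    then have "(\<Sum>r\<in>{1..<n}. ?E 0 (M - r) r i) = (\<Sum>r\<in>{1..<n}. if r = M + a - j then 1 else 0)"
      unfolding i(1) prod.case by (intro sum.cong) (simp_all only:)
    moreover have "r \<le> a \<and> a < r + (n - r) \<and> j + r = 0 + a \<longleftrightarrow> r = a - j" if "r \<in> {1..<n}" for r
      using i(2,3) assms that by auto
    then have "(\<Sum>r\<in>{1..<n}. ?E r 0 (n - r) i) = (\<Sum>r\<in>{1..<n}. if r = a - j then 1 else 0)"
      unfolding i(1) prod.case by (intro sum.cong) (simp_all only:)
    \<comment> \<open>For cells with \<open>a > j\<close> the default \<open>M\<close> matches no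
      \<open>c\<close>: it exceeds \<open>M - n\<close>, since \<open>n\<close> is positive once a
      row \<open>a < n\<close> exists.\<close>
    moreover have "0 \<le> a \<and> a < 0 + n \<and> j + 0 = c + a \<longleftrightarrow> c = (if a \<le> j then j - a else M)" if "c \<in> {..M - n}" for c
      using i(2,3) assms that by auto
    then have "(\<Sum>c\<in>{..M - n}. ?E 0 c n i) = (\<Sum>c\<in>{..M - n}. if c = (if a \<le> j then j - a else M) then 1 else 0)"
      unfolding i(1) prod.case by (intro sum.cong) (simp_all only:)
    ultimately show "(\<Sum>r\<in>{1..<n}. ?E 0 (M - r) r i + ?E r 0 (n - r) i) + (\<Sum>c\<in>{..M - n}. ?E 0 c n i) = 1"
      unfolding sum.distrib sum.delta[OF finite_atLeastLessThan] sum.delta[OF finite_atMost]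
      using i(2,3) assms by (simp only: atLeastLessThan_iff atMost_iff split: if_split) linarith
  qed
qed

section \<open>Rotations of two rows\<close>

lemma two_neq_0:
  assumes "CHAR('k::field) > 2"
  shows "(2::'k) \<noteq> 0"
proof
  assume "(2::'k) = 0"
  then have "CHAR('k) dvd 2" using of_nat_eq_0_iff_char_dvd[of 2, where 'a = 'k] by simp
  then show False using assms by (auto dest: dvd_imp_le)
qed

definition rotate_rows ::
  "nat \<Rightarrow> 'k \<Rightarrow> 'k \<Rightarrow> (nat \<times> nat \<Rightarrow> 'k) \<Rightarrow> nat \<times> nat \<Rightarrow> 'k::comm_ring_1" where
  "rotate_rows i c s X = (\<lambda>(a, j). if a = i then c * X (i, j) - s * X (Suc i, j)
     else if a = Suc i then s * X (i, j) + c * X (Suc i, j) else X (a, j))"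

lemma minor_rotate_same:
  assumes "\<not> (r \<le> i \<and> i < r + k)" "\<not> (r \<le> Suc i \<and> Suc i < r + k)"
  shows "minor r c k (rotate_rows i x y X) = minor r c k X"
  unfolding minor_def by (rule dmat_cong) (use assms in \<open>auto simp: rotate_rows_def\<close>)

lemma minor_rotate_both:
  assumes "r \<le> i" "Suc i < r + k" "x * x + y * y = 1"
  shows "minor r c k (rotate_rows i x y X) = minor r c k X"
proof -
  let ?A = "\<lambda>u v. X (r + u, c + v)"
  have "minor r c k (rotate_rows i x y X) =
      dmat k (?A(i - r := (\<lambda>v. x * ?A (i - r) v - y * ?A (Suc i - r) v),
        Suc i - r := (\<lambda>v. y * ?A (i - r) v + x * ?A (Suc i - r) v)))"
    unfolding minor_def by (rule dmat_cong) (use assms in \<open>auto simp: rotate_rows_def\<close>)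
  also have "\<dots> = minor r c k X"
    using assms unfolding minor_def by (subst dmat_rotate_rows) auto
  finally show ?thesis .
qed

text \<open>Of the rotated rows only row \<open>i\<close> belongs to this minor, as its last one. By
  linearity in that row, \<open>D\<close> is the negative of the determinant with row
  \<open>i\<close> replaced by row \<open>Suc i\<close>.\<close>

lemma minor_rotate_last:
  assumes "Suc i < n" "c + Suc i \<le> M"
  shows "\<exists>D\<in>polys (grid n M). \<forall>x y X. minor 0 c (Suc i) (rotate_rows i x y X) =
    x * minor 0 c (Suc i) X + y * (D X :: 'k::comm_ring_1)"
proof -
  let ?A = "\<lambda>X :: nat \<times> nat \<Rightarrow> 'k. \<lambda>u v. X (u, c + v)"
  let ?D = "\<lambda>X. (- 1) * dmat (Suc i) ((?A X)(i := ?A X (Suc i)))"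
  have "?D \<in> polys (grid n M)"
  proof (rule mspan_cmult, rule dmat_polys)
    fix u v assume "u < Suc i" "v < Suc i"
    then have "(if u = i then Suc i else u, c + v) \<in> grid n M"
      using assms by (auto simp: grid_def)
    from coord_polys[OF finite_grid this]
    show "(\<lambda>X. ((?A X)(i := ?A X (Suc i))) u v) \<in> polys (grid n M)"
      by (cases "u = i") auto
  qed
  moreover have "minor 0 c (Suc i) (rotate_rows i x y X) = x * minor 0 c (Suc i) X + y * ?D X" for x y X
  proof -
    have "minor 0 c (Suc i) (rotate_rows i x y X) =
        dmat (Suc i) ((?A X)(i := (\<lambda>v. x * ?A X i v + (- y) * ?A X (Suc i) v)))"
      unfolding minor_def by (rule dmat_cong) (auto simp: rotate_rows_def)
    also have "\<dots> = x * dmat (Suc i) ((?A X)(i := ?A X i)) + (- y) * dmat (Suc i) ((?A X)(i := ?A X (Suc i)))"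
      by (rule dmat_row_linear) simp
    finally have 1: "minor 0 c (Suc i) (rotate_rows i x y X) = \<dots>" .
    have 2: "minor 0 c (Suc i) X = dmat (Suc i) ((?A X)(i := ?A X i))"
      unfolding minor_def by (rule dmat_cong) auto
    show ?thesis unfolding 1 2 by (simp only: mult_minus_left mult_minus_right mult_1_left)
  qed
  ultimately show ?thesis by (intro bexI[where x = ?D]) simp_all
qed

text \<open>Here only row \<open>Suc i\<close> belongs to the minor, as its first one;
  \<open>D\<close> is the determinant with that row replaced by row \<open>i\<close>.\<close>

lemma minor_rotate_first:
  assumes "Suc i < n" "c + (n - Suc i) \<le> M"
  shows "\<exists>D\<in>polys (grid n M). \<forall>x y X. minor (Suc i) c (n - Suc i) (rotate_rows i x y X) =
    x * minor (Suc i) c (n - Suc i) X + y * (D X :: 'k::comm_ring_1)"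
proof -
  let ?k = "n - Suc i"
  let ?A = "\<lambda>X :: nat \<times> nat \<Rightarrow> 'k. \<lambda>u v. X (Suc i + u, c + v)"
  let ?D = "\<lambda>X. dmat ?k ((?A X)(0 := \<lambda>v. X (i, c + v)))"
  have "?D \<in> polys (grid n M)"
  proof (rule dmat_polys)
    fix u v assume "u < ?k" "v < ?k"
    then have "(if u = 0 then i else Suc i + u, c + v) \<in> grid n M"
      using assms by (auto simp: grid_def)
    from coord_polys[OF finite_grid this]
    show "(\<lambda>X. ((?A X)(0 := \<lambda>v. X (i, c + v))) u v) \<in> polys (grid n M)"
      by (cases "u = 0") auto
  qed
  moreover have "minor (Suc i) c ?k (rotate_rows i x y X) = x * minor (Suc i) c ?k X + y * ?D X" for x y X
  proof -
    have "minor (Suc i) c ?k (rotate_rows i x y X) =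
        dmat ?k ((?A X)(0 := (\<lambda>v. x * ?A X 0 v + y * X (i, c + v))))"
      unfolding minor_def by (rule dmat_cong) (auto simp: rotate_rows_def)
    also have "\<dots> = x * dmat ?k ((?A X)(0 := ?A X 0)) + y * dmat ?k ((?A X)(0 := \<lambda>v. X (i, c + v)))"
      by (rule dmat_row_linear) (use assms in simp)
    finally have 1: "minor (Suc i) c ?k (rotate_rows i x y X) = \<dots>" .
    have 2: "minor (Suc i) c ?k X = dmat ?k ((?A X)(0 := ?A X 0))"
      unfolding minor_def by (rule dmat_cong) auto
    show ?thesis unfolding 1 2 by (rule refl)
  qed
  ultimately show ?thesis by (intro bexI[where x = ?D]) simp_all
qed

lemma rotate_rows_linear:
  fixes x y :: "'k::comm_ring_1"
  assumes "Suc i < n" "e \<in> grid n M"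
  shows "(\<lambda>X. rotate_rows i x y X e) \<in> mspan (grid n M) (hom_deg (grid n M) 1)"
proof -
  obtain a j where e: "e = (a, j)" "a < n" "j < M" using assms(2) by (auto simp: grid_def)
  have co: "(\<lambda>X :: nat \<times> nat \<Rightarrow> 'k. X (b, j)) \<in> mspan (grid n M) (hom_deg (grid n M) 1)" if "b < n" for b
    using that e(3) by (intro coord_hom finite_grid) (auto simp: grid_def)
  have lin: "(\<lambda>X :: nat \<times> nat \<Rightarrow> 'k. z * X (i, j) + w * X (Suc i, j)) \<in> mspan (grid n M) (hom_deg (grid n M) 1)" for z w
    using assms(1) by (intro mspan_add mspan_cmult co) auto
  show ?thesis
    using lin[of x "- y"] lin[of y x] co[OF e(2)]
    by (cases "a = i"; cases "a = Suc i") (auto simp: rotate_rows_def e(1))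
qed

lemma rotate_rows_rotate_rows:
  "rotate_rows i c s (rotate_rows i c' s' X) = rotate_rows i (c * c' - s * s') (c * s' + s * c') X"
  by (auto simp: rotate_rows_def fun_eq_iff algebra_simps)

text \<open>A coordinate reflection, hence of determinant -1 on each column. It serves only to
  invert rotations by conjugation.\<close>

definition flip_row :: "nat \<Rightarrow> (nat \<times> nat \<Rightarrow> 'k) \<Rightarrow> nat \<times> nat \<Rightarrow> 'k::comm_ring_1" where
  "flip_row i X = (\<lambda>(a, j). if a = i then - X (a, j) else X (a, j))"

lemma flip_row_linear:
  fixes i :: nat
  assumes "e \<in> grid n M"
  shows "(\<lambda>X :: nat \<times> nat \<Rightarrow> 'k::comm_ring_1. flip_row i X e) \<in> mspan (grid n M) (hom_deg (grid n M) 1)"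
proof -
  obtain a j where e: "e = (a, j)" by (cases e)
  have "(\<lambda>X :: nat \<times> nat \<Rightarrow> 'k. X e) \<in> mspan (grid n M) (hom_deg (grid n M) 1)"
    by (rule coord_hom[OF finite_grid assms])
  from this mspan_cmult[OF this, of "- 1"] show ?thesis
    by (cases "a = i") (auto simp: flip_row_def e)
qed

lemma flip_row_flip_row: "flip_row i (flip_row i X) = X"
  by (auto simp: flip_row_def fun_eq_iff)

lemma flip_rotate_flip:
  "flip_row (Suc i) (rotate_rows i c s (flip_row (Suc i) X)) = rotate_rows i c (- s) X"
  by (auto simp: flip_row_def rotate_rows_def fun_eq_iff)

text \<open>The rotations of a plane form a one-dimensional torus; \<open>torus_cos\<close> and \<open>torus_sin\<close>
  parametrize it by means of a square root \<open>\<iota>\<close> of \<open>-1\<close>.\<close>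

definition torus_cos :: "'k::field \<Rightarrow> 'k" where "torus_cos t = (t + inverse t) / 2"
definition torus_sin :: "'k::field \<Rightarrow> 'k \<Rightarrow> 'k" where "torus_sin \<iota> t = (t - inverse t) / (2 * \<iota>)"

context
  fixes \<iota> :: "'k::field"
  assumes iota: "\<iota> * \<iota> = - 1" and two: "(2::'k) \<noteq> 0"
begin

lemma iota_neq_0: "\<iota> \<noteq> 0"
proof
  assume "\<iota> = 0"
  with iota show False by simp
qed

lemma inverse_iota: "inverse \<iota> = - \<iota>"
proof (rule inverse_unique)
  show "\<iota> * - \<iota> = 1" unfolding mult_minus_right iota by (rule minus_minus)
qed

lemma torus_sin_eq: "torus_sin \<iota> t = - \<iota> * ((t - inverse t) / 2)"
proof -
  have "torus_sin \<iota> t = inverse \<iota> * ((t - inverse t) / 2)"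
    by (simp only: torus_sin_def divide_inverse inverse_mult_distrib ac_simps)
  then show ?thesis by (simp only: inverse_iota)
qed

text \<open>These are the addition formulas for hyperbolic cosine and sine, written with half sums
  and half differences.\<close>

lemma halves_mult:
  "(x + x') / 2 * ((y + y') / 2) + (x - x') / 2 * ((y - y') / 2) = (x * y + x' * y') / (2::'k)"
  "(x + x') / 2 * ((y - y') / 2) + (x - x') / 2 * ((y + y') / 2) = (x * y - x' * y') / (2::'k)"
proof -
  have 4: "(2 * z) / (2 * 2) = z / 2" for z :: 'k
    by (rule mult_divide_mult_cancel_left) (rule two)
  have "(x + x') / 2 * ((y + y') / 2) + (x - x') / 2 * ((y - y') / 2) =
      ((x + x') * (y + y') + (x - x') * (y - y')) / (2 * 2)"
    by (simp only: times_divide_times_eq add_divide_distrib[symmetric])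
  also have "(x + x') * (y + y') + (x - x') * (y - y') = 2 * (x * y + x' * y')"
    unfolding mult_2 by (simp add: ring_distribs)
  finally show "(x + x') / 2 * ((y + y') / 2) + (x - x') / 2 * ((y - y') / 2) = (x * y + x' * y') / (2::'k)"
    unfolding 4 .
  have "(x + x') / 2 * ((y - y') / 2) + (x - x') / 2 * ((y + y') / 2) =
      ((x + x') * (y - y') + (x - x') * (y + y')) / (2 * 2)"
    by (simp only: times_divide_times_eq add_divide_distrib[symmetric])
  also have "(x + x') * (y - y') + (x - x') * (y + y') = 2 * (x * y - x' * y')"
    unfolding mult_2 by (simp add: ring_distribs)
  finally show "(x + x') / 2 * ((y - y') / 2) + (x - x') / 2 * ((y + y') / 2) = (x * y - x' * y') / (2::'k)"
    unfolding 4 .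
qed

lemma torus_mult:
  "torus_cos t * torus_cos u - torus_sin \<iota> t * torus_sin \<iota> u = torus_cos (t * u)"
  "torus_cos t * torus_sin \<iota> u + torus_sin \<iota> t * torus_cos u = torus_sin \<iota> (t * u)"
proof -
  have 1: "- \<iota> * b * (- \<iota> * b') = (\<iota> * \<iota>) * (b * b')" for b b' by simp
  have 2: "a * (- \<iota> * b') + - \<iota> * b * a' = - \<iota> * (a * b' + b * a')" for a b a' b'
    by (simp only: distrib_left mult.assoc mult.left_commute[of a])
  show "torus_cos t * torus_cos u - torus_sin \<iota> t * torus_sin \<iota> u = torus_cos (t * u)"
    unfolding torus_sin_eq torus_cos_def 1 iota mult_minus1 diff_minus_eq_add halves_mult
      inverse_mult_distrib ..
  show "torus_cos t * torus_sin \<iota> u + torus_sin \<iota> t * torus_cos u = torus_sin \<iota> (t * u)"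
    unfolding torus_sin_eq torus_cos_def 2 halves_mult inverse_mult_distrib ..
qed

lemma torus_1: "torus_cos 1 = (1::'k)" "torus_sin \<iota> 1 = 0"
  using two by (auto simp: torus_cos_def torus_sin_def)

lemma torus_inverse: "torus_cos (inverse t) = (torus_cos t :: 'k)" "torus_sin \<iota> (inverse t) = - torus_sin \<iota> t"
proof -
  show "torus_cos (inverse t) = (torus_cos t :: 'k)" by (simp add: torus_cos_def add.commute)
  have "inverse t - t = - (t - inverse t)" by simp
  then show "torus_sin \<iota> (inverse t) = - torus_sin \<iota> t"
    unfolding torus_sin_def inverse_inverse_eq by (simp only: minus_divide_left)
qed

lemma torus_norm:
  assumes "t \<noteq> 0"
  shows "torus_cos t * torus_cos t + torus_sin \<iota> t * torus_sin \<iota> t = 1"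
  using torus_mult(1)[of t "inverse t"] assms by (simp add: torus_inverse torus_1)

text \<open>As in Euler's formula, the parameter is \<open>c\<close> plus iota times
  \<open>s\<close>; by the norm condition its inverse is the conjugate \<open>c\<close> minus iota
  times \<open>s\<close>.\<close>

lemma torus_surj:
  assumes "c * c + s * s = 1"
  shows "\<exists>t. t \<noteq> 0 \<and> torus_cos t = c \<and> torus_sin \<iota> t = s"
proof (intro exI conjI)
  let ?t = "c + \<iota> * s"
  have *: "?t * (c - \<iota> * s) = 1"
  proof -
    have "?t * (c - \<iota> * s) = c * c - (\<iota> * \<iota>) * (s * s)" by (simp add: algebra_simps)
    then show ?thesis using assms by (simp add: iota)
  qed
  then show "?t \<noteq> 0" by auto
  have inv: "inverse ?t = c - \<iota> * s" using * by (rule inverse_unique)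
  show "torus_cos ?t = c" unfolding torus_cos_def inv using two by simp
  show "torus_sin \<iota> ?t = s" unfolding torus_sin_def inv using two iota_neq_0 by simp
qed

text \<open>The decomposition into components of torus weight 1 and -1. The extra factor
  \<open>t\<close> clears the negative power, so that only the square of \<open>t\<close> occurs on
  the right.\<close>

lemma torus_weight:
  assumes "t \<noteq> 0"
  shows "t * (torus_cos t * a + torus_sin \<iota> t * b) = t\<^sup>2 * ((a - \<iota> * b) / 2) + (a + \<iota> * b) / 2"
proof -
  have "t * torus_cos t = (t\<^sup>2 + 1) / 2"
    unfolding torus_cos_def
    by (simp only: times_divide_eq_right distrib_left right_inverse[OF assms] power2_eq_square)
  moreover have "t * torus_sin \<iota> t = - \<iota> * (t * ((t - inverse t) / 2))"
    unfolding torus_sin_eq by (rule mult.left_commute)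
  then have "t * torus_sin \<iota> t = (- \<iota> * (t\<^sup>2 - 1)) / 2"
    by (simp only: times_divide_eq_right right_diff_distrib right_inverse[OF assms] power2_eq_square)
  ultimately have "t * (torus_cos t * a + torus_sin \<iota> t * b) = (t\<^sup>2 + 1) / 2 * a + (- \<iota> * (t\<^sup>2 - 1)) / 2 * b"
    by (simp only: distrib_left mult.assoc[symmetric])
  also have "\<dots> = ((t\<^sup>2 + 1) * a + (- \<iota> * (t\<^sup>2 - 1)) * b) / 2"
    by (simp only: times_divide_eq_left add_divide_distrib[symmetric])
  also have "(T + 1) * a + (- \<iota> * (T - 1)) * b = T * (a - \<iota> * b) + (a + \<iota> * b)" for T
    by (simp add: ring_distribs)
  finally show ?thesis unfolding add_divide_distrib times_divide_eq_right[symmetric] .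
qed

end

section \<open>Rotation invariance of the Frobenius trace\<close>

text \<open>In the application \<open>T\<close> is the square of the torus parameter, and the
  coefficients separate the torus weights of a power of the corner product, shifted to be
  nonnegative.\<close>

definition poly_family :: "'i set \<Rightarrow> nat \<Rightarrow> ('k \<Rightarrow> ('i \<Rightarrow> 'k) \<Rightarrow> 'k::comm_ring_1) \<Rightarrow> bool" where
  "poly_family I d G \<longleftrightarrow> (\<exists>F. (\<forall>k. F k \<in> polys I) \<and> (\<forall>T X. G T X = (\<Sum>k\<le>d. T ^ k * F k X)))"

lemma poly_family_const: "C \<in> polys I \<Longrightarrow> poly_family I 0 (\<lambda>T. C)"
  unfolding poly_family_def by (intro exI[of _ "\<lambda>_. C"]) simp

lemma poly_family_linear_mult:
  assumes "poly_family I d G" "A \<in> polys I" "B \<in> polys I"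
  shows "poly_family I (Suc d) (\<lambda>T X. (A X + T * B X) * G T X)"
proof -
  obtain F where F: "\<And>k. F k \<in> polys I" "\<And>T X. G T X = (\<Sum>k\<le>d. T ^ k * F k X)"
    using assms(1) by (auto simp: poly_family_def)
  \<comment> \<open>Coefficient \<open>k\<close> of the product is \<open>A\<close> times
    \<open>F k\<close> plus \<open>B\<close> times the preceding coefficient, with \<open>F\<close>
    read as zero outside the range up to \<open>d\<close>.\<close>
  define F' where "F' k = (\<lambda>X. (if k \<le> d then A X * F k X else 0) + (case k of 0 \<Rightarrow> 0 | Suc l \<Rightarrow> B X * F l X))" for k
  have "F' k \<in> polys I" for k
    unfolding F'_def using assms(2,3) F(1)
    by (cases k; cases "k \<le> d") (auto intro!: mspan_add polys_mult mspan.zero)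
  moreover have "(A X + T * B X) * G T X = (\<Sum>k\<le>Suc d. T ^ k * F' k X)" for T X
  proof -
    have "(\<Sum>k\<le>Suc d. T ^ k * F' k X) =
        (\<Sum>k\<le>Suc d. T ^ k * (if k \<le> d then A X * F k X else 0)) +
        (\<Sum>k\<le>Suc d. T ^ k * (case k of 0 \<Rightarrow> 0 | Suc l \<Rightarrow> B X * F l X))"
      by (simp only: F'_def distrib_left sum.distrib)
    also have "(\<Sum>k\<le>Suc d. T ^ k * (if k \<le> d then A X * F k X else 0)) = (\<Sum>k\<le>d. T ^ k * (A X * F k X))"
      by (simp only: sum.atMost_Suc) simp
    also have "(\<Sum>k\<le>Suc d. T ^ k * (case k of 0 \<Rightarrow> 0 | Suc l \<Rightarrow> B X * F l X)) =
        (\<Sum>k\<le>d. T ^ Suc k * (B X * F k X))"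
      by (simp only: sum.atMost_Suc_shift nat.case) simp
    finally show ?thesis
      unfolding F(2) distrib_right sum_distrib_left sum.distrib by (simp only: power_Suc ac_simps sum.distrib)
  qed
  ultimately show ?thesis unfolding poly_family_def by blast
qed

lemma poly_family_cmult:
  assumes "poly_family I d G" "C \<in> polys I"
  shows "poly_family I d (\<lambda>T X. C X * G T X)"
proof -
  obtain F where F: "\<And>k. F k \<in> polys I" "\<And>T X. G T X = (\<Sum>k\<le>d. T ^ k * F k X)"
    using assms(1) by (auto simp: poly_family_def)
  have "C X * G T X = (\<Sum>k\<le>d. T ^ k * (C X * F k X))" for T X
    unfolding F(2) by (simp only: sum_distrib_left mult.left_commute)
  then show ?thesis
    unfolding poly_family_def
    by (intro exI[of _ "\<lambda>k X. C X * F k X"]) (simp add: polys_mult[OF assms(2) F(1)])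
qed

lemma poly_family_power:
  assumes "C \<in> polys I" "A \<in> polys I" "B \<in> polys I" "A' \<in> polys I" "B' \<in> polys I"
  shows "poly_family I (2 * q) (\<lambda>T X. (C X * ((A X + T * B X) * (A' X + T * B' X))) ^ q)"
proof (induction q)
  case 0
  show ?case using poly_family_const[OF polys_const, of I 1] by simp
next
  case (Suc q)
  have "poly_family I (Suc (Suc (2 * q))) (\<lambda>T X. C X * ((A X + T * B X) * ((A' X + T * B' X) *
      (C X * ((A X + T * B X) * (A' X + T * B' X))) ^ q)))"
    by (intro poly_family_cmult poly_family_linear_mult Suc assms)
  then show ?case by (simp add: mult.assoc)
qed

text \<open>Only the two minors for \<open>r = Suc i\<close> contain exactly one row of the rotated
  plane; every other minor contains both or neither and is unchanged. Each of the two uses up one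
  factor \<open>t\<close> and becomes linear in the square of \<open>t\<close>.\<close>

lemma corner_product_rotate:
  fixes \<iota> :: "'k::field"
  assumes iota: "\<iota> * \<iota> = - 1" and two: "(2::'k) \<noteq> 0" and nM: "n \<le> M" and i: "Suc i < n"
  obtains C A B A' B' where "{C, A, B, A', B'} \<subseteq> polys (grid n M)"
    "\<And>t X. t \<noteq> 0 \<Longrightarrow> t\<^sup>2 * corner_product n M (rotate_rows i (torus_cos t) (torus_sin \<iota> t) X) =
      C X * ((A X + t\<^sup>2 * B X) * (A' X + t\<^sup>2 * B' X))"
proof -
  let ?I = "grid n M"
  let ?rot = "\<lambda>t. rotate_rows i (torus_cos t) (torus_sin \<iota> t)"
  let ?m = "minor 0 (M - Suc i) (Suc i) :: (nat \<times> nat \<Rightarrow> 'k) \<Rightarrow> 'k"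
  let ?m' = "minor (Suc i) 0 (n - Suc i) :: (nat \<times> nat \<Rightarrow> 'k) \<Rightarrow> 'k"
  let ?p = "\<lambda>r X. minor 0 (M - r) r X * minor r 0 (n - r) X :: 'k"
  let ?C = "\<lambda>X. (\<Prod>r\<in>{1..<n} - {Suc i}. ?p r X) * (\<Prod>c\<le>M - n. minor 0 c n X)"
  have "M - Suc i + Suc i \<le> M" "0 + (n - Suc i) \<le> M" using i nM by auto
  from minor_rotate_last[OF i this(1), where 'k = 'k] minor_rotate_first[OF i this(2), where 'k = 'k]
  obtain D D' where D: "D \<in> polys ?I" "\<And>x y X. ?m (rotate_rows i x y X) = x * ?m X + y * D X"
    and D': "D' \<in> polys ?I" "\<And>x y X. ?m' (rotate_rows i x y X) = x * ?m' X + y * D' X"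
    by blast
  have m: "?m \<in> polys ?I" "?m' \<in> polys ?I" using i nM by (auto intro!: minor_polys)
  have C: "?C \<in> polys ?I" using nM by (intro polys_mult polys_prod minor_polys) auto
  have split: "corner_product n M X = ?C X * (?m X * ?m' X)" for X
    unfolding corner_product_def using i
    by (subst prod.remove[of "{1..<n}" "Suc i"]) (simp_all add: mult.assoc mult.left_commute mult.commute)
  have inv: "?C (?rot t X) = ?C X" if "t \<noteq> 0" for t X
  proof (intro arg_cong2[of _ _ _ _ "(*)"] prod.cong refl)
    note norm = torus_norm[OF iota two that]
    fix r assume r: "r \<in> {1..<n} - {Suc i}"
    show "minor 0 (M - r) r (?rot t X) = minor 0 (M - r) r X"
    proof (cases "r \<le> i")
      case True
      then show ?thesis by (intro minor_rotate_same) auto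
    next
      case False
      then show ?thesis using r by (intro minor_rotate_both norm) auto
    qed
    show "minor r 0 (n - r) (?rot t X) = minor r 0 (n - r) X"
    proof (cases "r \<le> i")
      case True
      then show ?thesis using r i by (intro minor_rotate_both norm) auto
    next
      case False
      then show ?thesis using r by (intro minor_rotate_same) auto
    qed
  next
    show "minor 0 c n (?rot t X) = minor 0 c n X" for c
      using i by (intro minor_rotate_both torus_norm[OF iota two that]) auto
  qed
  have lin: "(\<lambda>X. (f X - \<iota> * g X) / 2) \<in> polys ?I" "(\<lambda>X. (f X + \<iota> * g X) / 2) \<in> polys ?I"
    if "f \<in> polys ?I" "g \<in> polys ?I" for f g
    using mspan_cmult[OF polys_diff[OF that(1) mspan_cmult[OF that(2), of \<iota>]], of "inverse 2"]
      mspan_cmult[OF mspan_add[OF that(1) mspan_cmult[OF that(2), of \<iota>]], of "inverse 2"]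
    unfolding divide_inverse by (simp_all only: mult.commute[of "inverse 2"])
  have "t\<^sup>2 * corner_product n M (?rot t X) = ?C X *
      (((?m X + \<iota> * D X) / 2 + t\<^sup>2 * ((?m X - \<iota> * D X) / 2)) *
       ((?m' X + \<iota> * D' X) / 2 + t\<^sup>2 * ((?m' X - \<iota> * D' X) / 2)))" if t: "t \<noteq> 0" for t X
  proof -
    have "t\<^sup>2 * corner_product n M (?rot t X) = ?C X * ((t * ?m (?rot t X)) * (t * ?m' (?rot t X)))"
      unfolding split inv[OF t] power2_eq_square by (simp only: ac_simps)
    then show ?thesis
      unfolding D(2) D'(2) torus_weight[OF iota two t] by (simp only: add.commute)
  qed
  then show ?thesis
    by (rule that[rotated]) (assumption, unfold insert_subset, intro conjI empty_subsetI C lin m D(1) D'(1))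
qed

text \<open>Every coordinate of the curve has at most a simple pole at zero, so a polynomial
  function along it is a Laurent polynomial, cleared by some power of \<open>t\<close>.\<close>

lemma polys_laurent_curve:
  fixes L :: "'k::field \<Rightarrow> 'i \<Rightarrow> 'k"
  assumes "finite I" "\<And>e. e \<in> I \<Longrightarrow> \<exists>Q. \<forall>t. t \<noteq> 0 \<longrightarrow> t * L t e = poly Q t" "b \<in> polys I"
  shows "\<exists>N Q. \<forall>t. t \<noteq> 0 \<longrightarrow> t ^ N * b (L t) = poly Q t"
  using assms(3)
proof (induction rule: mspan.induct)
  case (step f E c)
  obtain N Q where NQ: "\<And>t. t \<noteq> 0 \<Longrightarrow> t ^ N * f (L t) = poly Q t" using step.IH by blast
  obtain R where R: "\<And>e t. e \<in> I \<Longrightarrow> t \<noteq> 0 \<Longrightarrow> t * L t e = poly (R e) t"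
    using assms(2) by metis
  define d where "d = (\<Sum>e\<in>I. E e)"
  have mon: "t ^ d * mon I E (L t) = poly (\<Prod>e\<in>I. R e ^ E e) t" if "t \<noteq> 0" for t
  proof -
    have "t ^ d * mon I E (L t) = (\<Prod>e\<in>I. (t * L t e) ^ E e)"
      by (simp add: d_def mon_def power_sum power_mult_distrib prod.distrib)
    also have "\<dots> = (\<Prod>e\<in>I. poly (R e) t ^ E e)" using R[OF _ that] by (intro prod.cong) auto
    finally show ?thesis by (simp add: poly_prod)
  qed
  let ?S = "monom c N * (\<Prod>e\<in>I. R e ^ E e) + monom 1 d * Q"
  have "t ^ (d + N) * (c * mon I E (L t) + f (L t)) = poly ?S t" if "t \<noteq> 0" for t
  proof -
    have "t ^ (d + N) * (c * mon I E (L t) + f (L t)) =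
        c * t ^ N * (t ^ d * mon I E (L t)) + t ^ d * (t ^ N * f (L t))"
      by (simp only: power_add distrib_left ac_simps)
    then show ?thesis
      unfolding mon[OF that] NQ[OF that] by (simp add: poly_monom)
  qed
  then show ?case by blast
qed (auto intro: exI[of _ 0])

text \<open>Composition with \<open>x ^ p\<close> leaves only degrees divisible by \<open>p\<close>,
  by recursion as in Horner's scheme. This is the obstruction that kills weight components of the
  trace.\<close>

lemma coeff_pcompose_monom:
  fixes Q :: "'k::comm_ring_1 poly"
  assumes "coeff (pcompose Q (monom 1 p)) j \<noteq> 0"
  shows "p dvd j"
  using assms
proof (induction Q arbitrary: j)
  case (pCons a Q)
  show ?case
  proof (cases "p \<le> j")
    case True
    then have "coeff (pcompose (pCons a Q) (monom 1 p)) j = (if j = 0 then a else 0) + coeff (pcompose Q (monom 1 p)) (j - p)"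
      by (simp add: pcompose_pCons coeff_monom_mult coeff_pCons split: nat.split)
    then show ?thesis using pCons.prems pCons.IH[of "j - p"] True
      by (cases "j = 0") (auto simp: dvd_minus_self)
  next
    case False
    then have "coeff (pcompose (pCons a Q) (monom 1 p)) j = (if j = 0 then a else 0)"
      by (simp add: pcompose_pCons coeff_monom_mult coeff_pCons split: nat.split)
    then show ?thesis using pCons.prems by (cases "j = 0") auto
  qed
qed simp

context char_p
begin

lemma linear_subst_rotate: "Suc i < n \<Longrightarrow> linear_subst (grid n M) (rotate_rows i (x :: 'k) y)"
  unfolding linear_subst_def[OF finite_grid] using rotate_rows_linear by blast

text \<open>Conjugation by a flip inverts the rotations, so the factor is a character of order at most
  two of a group in which every element is a square.\<close>

lemma subst_factor_rotate:
  fixes \<iota> :: 'k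
  assumes iota: "\<iota> * \<iota> = - 1" and two: "(2::'k) \<noteq> 0" and i: "Suc i < n" and t: "t \<noteq> 0"
  shows "subst_factor (grid n M) (rotate_rows i (torus_cos t) (torus_sin \<iota> t)) = 1"
proof -
  let ?I = "grid n M"
  let ?rot = "\<lambda>t. rotate_rows i (torus_cos t) (torus_sin \<iota> t)"
  let ?\<chi> = "\<lambda>t. subst_factor ?I (?rot t)"
  let ?f = "flip_row (Suc i) :: (nat \<times> nat \<Rightarrow> 'k) \<Rightarrow> nat \<times> nat \<Rightarrow> 'k"
  note comp = subst_factor_comp[OF finite_grid]
  have lin: "linear_subst ?I (?rot t)" for t by (rule linear_subst_rotate[OF i])
  have flip: "linear_subst ?I ?f"
    unfolding linear_subst_def[OF finite_grid] using flip_row_linear by blast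
  have mult: "?\<chi> (u * v) = ?\<chi> u * ?\<chi> v" for u v
    unfolding comp[OF lin lin, symmetric] rotate_rows_rotate_rows torus_mult[OF iota two] ..
  have one: "?\<chi> 1 = 1"
    by (rule subst_factor_id[OF finite_grid])
      (auto simp: torus_1[OF iota two] rotate_rows_def)
  have "?\<chi> (inverse u) = subst_factor ?I ?f * (?\<chi> u * subst_factor ?I ?f)" for u
    unfolding comp[OF lin flip, symmetric]
      comp[OF flip linear_subst_comp[OF finite_grid lin flip], symmetric] flip_rotate_flip
      torus_inverse[OF iota two] ..
  moreover have "subst_factor ?I ?f * subst_factor ?I ?f = 1"
    unfolding comp[OF flip flip, symmetric] flip_row_flip_row by (rule subst_factor_id[OF finite_grid]) simp
  ultimately have inv: "?\<chi> (inverse u) = ?\<chi> u" for u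
    by (simp only: mult.left_commute[of "subst_factor ?I ?f" "?\<chi> u"] mult_1_right)
  obtain u :: 'k where u: "u ^ 2 = t" using nth_root_exists[of 2 t] by auto
  then have "u \<noteq> 0" using t by auto
  then have "?\<chi> u * ?\<chi> u = ?\<chi> (u * inverse u)" by (simp only: mult inv)
  also have "\<dots> = 1" unfolding right_inverse[OF \<open>u \<noteq> 0\<close>] by (rule one)
  finally show ?thesis using u mult[of u u] by (simp only: power2_eq_square)
qed

lemma frob_trace_rotation_invariant:
  fixes \<iota> :: 'k
  assumes iota: "\<iota> * \<iota> = - 1" and p2: "p > 2" and nM: "n \<le> M" and i: "Suc i < n" and t: "t \<noteq> 0"
    and \<alpha>: "\<alpha> \<in> polys (grid n M)"
    and inv: "\<And>t X. t \<noteq> 0 \<Longrightarrow> \<alpha> (rotate_rows i (torus_cos t) (torus_sin \<iota> t) X) = \<alpha> X"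
  shows "frob_trace (grid n M) (\<lambda>X. corner_product n M X ^ (p - 1) * \<alpha> X)
      (rotate_rows i (torus_cos t) (torus_sin \<iota> t) X) =
    frob_trace (grid n M) (\<lambda>X. corner_product n M X ^ (p - 1) * \<alpha> X) X"
proof -
  let ?I = "grid n M" and ?h = "corner_product n M :: (nat \<times> nat \<Rightarrow> 'k) \<Rightarrow> 'k"
  let ?rot = "\<lambda>t. rotate_rows i (torus_cos t) (torus_sin \<iota> t)"
  define q where "q = p - 1"
  define a where "a = (\<lambda>X. ?h X ^ q * \<alpha> X)"
  define b where "b = frob_trace ?I a"
  have two: "(2::'k) \<noteq> 0" using two_neq_0[where 'k = 'k] p2 char by simp
  have h: "?h \<in> polys ?I" by (rule leading_polys[OF corner_product_leading[OF nM]])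
  have a: "a \<in> polys ?I" unfolding a_def by (intro polys_mult polys_power h \<alpha>)
  obtain C A B A' B' where "{C, A, B, A', B'} \<subseteq> polys ?I"
    and CAB: "\<And>t X. t \<noteq> 0 \<Longrightarrow> t\<^sup>2 * ?h (?rot t X) = C X * ((A X + t\<^sup>2 * B X) * (A' X + t\<^sup>2 * B' X))"
    using corner_product_rotate[OF iota two nM i] by blast
  then obtain F where F: "\<And>k. F k \<in> polys ?I"
    "\<And>T X. (C X * ((A X + T * B X) * (A' X + T * B' X))) ^ q = (\<Sum>k\<le>2 * q. T ^ k * F k X)"
    using poly_family_power[of C ?I A B A' B' q] unfolding poly_family_def by auto
  \<comment> \<open>\<open>F k\<close> has torus weight \<open>2 * k - 2 * q\<close>, so
    \<open>G k\<close> is the trace of one weight component; only \<open>k = q\<close> has weight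
    zero.\<close>
  define G where "G k = frob_trace ?I (\<lambda>X. F k X * \<alpha> X)" for k
  have Fa: "(\<lambda>X. F k X * \<alpha> X) \<in> polys ?I" for k by (intro polys_mult F(1) \<alpha>)
  \<comment> \<open>The torus parameter is taken to be \<open>s ^ p\<close>, because the trace
    extracts \<open>p\<close>-th roots of scalars: on the right only powers of \<open>s\<close>
    itself remain.\<close>
  have expand: "(s\<^sup>2) ^ q * b (?rot (s ^ p) X) = (\<Sum>k\<le>2 * q. (s\<^sup>2) ^ k * G k X)" if s: "s \<noteq> 0" for s X
  proof -
    let ?c = "inverse ((s\<^sup>2) ^ q)"
    have sp: "s ^ p \<noteq> 0" using s by simp
    have s2: "((s ^ p)\<^sup>2) ^ k = ((s\<^sup>2) ^ k) ^ p" for k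
      by (simp only: power_mult[symmetric] ac_simps)
    have "b (?rot (s ^ p) X) = frob_trace ?I (\<lambda>X. a (?rot (s ^ p) X)) X"
      unfolding b_def frob_trace_subst[OF finite_grid linear_subst_rotate[OF i] a]
        subst_factor_rotate[OF iota two i sp] by simp
    also have "(\<lambda>X. a (?rot (s ^ p) X)) = (\<lambda>X. ?c ^ p * (\<Sum>k\<le>2 * q. ((s\<^sup>2) ^ k) ^ p * (F k X * \<alpha> X)))"
    proof
      fix X
      have "((s ^ p)\<^sup>2) ^ q * ?h (?rot (s ^ p) X) ^ q = (\<Sum>k\<le>2 * q. ((s ^ p)\<^sup>2) ^ k * F k X)"
        unfolding F(2)[symmetric] CAB[OF sp, symmetric] power_mult_distrib ..
      then have 1: "((s\<^sup>2) ^ q) ^ p * ?h (?rot (s ^ p) X) ^ q = (\<Sum>k\<le>2 * q. ((s\<^sup>2) ^ k) ^ p * F k X)"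
        unfolding s2 .
      have "?c ^ p * ((s\<^sup>2) ^ q) ^ p = 1" using s by (simp flip: power_mult_distrib)
      then have "a (?rot (s ^ p) X) = ?c ^ p * (((s\<^sup>2) ^ q) ^ p * ?h (?rot (s ^ p) X) ^ q) * \<alpha> X"
        unfolding a_def inv[OF sp] by (simp only: mult.assoc[symmetric] mult_1_left)
      then show "a (?rot (s ^ p) X) = ?c ^ p * (\<Sum>k\<le>2 * q. ((s\<^sup>2) ^ k) ^ p * (F k X * \<alpha> X))"
        unfolding 1 by (simp only: sum_distrib_right mult.assoc)
    qed
    also have "frob_trace ?I \<dots> = (\<lambda>X. ?c * (\<Sum>k\<le>2 * q. (s\<^sup>2) ^ k * G k X))"
      unfolding G_def
    proof -
      have "(\<lambda>X. \<Sum>k\<le>2 * q. ((s\<^sup>2) ^ k) ^ p * (F k X * \<alpha> X)) \<in> polys ?I"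
        by (intro mspan_sum mspan_cmult Fa)
      moreover have "frob_trace ?I (\<lambda>X. \<Sum>k\<le>2 * q. ((s\<^sup>2) ^ k) ^ p * (F k X * \<alpha> X)) =
          (\<lambda>X. \<Sum>k\<le>2 * q. frob_trace ?I (\<lambda>X. ((s\<^sup>2) ^ k) ^ p * (F k X * \<alpha> X)) X)"
        by (rule frob_trace_sum[OF finite_grid]) (simp, intro mspan_cmult Fa)
      ultimately show "frob_trace ?I (\<lambda>X. ?c ^ p * (\<Sum>k\<le>2 * q. ((s\<^sup>2) ^ k) ^ p * (F k X * \<alpha> X))) =
          (\<lambda>X. ?c * (\<Sum>k\<le>2 * q. (s\<^sup>2) ^ k * frob_trace ?I (\<lambda>X. F k X * \<alpha> X) X))"
        by (simp only: frob_trace_cmult[OF finite_grid] frob_trace_cmult[OF finite_grid Fa])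
    qed
    finally show ?thesis using s by simp
  qed
  have G0: "G k X = 0" if k: "k \<le> 2 * q" "k \<noteq> q" for k X
  proof -
    have "\<exists>Q. \<forall>t. t \<noteq> 0 \<longrightarrow> t * ?rot t X e = poly Q t" for e
    proof -
      obtain r j where e: "e = (r, j)" by (cases e)
      have lin: "\<exists>Q. \<forall>t. t \<noteq> 0 \<longrightarrow> t * (torus_cos t * x + torus_sin \<iota> t * y) = poly Q t" for x y
      proof (intro exI allI impI)
        fix t :: 'k assume t: "t \<noteq> 0"
        show "t * (torus_cos t * x + torus_sin \<iota> t * y) = poly [:(x + \<iota> * y) / 2, 0, (x - \<iota> * y) / 2:] t"
          unfolding torus_weight[OF iota two t]
          by (simp only: poly_pCons poly_0 mult_zero_right mult_zero_left add_0_right add_0_left power2_eq_square ac_simps)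
      qed
      consider "r = i" | "r = Suc i" | "r \<noteq> i" "r \<noteq> Suc i" by blast
      then show ?thesis
      proof cases
        case 1
        then have "?rot t X e = torus_cos t * X (i, j) + torus_sin \<iota> t * - X (Suc i, j)" for t
          by (simp add: rotate_rows_def e)
        then show ?thesis using lin by (simp only:)
      next
        case 2
        then have "?rot t X e = torus_cos t * X (Suc i, j) + torus_sin \<iota> t * X (i, j)" for t
          by (simp add: rotate_rows_def e add.commute)
        then show ?thesis using lin by (simp only:)
      next
        case 3
        then have "t * ?rot t X e = poly [:0, X e:] t" for t
          by (simp add: rotate_rows_def e)
        then show ?thesis by blast
      qed
    qed
    moreover have "b \<in> polys ?I" unfolding b_def by (rule frob_trace_polys[OF finite_grid a])
    ultimately obtain N Q where NQ: "\<And>t. t \<noteq> 0 \<Longrightarrow> t ^ N * b (?rot t X) = poly Q t"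
      using polys_laurent_curve[OF finite_grid, of n M "\<lambda>t. ?rot t X" b] by auto
    \<comment> \<open>Both sides of \<open>expand\<close> become polynomials in \<open>s\<close>
      after clearing denominators. The left one is a polynomial in \<open>s ^ p\<close> up to the
      shift by \<open>2 * q\<close>, while on the right \<open>G k X\<close> sits in degree
      \<open>p * N + 2 * k\<close>.\<close>
    have "monom 1 (2 * q) * pcompose Q (monom 1 p) = monom 1 (p * N) * (\<Sum>k\<le>2 * q. monom (G k X) (2 * k))"
    proof (rule poly_eqI_infinite[of "{0}"])
      fix s :: 'k assume "s \<notin> {0}"
      then have s: "s \<noteq> 0" by simp
      then have sp: "s ^ p \<noteq> 0" by simp
      have "poly (monom 1 (2 * q) * pcompose Q (monom 1 p)) s = (s\<^sup>2) ^ q * ((s ^ p) ^ N * b (?rot (s ^ p) X))"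
        by (simp add: poly_monom poly_pcompose NQ[OF sp] power_mult)
      also have "\<dots> = s ^ (p * N) * ((s\<^sup>2) ^ q * b (?rot (s ^ p) X))"
        by (simp only: power_mult mult.left_commute)
      also have "\<dots> = s ^ (p * N) * (\<Sum>k\<le>2 * q. (s\<^sup>2) ^ k * G k X)"
        by (simp only: expand[OF s])
      finally show "poly (monom 1 (2 * q) * pcompose Q (monom 1 p)) s =
          poly (monom 1 (p * N) * (\<Sum>k\<le>2 * q. monom (G k X) (2 * k))) s"
        by (simp only: poly_mult poly_monom poly_sum mult_1_left power_mult[of s 2] mult.commute[of "G _ X"])
    qed simp
    then have "coeff (monom 1 (2 * q) * pcompose Q (monom 1 p)) (p * N + 2 * k) =
        coeff (monom 1 (p * N) * (\<Sum>k\<le>2 * q. monom (G k X) (2 * k))) (p * N + 2 * k)"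
      by simp
    also have "\<dots> = (\<Sum>l\<le>2 * q. coeff (monom (G l X) (2 * l)) (2 * k))"
      by (simp only: coeff_monom_mult coeff_sum) simp
    also have "\<dots> = (\<Sum>l\<le>2 * q. if l = k then G l X else 0)"
      by (intro sum.cong) auto
    also have "\<dots> = G k X" using k(1) by simp
    finally have G: "G k X = coeff (monom 1 (2 * q) * pcompose Q (monom 1 p)) (p * N + 2 * k)" ..
    \<comment> \<open>Otherwise the odd prime \<open>p\<close> would divide \<open>k - q\<close>,
      which is nonzero and at most \<open>q = p - 1\<close> in absolute value.\<close>
    have "\<not> p dvd p * N + 2 * k - 2 * q" if le: "2 * q \<le> p * N + 2 * k"
    proof
      assume "p dvd p * N + 2 * k - 2 * q"
      then have "int p dvd int (p * N + 2 * k - 2 * q)" by (simp only: int_dvd_int_iff)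
      also have "int (p * N + 2 * k - 2 * q) = int p * int N + 2 * (int k - int q)"
        using le by (simp add: of_nat_diff)
      finally have "int p dvd 2 * (int k - int q)" by (simp add: dvd_add_right_iff)
      moreover have "\<not> int p dvd 2" using p2 by (auto dest: zdvd_imp_le)
      moreover have "prime (int p)" using p by simp
      ultimately have "int p dvd int k - int q" by (metis prime_dvd_multD)
      then have "\<bar>int p\<bar> \<le> \<bar>int k - int q\<bar>" using k(2) by (intro dvd_imp_le_int) auto
      then show False using k(1) p2 unfolding q_def by linarith
    qed
    then have "coeff (pcompose Q (monom 1 p)) (p * N + 2 * k - 2 * q) = 0" if "2 * q \<le> p * N + 2 * k"
      using coeff_pcompose_monom that by blast
    then show ?thesis unfolding G coeff_monom_mult by simp
  qed
  have const: "b (?rot t X) = G q X" if t: "t \<noteq> 0" for t X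
  proof -
    obtain s where s: "s ^ p = t" using frob_root_power by blast
    then have s0: "s \<noteq> 0" using t prime_gt_0_nat[OF p] by auto
    have "(s\<^sup>2) ^ q * b (?rot t X) = (\<Sum>k\<le>2 * q. (s\<^sup>2) ^ k * G k X)"
      using expand[OF s0, of X] s by simp
    also have "\<dots> = (\<Sum>k\<le>2 * q. if k = q then (s\<^sup>2) ^ k * G k X else 0)"
      by (intro sum.cong) (auto simp: G0)
    also have "\<dots> = (s\<^sup>2) ^ q * G q X" by simp
    finally show ?thesis using s0 by simp
  qed
  \<comment> \<open>The value along the torus orbit is constant in the parameter, and parameter 1
    identifies it with the value at \<open>X\<close>.\<close>
  have "?rot 1 X = X" for X by (auto simp: torus_1[OF iota two] rotate_rows_def fun_eq_iff)
  then show ?thesis using const[OF t, of X] const[of 1 X] by (simp add: b_def a_def q_def)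
qed

text \<open>A remainder monomial surviving the trace has all exponents at least
  \<open>p - 1\<close>; equality of total degrees then forces all of them to be
  \<open>p - 1\<close>, against the strictly smaller weight.\<close>

lemma frob_trace_leading:
  assumes I: "finite I" and f: "leading I w (\<lambda>_. p - 1) (f :: ('i \<Rightarrow> 'k) \<Rightarrow> 'k)"
  shows "frob_trace I f = (\<lambda>X. 1)"
proof -
  let ?P = "\<lambda>E'. (\<Sum>i\<in>I. E' i) = (\<Sum>i\<in>I. p - 1) \<and> (\<Sum>i\<in>I. w i * E' i) < (\<Sum>i\<in>I. w i * (p - 1))"
  obtain g where g: "g \<in> mspan I ?P" and f': "f = (\<lambda>X. mon I (\<lambda>_. p - 1) X + g X)"
    using f by (auto simp: leading_def)
  have "frob_trace I g = (\<lambda>X. 0)"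
    using g
  proof (induction rule: mspan.induct)
    case (step f E c)
    have "\<not> (\<forall>i\<in>I. E i mod p = p - 1)"
    proof
      assume *: "\<forall>i\<in>I. E i mod p = p - 1"
      have ge: "p - 1 \<le> E i" if "i \<in> I" for i using * that by (metis mod_less_eq_dividend)
      have "\<forall>i\<in>I. E i = p - 1"
      proof (rule ccontr)
        assume "\<not> (\<forall>i\<in>I. E i = p - 1)"
        then obtain i where "i \<in> I" "E i \<noteq> p - 1" by blast
        then have "\<exists>i\<in>I. p - 1 < E i" using ge[of i] by (intro bexI[of _ i]) linarith+
        then have "(\<Sum>i\<in>I. p - 1) < (\<Sum>i\<in>I. E i)" using ge by (intro sum_strict_mono_ex1[OF I]) auto
        then show False using step.hyps(2) by simp
      qed
      then have "(\<Sum>i\<in>I. w i * E i) = (\<Sum>i\<in>I. w i * (p - 1))" by (intro sum.cong) auto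
      then show False using step.hyps(2) by simp
    qed
    then show ?case
      unfolding frob_trace_step[OF I mspan_polys[OF step.hyps(1)]] step.IH by (simp only: if_False) simp
  qed (simp add: frob_trace_0[OF I])
  then show ?thesis
    unfolding f' frob_trace_add[OF I mspan_mon[OF TrueI] mspan_polys[OF g]] frob_trace_top[OF I] by simp
qed

lemma frob_trace_corner_product:
  "n \<le> M \<Longrightarrow> frob_trace (grid n M) (\<lambda>X :: nat \<times> nat \<Rightarrow> 'k. corner_product n M X ^ (p - 1)) = (\<lambda>X. 1)"
  by (rule frob_trace_leading[OF finite_grid, where w = "\<lambda>(a, j). a * j"])
    (use leading_power[OF corner_product_leading, of n M "p - 1"] in simp)

end

section \<open>Plane rotations generate the special orthogonal group\<close>

locale orthonormal_space = vector_space scale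
  for scale :: "'k::field \<Rightarrow> 'v::ab_group_add \<Rightarrow> 'v" +
  fixes \<beta> :: "'v \<Rightarrow> 'v \<Rightarrow> 'k" and e :: "nat \<Rightarrow> 'v" and n :: nat
  assumes form: "symmetric_bilinear_form scale \<beta>"
    and orthonormal: "\<And>i j. i < n \<Longrightarrow> j < n \<Longrightarrow> \<beta> (e i) (e j) = (if i = j then 1 else 0)"
    and expansion: "\<And>v. (\<Sum>i<n. scale (\<beta> (e i) v) (e i)) = v"

lemma symmetric_bilinear_form_simps:
  assumes "symmetric_bilinear_form scale \<beta>"
  shows "\<beta> x (y + z) = \<beta> x y + \<beta> x z" "\<beta> x (y - z) = \<beta> x y - \<beta> x z" "\<beta> x (scale c y) = c * \<beta> x y"
    "\<beta> x (\<Sum>i\<in>S. f i) = (\<Sum>i\<in>S. \<beta> x (f i))" "\<beta> x 0 = 0" "\<beta> x y = \<beta> y x"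
proof -
  interpret L: Vector_Spaces.linear scale "(*)" "\<beta> x"
    using assms by (simp add: symmetric_bilinear_form_def)
  show "\<beta> x (y + z) = \<beta> x y + \<beta> x z" "\<beta> x (y - z) = \<beta> x y - \<beta> x z" "\<beta> x (scale c y) = c * \<beta> x y"
    "\<beta> x (\<Sum>i\<in>S. f i) = (\<Sum>i\<in>S. \<beta> x (f i))" "\<beta> x 0 = 0"
    by (rule L.add L.diff L.scale L.sum L.zero)+
  show "\<beta> x y = \<beta> y x" using assms by (auto simp: symmetric_bilinear_form_def)
qed

lemma dmat_diagonal:
  fixes d :: "nat \<Rightarrow> 'k::comm_ring_1"
  shows "dmat n (\<lambda>i j. if i = j then d i else 0) = (\<Prod>i<n. d i)"
proof -
  let ?D = "mat n n (\<lambda>(i, j). if i = j then d i else 0)"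
  have "det ?D = prod_list (diag_mat ?D)"
    by (rule det_upper_triangular[of _ n]) auto
  also have "diag_mat ?D = map d [0..<n]"
    by (simp add: diag_mat_def)
  also have "prod_list (map d [0..<n]) = (\<Prod>i<n. d i)"
    using prod.distinct_set_conv_list[of "[0..<n]" d] by (simp add: atLeast0LessThan)
  finally show ?thesis by (simp add: dmat_def)
qed

section \<open>Coordinates with respect to an orthonormal basis\<close>

context orthonormal_space
begin

lemmas form_simps = symmetric_bilinear_form_simps(1-5)[OF form]
lemmas form_sym = symmetric_bilinear_form_simps(6)[OF form]

lemma form_left_simps:
  "\<beta> (y + z) x = \<beta> y x + \<beta> z x" "\<beta> (y - z) x = \<beta> y x - \<beta> z x" "\<beta> (scale c y) x = c * \<beta> y x"
  "\<beta> (\<Sum>i\<in>S. f i) x = (\<Sum>i\<in>S. \<beta> (f i) x)"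
  by (simp_all only: form_sym[of _ x] form_simps)

definition vec :: "(nat \<Rightarrow> 'k) \<Rightarrow> 'v" where
  "vec x = (\<Sum>a<n. scale (x a) (e a))"

lemma form_e_vec: "a < n \<Longrightarrow> \<beta> (e a) (vec x) = x a"
  by (simp add: vec_def form_simps orthonormal if_distrib[of "\<lambda>y. _ * y"] cong: if_cong)

lemma vec_coords: "vec (\<lambda>a. \<beta> (e a) v) = v"
  by (simp add: vec_def expansion)

lemma vec_cong: "(\<And>a. a < n \<Longrightarrow> x a = y a) \<Longrightarrow> vec x = vec y"
  by (simp add: vec_def)

lemma coords_eqI: "(\<And>a. a < n \<Longrightarrow> \<beta> (e a) v = \<beta> (e a) w) \<Longrightarrow> v = w"
  using vec_cong[of "\<lambda>a. \<beta> (e a) v" "\<lambda>a. \<beta> (e a) w"] by (simp add: vec_coords)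

lemma form_vec: "\<beta> (vec x) (vec y) = (\<Sum>a<n. x a * y a)"
  by (subst vec_def) (simp add: form_left_simps form_e_vec)

lemma form_coords: "\<beta> v w = (\<Sum>a<n. \<beta> (e a) v * \<beta> (e a) w)"
  using form_vec[of "\<lambda>a. \<beta> (e a) v" "\<lambda>a. \<beta> (e a) w"] by (simp add: vec_coords)

lemma e_inj: "inj_on e {..<n}"
proof (rule inj_onI)
  fix i j assume "i \<in> {..<n}" "j \<in> {..<n}" "e i = e j"
  then show "i = j" using orthonormal[of i j] orthonormal[of i i] by (auto split: if_splits)
qed

lemma basis_list_e: "basis_list scale (map e [0..<n])"
proof -
  have set: "set (map e [0..<n]) = e ` {..<n}" by auto
  have "distinct (map e [0..<n])"
    using e_inj by (simp add: distinct_map atLeast0LessThan)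
  moreover have "independent (e ` {..<n})"
  proof
    assume "dependent (e ` {..<n})"
    then obtain u where u: "\<exists>v\<in>e ` {..<n}. u v \<noteq> 0" "(\<Sum>v\<in>e ` {..<n}. scale (u v) v) = 0"
      by (auto simp: dependent_finite)
    then have "vec (\<lambda>a. u (e a)) = 0"
      by (simp add: vec_def sum.reindex[OF e_inj])
    then have "u (e a) = 0" if "a < n" for a
      using form_e_vec[OF that, of "\<lambda>a. u (e a)"] by (simp add: form_simps)
    then show False using u(1) by auto
  qed
  moreover have "v \<in> span (e ` {..<n})" for v
  proof -
    have "(\<Sum>i<n. scale (\<beta> (e i) v) (e i)) \<in> span (e ` {..<n})"
      by (intro span_sum span_scale span_base) auto
    then show ?thesis by (simp only: expansion)
  qed
  ultimately show ?thesis unfolding basis_list_def set by auto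
qed

lemma representation_e:
  assumes "i < n"
  shows "representation (set (map e [0..<n])) v (e i) = \<beta> (e i) v"
proof -
  let ?B = "set (map e [0..<n])"
  have B: "independent ?B" "span ?B = UNIV" "?B = e ` {..<n}"
    using basis_list_e by (auto simp: basis_list_def)
  have "representation ?B v (e i) = representation ?B (\<Sum>a<n. scale (\<beta> (e a) v) (e a)) (e i)"
    by (simp only: expansion)
  also have "\<dots> = (\<Sum>a<n. \<beta> (e a) v * representation ?B (e a) (e i))"
    using B by (subst representation_sum) (auto simp: representation_scale)
  also have "\<dots> = (\<Sum>a<n. \<beta> (e a) v * (if a = i then 1 else 0))"
    using B assms e_inj
    by (intro sum.cong refl) (auto simp: representation_basis inj_on_def)
  finally show ?thesis
    using assms by (simp add: if_distrib[of "\<lambda>y. _ * y"] cong: if_cong)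
qed

lemma lin_det_coords:
  assumes "Vector_Spaces.linear scale scale f"
  shows "lin_det scale f = dmat n (\<lambda>i j. \<beta> (e i) (f (e j)))"
  unfolding lin_det_eq[OF basis_list_e assms] matrix_of_def dmat_def
  by (intro arg_cong[of _ _ det] cong_mat) (auto simp: representation_e simp del: set_map set_upt)

section \<open>Rotations of coordinate planes as elements of SO(V)\<close>

definition rotation :: "nat \<Rightarrow> 'k \<Rightarrow> 'k \<Rightarrow> 'v \<Rightarrow> 'v" where
  "rotation i c s v = vec (\<lambda>a. if a = i then c * \<beta> (e i) v - s * \<beta> (e (Suc i)) v
     else if a = Suc i then s * \<beta> (e i) v + c * \<beta> (e (Suc i)) v else \<beta> (e a) v)"

lemma rotation_coords:
  "a < n \<Longrightarrow> \<beta> (e a) (rotation i c s v) =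
    (if a = i then c * \<beta> (e i) v - s * \<beta> (e (Suc i)) v
     else if a = Suc i then s * \<beta> (e i) v + c * \<beta> (e (Suc i)) v else \<beta> (e a) v)"
  unfolding rotation_def by (rule form_e_vec)

lemma rotation_fixes: "a < n \<Longrightarrow> a \<noteq> i \<Longrightarrow> a \<noteq> Suc i \<Longrightarrow> Suc i < n \<Longrightarrow> rotation i c s (e a) = e a"
  by (rule coords_eqI) (simp add: rotation_coords orthonormal)

lemma linearI_form:
  assumes "\<And>a v w. a < n \<Longrightarrow> \<beta> (e a) (f (v + w)) = \<beta> (e a) (f v) + \<beta> (e a) (f w)"
    and "\<And>a c v. a < n \<Longrightarrow> \<beta> (e a) (f (scale c v)) = c * \<beta> (e a) (f v)"
  shows "Vector_Spaces.linear scale scale f"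
  by unfold_locales (auto intro!: coords_eqI simp: assms form_simps)

lemma rotation_linear: "Vector_Spaces.linear scale scale (rotation i c s)"
  by (rule linearI_form) (auto simp: rotation_coords form_simps algebra_simps)

lemma rotation_form:
  assumes "Suc i < n" "c * c + s * s = 1"
  shows "\<beta> (rotation i c s v) (rotation i c s w) = \<beta> v w"
proof -
  have split: "(\<Sum>a<n. f a) = f i + f (Suc i) + (\<Sum>a\<in>{..<n} - {i} - {Suc i}. f a)" for f :: "nat \<Rightarrow> 'k"
    using assms(1) by (subst sum.remove[of _ i], simp, simp, subst sum.remove[of _ "Suc i"], auto)
  let ?x = "\<beta> (e i) v" and ?y = "\<beta> (e (Suc i)) v" and ?z = "\<beta> (e i) w" and ?t = "\<beta> (e (Suc i)) w"
  have "(c * ?x - s * ?y) * (c * ?z - s * ?t) + (s * ?x + c * ?y) * (s * ?z + c * ?t) =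
      (c * c + s * s) * (?x * ?z + ?y * ?t)"
    by (simp add: ring_distribs)
  then show ?thesis
    unfolding form_coords[of "rotation i c s v"] form_coords[of v] split
    using assms by (simp add: rotation_coords)
qed

lemma rotation_inverse:
  assumes "Suc i < n" "c * c + s * s = 1"
  shows "rotation i c (- s) (rotation i c s v) = v"
proof (rule coords_eqI)
  fix a assume a: "a < n"
  have 1: "c * (c * x - s * y) + s * (s * x + c * y) = (c * c + s * s) * x" for x y
    by (simp add: ring_distribs)
  have 2: "c * (s * x + c * y) - s * (c * x - s * y) = (c * c + s * s) * y" for x y
    by (simp add: ring_distribs)
  show "\<beta> (e a) (rotation i c (- s) (rotation i c s v)) = \<beta> (e a) v"
    using assms a 1 2 by (simp add: rotation_coords)
qed

lemma rotation_det:
  assumes "Suc i < n" "c * c + s * s = 1"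
  shows "lin_det scale (rotation i c s) = 1"
proof -
  let ?A = "\<lambda>i j. if i = j then 1 else 0 :: 'k"
  have "lin_det scale (rotation i c s) = dmat n (?A(i := (\<lambda>v. c * ?A i v - s * ?A (Suc i) v),
      Suc i := (\<lambda>v. s * ?A i v + c * ?A (Suc i) v)))"
    unfolding lin_det_coords[OF rotation_linear]
    using assms(1) by (intro dmat_cong) (auto simp: rotation_coords orthonormal)
  also have "\<dots> = (c * c + s * s) * dmat n ?A"
    using assms(1) by (intro dmat_rotate_rows) auto
  also have "dmat n ?A = det (1\<^sub>m n)"
    unfolding dmat_def one_mat_def by simp
  finally show ?thesis using assms(2) by simp
qed

lemma rotation_SO:
  assumes "Suc i < n" "c * c + s * s = 1"
  shows "rotation i c s \<in> special_orthogonal scale \<beta>"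
proof -
  have "rotation i c s (rotation i c (- s) v) = v" for v
    using rotation_inverse[of i c "- s"] assms by simp
  then have "bij (rotation i c s)"
    using rotation_inverse[OF assms] by (intro o_bij[of "rotation i c (- s)"]) auto
  then show ?thesis
    using assms rotation_linear rotation_form rotation_det by (simp add: special_orthogonal_def)
qed

text \<open>The index \<open>k\<close> restricts the planes to the first \<open>k\<close> axes. Such
  products fix the later basis vectors, which makes induction on \<open>k\<close> possible.\<close>

inductive_set rotations :: "nat \<Rightarrow> ('v \<Rightarrow> 'v) set" for k where
  id: "id \<in> rotations k"
| step: "h \<in> rotations k \<Longrightarrow> Suc i < k \<Longrightarrow> c * c + s * s = 1 \<Longrightarrow> rotation i c s \<circ> h \<in> rotations k"

lemma rotations_mono: "h \<in> rotations k \<Longrightarrow> k \<le> l \<Longrightarrow> h \<in> rotations l"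
  by (induction rule: rotations.induct) (auto intro: rotations.intros)

lemma rotations_comp: "h \<in> rotations k \<Longrightarrow> h' \<in> rotations k \<Longrightarrow> h \<circ> h' \<in> rotations k"
  by (induction rule: rotations.induct) (auto simp: comp_assoc intro: rotations.step)

lemma SO_comp:
  assumes "f \<in> special_orthogonal scale \<beta>" "g \<in> special_orthogonal scale \<beta>"
  shows "f \<circ> g \<in> special_orthogonal scale \<beta>"
proof -
  have lin: "Vector_Spaces.linear scale scale f" "Vector_Spaces.linear scale scale g"
    using assms by (auto simp: special_orthogonal_def)
  have fg: "Vector_Spaces.linear scale scale (f \<circ> g)"
    by (rule Vector_Spaces.linear_compose[OF lin(2,1)])
  note B = basis_list_e
  have carr: "matrix_of scale (map e [0..<n]) (map e [0..<n]) h \<in> carrier_mat n n" for h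
    by (simp add: matrix_of_def)
  have "lin_det scale (f \<circ> g) = lin_det scale f * lin_det scale g"
    unfolding lin_det_eq[OF B lin(1)] lin_det_eq[OF B lin(2)] lin_det_eq[OF B fg]
      matrix_of_compose[OF B B lin(1), symmetric] by (rule det_mult[OF carr carr])
  then show ?thesis
    using assms fg by (auto simp: special_orthogonal_def intro: bij_comp)
qed

lemma id_SO: "id \<in> special_orthogonal scale \<beta>"
proof -
  have "lin_det scale id = det (1\<^sub>m n)"
    using lin_det_eq[OF basis_list_e linear_id] matrix_of_id[OF vector_space_axioms basis_list_e] by simp
  then show ?thesis by (simp add: special_orthogonal_def linear_id)
qed

lemma rotations_SO: "h \<in> rotations k \<Longrightarrow> k \<le> n \<Longrightarrow> h \<in> special_orthogonal scale \<beta>"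
proof (induction rule: rotations.induct)
  case (step h i c s)
  then show ?case by (intro SO_comp rotation_SO) auto
qed (rule id_SO)

lemma rotations_fix: "h \<in> rotations k \<Longrightarrow> k \<le> a \<Longrightarrow> a < n \<Longrightarrow> h (e a) = e a"
  by (induction rule: rotations.induct) (auto simp: rotation_fixes)

section \<open>Moving unit vectors to a coordinate axis\<close>

lemma form_supported:
  assumes "k \<le> n" "\<And>a. k \<le> a \<Longrightarrow> a < n \<Longrightarrow> \<beta> (e a) v = 0"
  shows "\<beta> v v = (\<Sum>a<k. \<beta> (e a) v * \<beta> (e a) v)"
proof -
  have "(\<Sum>a<n. \<beta> (e a) v * \<beta> (e a) v) = (\<Sum>a<k. \<beta> (e a) v * \<beta> (e a) v)"
    using assms by (intro sum.mono_neutral_right) auto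
  then show ?thesis by (simp only: form_coords[of v v])
qed

lemma rotate_pair_to_axis:
  assumes "Suc i < n" "x * x + y * y = 1"
  shows "rotation i y x (scale x (e i) + scale y (e (Suc i))) = e (Suc i)"
proof (rule coords_eqI)
  fix a assume a: "a < n"
  have "\<beta> (e b) (scale x (e i) + scale y (e (Suc i))) = (if b = i then x else if b = Suc i then y else 0)"
    if "b < n" for b
    using that assms(1) by (simp add: form_simps orthonormal)
  then show "\<beta> (e a) (rotation i y x (scale x (e i) + scale y (e (Suc i)))) = \<beta> (e a) (e (Suc i))"
    using a assms by (simp add: rotation_coords orthonormal mult.commute)
qed

text \<open>Three rotations suffice: \<open>(1, 0)\<close>, \<open>(0, 1)\<close> and
  \<open>(c, c)\<close> with \<open>c * c = 1 / 2\<close>. If the first two gave zero, the unit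
  condition would yield \<open>R = - 1\<close> and \<open>x * x = y * y = 1\<close>; the third would
  then give \<open>x * y = 0\<close>.\<close>

lemma exists_anisotropic_rotation:
  fixes R x y :: 'k
  assumes sqrt: "\<And>z :: 'k. \<exists>w. w * w = z" and two: "(2 :: 'k) \<noteq> 0" and unit: "R + x * x + y * y = 1"
  shows "\<exists>c s. c * c + s * s = 1 \<and> R + (c * x - s * y) * (c * x - s * y) \<noteq> 0"
proof (rule ccontr)
  assume "\<not> ?thesis"
  then have *: "R + (c * x - s * y) * (c * x - s * y) = 0" if "c * c + s * s = 1" for c s
    using that by blast
  have "R + x * x = 0" "R + y * y = 0" using *[of 1 0] *[of 0 1] by simp_all
  then have x: "x * x = - R" and y: "y * y = - R"
    by (simp_all only: minus_unique[symmetric])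
  have "- R = 1" using unit unfolding x y by simp
  then have R: "R = - 1" by (metis minus_minus)
  obtain c :: 'k where c: "c * c = 1 / 2" using sqrt by blast
  have h: "c * c + c * c = 1"
    unfolding c add_divide_distrib[symmetric] one_add_one by (rule divide_self[OF two])
  have "(c * x - c * y) * (c * x - c * y) = (c * c) * (x * x + y * y) - (c * c + c * c) * (x * y)"
    by (simp add: ring_distribs)
  also have "x * x + y * y = 1 + 1" unfolding x y R by simp
  finally have "(c * x - c * y) * (c * x - c * y) = 1 - x * y"
    by (simp only: distrib_left mult_1_right mult_1_left h)
  with *[OF h] have "x * y = 0" unfolding R by simp
  then consider "x = 0" | "y = 0" by auto
  then show False using x y unfolding R by cases simp_all
qed

text \<open>Induction on the number of axes. The projection of \<open>v\<close> to the first axes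
  may be isotropic, so a preliminary rotation corrects this. The projection can then be normalized
  and moved by induction to the last of these axes, and one rotation in the final plane
  finishes.\<close>

lemma rotate_to_axis:
  assumes sqrt: "\<And>z :: 'k. \<exists>w. w * w = z" and two: "(2 :: 'k) \<noteq> 0"
    and "2 \<le> k" "k \<le> n" "\<And>a. k \<le> a \<Longrightarrow> a < n \<Longrightarrow> \<beta> (e a) v = 0" "\<beta> v v = 1"
  shows "\<exists>h\<in>rotations k. h v = e (k - 1)"
  using assms(3-6)
proof (induction k arbitrary: v rule: nat_induct_at_least)
  case base
  let ?x = "\<beta> (e 0) v" and ?y = "\<beta> (e (Suc 0)) v"
  have v: "v = scale ?x (e 0) + scale ?y (e (Suc 0))"
  proof (rule coords_eqI)
    fix a assume "a < n"
    then show "\<beta> (e a) v = \<beta> (e a) (scale ?x (e 0) + scale ?y (e (Suc 0)))"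
      using base(1) base(2)[of a] by (cases "a = 0"; cases "a = Suc 0") (auto simp: form_simps orthonormal)
  qed
  have xy: "?x * ?x + ?y * ?y = 1"
    using form_supported[OF base(1,2)] base(3) by (simp add: numeral_2_eq_2)
  then have "rotation 0 ?y ?x \<circ> id \<in> rotations 2"
    by (intro rotations.intros) (auto simp: add.commute)
  moreover have "rotation 0 ?y ?x (scale ?x (e 0) + scale ?y (e (Suc 0))) = e (Suc 0)"
    using base(1) xy by (intro rotate_pair_to_axis) auto
  then have "(rotation 0 ?y ?x \<circ> id) v = e (2 - 1)"
    using v by simp
  ultimately show ?case by blast
next
  case (Suc k)
  define i where "i = k - 1"
  have i: "Suc i = k" "k < n" using Suc.hyps Suc.prems(1) by (auto simp: i_def)
  let ?x = "\<beta> (e i) v" and ?y = "\<beta> (e k) v"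
  define R where "R = (\<Sum>a<i. \<beta> (e a) v * \<beta> (e a) v)"
  have split: "(\<Sum>a<Suc k. f a) = (\<Sum>a<i. f a) + f i + f k" for f :: "nat \<Rightarrow> 'k"
    unfolding i(1)[symmetric] by simp
  have "R + ?x * ?x + ?y * ?y = 1"
    using form_supported[OF Suc.prems(1,2)] Suc.prems(3) unfolding R_def split by simp
  then obtain c s where cs: "c * c + s * s = 1" "R + (c * ?x - s * ?y) * (c * ?x - s * ?y) \<noteq> 0"
    using exists_anisotropic_rotation[OF sqrt two] by blast
  define v1 where "v1 = rotation i c s v"
  define z where "z = \<beta> (e k) v1"
  have v1: "\<beta> (e a) v1 = (if a = i then c * ?x - s * ?y else if a = k then z else \<beta> (e a) v)" if "a < n" for a
    using that i unfolding z_def v1_def by (auto simp: rotation_coords)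
  have v1_0: "\<beta> (e a) v1 = 0" if "Suc k \<le> a" "a < n" for a
    using that i Suc.prems(2) by (simp add: v1)
  have "\<beta> v1 v1 = 1"
    unfolding v1_def using rotation_form[of i c s v v] i cs(1) Suc.prems(3) by simp
  then have norm: "(\<Sum>a<k. \<beta> (e a) v1 * \<beta> (e a) v1) + z * z = 1"
    using form_supported[OF Suc.prems(1) v1_0] by (simp add: z_def)
  have "(\<Sum>a<k. \<beta> (e a) v1 * \<beta> (e a) v1) = (\<Sum>a<i. \<beta> (e a) v1 * \<beta> (e a) v1) + \<beta> (e i) v1 * \<beta> (e i) v1"
    unfolding i(1)[symmetric] by simp
  also have "(\<Sum>a<i. \<beta> (e a) v1 * \<beta> (e a) v1) = R"
    unfolding R_def using i by (intro sum.cong) (auto simp: v1)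
  also have "\<beta> (e i) v1 = c * ?x - s * ?y" using i by (simp add: v1)
  finally have r0: "(\<Sum>a<k. \<beta> (e a) v1 * \<beta> (e a) v1) \<noteq> 0" using cs(2) by simp
  obtain \<rho> where \<rho>: "\<rho> * \<rho> = (\<Sum>a<k. \<beta> (e a) v1 * \<beta> (e a) v1)" using sqrt by metis
  then have \<rho>0: "\<rho> \<noteq> 0" using r0 by auto
  \<comment> \<open>The normalized projection of \<open>v1\<close> to the first \<open>k\<close>
    axes, a unit vector to which the induction hypothesis applies.\<close>
  define u where "u = scale (inverse \<rho>) (v1 - scale z (e k))"
  have u: "\<beta> (e a) u = (if a < k then inverse \<rho> * \<beta> (e a) v1 else 0)" if "a < n" for a
    using that i v1_0[of a] v1[of k] unfolding u_def
    by (cases "a = k") (auto simp: form_simps orthonormal not_less_eq_eq)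
  have "\<beta> u u = (\<Sum>a<k. (inverse \<rho> * inverse \<rho>) * (\<beta> (e a) v1 * \<beta> (e a) v1))"
    using form_supported[of k u] i by (simp add: u ac_simps)
  also have "\<dots> = (inverse \<rho> * inverse \<rho>) * (\<rho> * \<rho>)" by (simp only: \<rho> sum_distrib_left)
  also have "\<dots> = (inverse \<rho> * \<rho>) * (inverse \<rho> * \<rho>)" by (simp only: ac_simps)
  also have "\<dots> = 1" unfolding left_inverse[OF \<rho>0] by (rule mult_1_left)
  finally have uu: "\<beta> u u = 1" .
  obtain h where h: "h \<in> rotations k" "h u = e i"
    using Suc.IH[of u] u uu i by (auto simp: i_def)
  interpret L: Vector_Spaces.linear scale scale h
    using rotations_SO[OF h(1)] i by (simp add: special_orthogonal_def)
  have "v1 = scale \<rho> u + scale z (e k)"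
    using \<rho>0 by (simp add: u_def)
  then have "h v1 = scale \<rho> (h u) + scale z (h (e k))"
    by (simp only: L.add L.scale)
  also have "h (e k) = e k" by (rule rotations_fix[OF h(1)]) (use i in auto)
  \<comment> \<open>The image of \<open>v1\<close> now lies in the plane of \<open>e i\<close> and
    \<open>e k\<close>, and its coordinates there satisfy the norm condition.\<close>
  finally have "rotation i z \<rho> (h v1) = e (Suc i)"
    using rotate_pair_to_axis[of i \<rho> z] i norm \<rho> h(2) by simp
  moreover have "rotation i z \<rho> \<circ> (h \<circ> (rotation i c s \<circ> id)) \<in> rotations (Suc k)"
    using i cs(1) norm \<rho> rotations_mono[OF h(1), of "Suc k"]
    by (intro rotations.step rotations_comp rotations.id) (auto simp: add.commute)
  ultimately show ?case
    unfolding v1_def using i by (intro bexI[of _ "rotation i z \<rho> \<circ> (h \<circ> (rotation i c s \<circ> id))"]) auto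
qed

text \<open>The basis vectors are put back in place from the last one downwards. The first one is
  then left with a single scalar coordinate, and the determinant condition makes it 1.\<close>

lemma SO_reduce:
  assumes sqrt: "\<And>z :: 'k. \<exists>w. w * w = z" and two: "(2 :: 'k) \<noteq> 0"
    and g: "g \<in> special_orthogonal scale \<beta>"
  shows "\<exists>h\<in>rotations n. h \<circ> g = id"
proof (cases "n = 0")
  case True
  have "v = w" for v w :: 'v by (rule coords_eqI) (simp add: True)
  then have "id \<circ> g = id" by (intro ext)
  then show ?thesis using rotations.id by blast
next
  case False
  \<comment> \<open>The descent stops at index 1, since \<open>rotate_to_axis\<close> requires at
    least two axes.\<close>
  have ex: "\<exists>h\<in>rotations n. \<forall>a. j \<le> a \<longrightarrow> a < n \<longrightarrow> h (g (e a)) = e a" if "1 \<le> j" "j \<le> n" for j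
    using that(2,1)
  proof (induction rule: inc_induct)
    case base
    then show ?case using rotations.id by (intro bexI[of _ id]) auto
  next
    case (step j)
    then obtain h where h: "h \<in> rotations n" "\<And>a. Suc j \<le> a \<Longrightarrow> a < n \<Longrightarrow> h (g (e a)) = e a"
      by auto
    have hg: "h \<circ> g \<in> special_orthogonal scale \<beta>"
      by (rule SO_comp[OF rotations_SO[OF h(1)] g]) simp
    then have form_hg: "\<beta> (h (g v)) (h (g w)) = \<beta> v w" for v w
      by (simp add: special_orthogonal_def)
    \<comment> \<open>Orthogonality to the basis vectors already restored confines the image of
      \<open>e j\<close> to the first \<open>Suc j\<close> axes.\<close>
    have "\<beta> (e a) (h (g (e j))) = 0" if "Suc j \<le> a" "a < n" for a
    proof -
      have "\<beta> (h (g (e a))) (h (g (e j))) = 0"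
        unfolding form_hg using that step.hyps by (simp add: orthonormal)
      then show ?thesis unfolding h(2)[OF that] .
    qed
    moreover have "\<beta> (h (g (e j))) (h (g (e j))) = 1"
      unfolding form_hg using step.hyps by (simp add: orthonormal)
    ultimately obtain h' where h': "h' \<in> rotations (Suc j)" "h' (h (g (e j))) = e j"
      using rotate_to_axis[OF sqrt two, of "Suc j" "h (g (e j))"] step.prems step.hyps by auto
    have "(h' \<circ> h) (g (e a)) = e a" if "j \<le> a" "a < n" for a
    proof (cases "a = j")
      case False
      then show ?thesis using that h(2)[of a] rotations_fix[OF h'(1), of a] by simp
    qed (simp add: h'(2))
    moreover have "h' \<circ> h \<in> rotations n"
      using step.hyps by (intro rotations_comp rotations_mono[OF h'(1)] h(1)) auto
    ultimately show ?case by blast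
  qed
  have "\<exists>h\<in>rotations n. \<forall>a. 1 \<le> a \<longrightarrow> a < n \<longrightarrow> h (g (e a)) = e a"
    by (rule ex) (use False in auto)
  then obtain h where h: "h \<in> rotations n" "\<And>a. 1 \<le> a \<Longrightarrow> a < n \<Longrightarrow> h (g (e a)) = e a"
    by blast
  have hg: "h \<circ> g \<in> special_orthogonal scale \<beta>"
    by (rule SO_comp[OF rotations_SO[OF h(1)] g]) simp
  then have form_hg: "\<beta> (h (g v)) (h (g w)) = \<beta> v w" and lin: "Vector_Spaces.linear scale scale (h \<circ> g)"
    and det: "lin_det scale (h \<circ> g) = 1" for v w
    by (auto simp: special_orthogonal_def)
  let ?x = "\<beta> (e 0) (h (g (e 0)))"
  \<comment> \<open>The restored columns are standard, and orthogonality to them clears the first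
    column off the diagonal, so the matrix is diagonal.\<close>
  have coords: "\<beta> (e i) (h (g (e j))) = (if i = j then if i = 0 then ?x else 1 else 0)"
    if "i < n" "j < n" for i j
  proof -
    consider "j \<noteq> 0" | "j = 0" "i = 0" | "j = 0" "i \<noteq> 0" by blast
    then show ?thesis
    proof cases
      case 1
      then have "h (g (e j)) = e j" using that by (intro h(2)) auto
      then show ?thesis using 1 that by (simp add: orthonormal)
    next
      case 3
      then have "h (g (e i)) = e i" using that by (intro h(2)) auto
      then have "\<beta> (e i) (h (g (e 0))) = \<beta> (e i) (e 0)" using form_hg[of "e i" "e 0"] by simp
      then show ?thesis using 3 that by (simp add: orthonormal)
    qed simp
  qed
  have "dmat n (\<lambda>i j. \<beta> (e i) (h (g (e j)))) = 1"
    using det lin_det_coords[OF lin] by simp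
  also have "dmat n (\<lambda>i j. \<beta> (e i) (h (g (e j)))) =
      dmat n (\<lambda>i j. if i = j then if i = 0 then ?x else 1 else 0)"
    by (intro dmat_cong coords)
  also have "\<dots> = (\<Prod>i<n. if i = 0 then ?x else 1)"
    by (rule dmat_diagonal)
  also have "\<dots> = ?x" unfolding prod.delta[OF finite_lessThan] using False by simp
  finally have x: "?x = 1" .
  have "h (g v) = v" for v
  proof -
    interpret L: Vector_Spaces.linear scale scale "h \<circ> g" by (rule lin)
    have fix_e: "h (g (e a)) = e a" if "a < n" for a
    proof (rule coords_eqI)
      fix b assume b: "b < n"
      show "\<beta> (e b) (h (g (e a))) = \<beta> (e b) (e a)"
        unfolding coords[OF b that] x orthonormal[OF b that] by simp
    qed
    have "(h \<circ> g) (\<Sum>i<n. scale (\<beta> (e i) v) (e i)) = (\<Sum>i<n. scale (\<beta> (e i) v) (e i))"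
      unfolding L.sum L.scale using fix_e by simp
    then show ?thesis by (simp add: expansion)
  qed
  then have "h \<circ> g = id" by (simp add: fun_eq_iff)
  then show ?thesis using h(1) by blast
qed

end

section \<open>The splitting\<close>

lemma orthonormal_list_complete:
  fixes scale :: "'k::alg_closed_field \<Rightarrow> 'v::ab_group_add \<Rightarrow> 'v"
  assumes vs: "vector_space scale" and form: "symmetric_bilinear_form scale \<beta>" and nd: "nondegenerate_form \<beta>"
    and two: "(2::'k) \<noteq> 0"
    and on: "\<And>i j. i < n \<Longrightarrow> j < n \<Longrightarrow> \<beta> (e i) (e j) = (if i = j then 1 else 0)"
    and max: "\<And>w. (\<And>i. i < n \<Longrightarrow> \<beta> (e i) w = 0) \<Longrightarrow> \<beta> w w \<noteq> 1"
  shows "orthonormal_space scale \<beta> e n"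
proof -
  interpret vector_space scale by fact
  note simps = symmetric_bilinear_form_simps(1-5)[OF form]
  note sym = symmetric_bilinear_form_simps(6)[OF form]
  let ?perp = "\<lambda>w. \<forall>i<n. \<beta> (e i) w = 0"
  \<comment> \<open>An anisotropic vector of the orthogonal complement could be scaled to length 1
    by a square root, against maximality.\<close>
  have iso: "\<beta> w w = 0" if w: "?perp w" for w
  proof (rule ccontr)
    assume "\<beta> w w \<noteq> 0"
    obtain c :: 'k where c: "c ^ 2 = \<beta> w w" using nth_root_exists[of 2 "\<beta> w w"] by auto
    then have c0: "c \<noteq> 0" using \<open>\<beta> w w \<noteq> 0\<close> by auto
    have "\<beta> (scale (inverse c) w) (scale (inverse c) w) = inverse c * (inverse c * \<beta> w w)"
      by (simp only: simps sym[of "scale (inverse c) w" w])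
    also have "\<dots> = (inverse c * c) * (inverse c * c)"
      unfolding c[symmetric] power2_eq_square by (simp only: ac_simps)
    also have "\<dots> = 1" unfolding left_inverse[OF c0] by (rule mult_1_left)
    finally show False using max[of "scale (inverse c) w"] w by (simp add: simps)
  qed
  \<comment> \<open>Polarization, with 2 invertible, turns isotropy of all vectors of the complement
    into vanishing of the form on it.\<close>
  have perp: "\<beta> w w' = 0" if "?perp w" "?perp w'" for w w'
  proof -
    have "0 = \<beta> (w + w') (w + w')" using that by (intro iso[symmetric]) (simp add: simps)
    also have "\<dots> = \<beta> w w + \<beta> w w' + (\<beta> w w' + \<beta> w' w')"
      by (simp only: simps sym[of "w + w'" w] sym[of "w + w'" w'] sym[of w' w])
    also have "\<dots> = 2 * \<beta> w w'" 
      by (simp only: iso[OF that(1)] iso[OF that(2)] add_0_left add_0_right mult_2)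
    finally show ?thesis using two by simp
  qed
  have "(\<Sum>i<n. scale (\<beta> (e i) v) (e i)) = v" for v
  proof -
    have proj: "?perp (v - (\<Sum>i<n. scale (\<beta> (e i) v) (e i)))" for v
      by (simp add: simps on if_distrib[of "\<lambda>y. _ * y"] cong: if_cong)
    let ?w = "v - (\<Sum>i<n. scale (\<beta> (e i) v) (e i))"
    \<comment> \<open>The residual \<open>?w\<close> is orthogonal to the span of the
      \<open>e i\<close> and to their complement, hence to every \<open>u\<close>, so nondegeneracy
      makes it zero.\<close>
    have "\<beta> ?w u = 0" for u
    proof -
      let ?s = "\<Sum>i<n. scale (\<beta> (e i) u) (e i)"
      have "\<beta> ?w (e i) = 0" if "i < n" for i
        using proj that unfolding sym[of ?w "e i"] by blast
      then have "\<beta> ?w ?s = 0" by (simp only: simps) simp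
      moreover have "\<beta> ?w (u - ?s) = 0" by (rule perp[OF proj proj])
      ultimately have "\<beta> ?w ((u - ?s) + ?s) = 0" by (simp only: simps add_0_left)
      then show ?thesis by simp
    qed
    then have "?w = 0" using nd unfolding nondegenerate_form_def by blast
    then show ?thesis by simp
  qed
  then show ?thesis by unfold_locales (use form on in auto)
qed

lemma orthonormal_space_exists:
  fixes scale :: "'k::alg_closed_field \<Rightarrow> 'v::ab_group_add \<Rightarrow> 'v"
  assumes fd: "finite_dimensional_vector_space scale Basis"
    and form: "symmetric_bilinear_form scale \<beta>" and nd: "nondegenerate_form \<beta>"
    and two: "(2::'k) \<noteq> 0"
  shows "\<exists>e n. orthonormal_space scale \<beta> e n"
proof -
  interpret finite_dimensional_vector_space scale Basis by fact
  note simps = symmetric_bilinear_form_simps(1-5)[OF form]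
  note sym = symmetric_bilinear_form_simps(6)[OF form]
  define P where "P (k::nat) \<longleftrightarrow> (\<exists>e. \<forall>i<k. \<forall>j<k. \<beta> (e i) (e j) = (if i = j then 1 else 0))" for k
  have bound: "k \<le> dim UNIV" if Pk: "P k" for k
  proof -
    obtain e where e: "\<And>i j. i < k \<Longrightarrow> j < k \<Longrightarrow> \<beta> (e i) (e j) = (if i = j then 1 else 0)"
      using Pk unfolding P_def by blast
    have inj: "inj_on e {..<k}"
    proof (rule inj_onI)
      fix i j assume "i \<in> {..<k}" "j \<in> {..<k}" "e i = e j"
      then show "i = j" using e[of i j] e[of i i] by (auto split: if_splits)
    qed
    have "independent (e ` {..<k})"
    proof
      assume "dependent (e ` {..<k})"
      then obtain u where u: "\<exists>v\<in>e ` {..<k}. u v \<noteq> 0" "(\<Sum>v\<in>e ` {..<k}. scale (u v) v) = 0"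
        by (auto simp: dependent_finite)
      have "u (e a) = 0" if "a < k" for a
      proof -
        have "0 = \<beta> (e a) (\<Sum>i<k. scale (u (e i)) (e i))"
          using u(2) by (simp add: sum.reindex[OF inj] simps)
        also have "\<dots> = u (e a)"
          using that by (simp add: simps e if_distrib[of "\<lambda>y. _ * y"] cong: if_cong)
        finally show ?thesis by simp
      qed
      then show False using u(1) by auto
    qed
    then have "card (e ` {..<k}) \<le> dim UNIV" by (intro independent_card_le_dim) auto
    then show ?thesis by (simp add: card_image[OF inj])
  qed
  have "P 0" by (simp add: P_def)
  \<comment> \<open>Orthonormal systems are independent, so their lengths are bounded by the
    dimension and a longest one exists.\<close>
  then obtain n where n: "P n" "\<And>k. P k \<Longrightarrow> k \<le> n"
    using GreatestI_nat[of P 0 "dim UNIV"] Greatest_le_nat[of P _ "dim UNIV"] bound by blast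
  obtain e where e: "\<And>i j. i < n \<Longrightarrow> j < n \<Longrightarrow> \<beta> (e i) (e j) = (if i = j then 1 else 0)"
    using n(1) unfolding P_def by blast
  have "orthonormal_space scale \<beta> e n"
  proof (rule orthonormal_list_complete[OF vector_space_axioms form nd two e])
    fix w assume w: "\<And>i. i < n \<Longrightarrow> \<beta> (e i) w = 0"
    show "\<beta> w w \<noteq> 1"
    proof
      assume "\<beta> w w = 1"
      moreover have "\<beta> w (e i) = 0" if "i < n" for i
        using w[OF that] sym[of w "e i"] by simp
      ultimately have "P (Suc n)"
        unfolding P_def using e w
        by (intro exI[of _ "e(n := w)"]) (auto simp: less_Suc_eq)
      then show False using n(2) by fastforce
    qed
  qed
  then show ?thesis by blast
qed

section \<open>Passage between regular functions and polynomial functions of matrices\<close>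

lemma regular_functions_prod:
  assumes "finite S" "\<And>s. s \<in> S \<Longrightarrow> (\<lambda>x\<in>tuples m. F s x) \<in> regular_functions scale m"
  shows "(\<lambda>x\<in>tuples m. \<Prod>s\<in>S. F s x) \<in> regular_functions scale m"
  using assms
proof (induction S rule: finite_induct)
  case empty
  show ?case unfolding prod.empty by (rule regular_functions.const)
next
  case (insert s S)
  have "(\<lambda>x\<in>tuples m. (\<lambda>x\<in>tuples m. F s x) x * (\<lambda>x\<in>tuples m. \<Prod>s\<in>S. F s x) x) \<in> regular_functions scale m"
    using insert by (intro regular_functions.mult) auto
  also have "(\<lambda>x\<in>tuples m. (\<lambda>x\<in>tuples m. F s x) x * (\<lambda>x\<in>tuples m. \<Prod>s\<in>S. F s x) x) =
      (\<lambda>x\<in>tuples m. \<Prod>s\<in>insert s S. F s x)"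
    using insert.hyps by (intro restrict_ext) simp
  finally show ?case .
qed

lemma regular_functions_power:
  "(\<lambda>x\<in>tuples m. F x) \<in> regular_functions scale m \<Longrightarrow> (\<lambda>x\<in>tuples m. F x ^ k) \<in> regular_functions scale m"
  using regular_functions_prod[where S = "{..<k}" and F = "\<lambda>_. F"] by simp

locale orthogonal_frobenius = orthonormal_space scale \<beta> e n + char_p p "TYPE('k)"
  for scale :: "'k::alg_closed_field \<Rightarrow> 'v::ab_group_add \<Rightarrow> 'v" and \<beta> e n p +
  assumes p2: "p > 2"
begin

text \<open>Only the first \<open>m\<close> columns are read, so pulling functions back along this
  map to a wider matrix realizes the inclusion of coordinate rings.\<close>

definition tuple_of :: "nat \<Rightarrow> (nat \<times> nat \<Rightarrow> 'k) \<Rightarrow> nat \<Rightarrow> 'v" where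
  "tuple_of m X = (\<lambda>j\<in>{..<m}. vec (\<lambda>a. X (a, j)))"

text \<open>The default 0 appends zero vectors as further columns. Composition with this map is the
  retraction onto the smaller coordinate ring, equivariant because linear maps fix zero
  columns.\<close>

definition coords :: "nat \<Rightarrow> (nat \<Rightarrow> 'v) \<Rightarrow> nat \<times> nat \<Rightarrow> 'k" where
  "coords m x = (\<lambda>(a, j). if a < n \<and> j < m then \<beta> (e a) (x j) else 0)"

lemma tuple_of_tuples: "tuple_of m X \<in> tuples m"
  by (simp add: tuple_of_def tuples_def)

lemma tuple_of_coords:
  assumes "x \<in> tuples m"
  shows "tuple_of m (coords m x) = x"
proof
  fix j
  show "tuple_of m (coords m x) j = x j"
  proof (cases "j < m")
    case True
    then have "vec (\<lambda>a. coords m x (a, j)) = vec (\<lambda>a. \<beta> (e a) (x j))"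
      by (intro vec_cong) (simp add: coords_def)
    also have "\<dots> = x j" by (rule vec_coords)
    finally show ?thesis using True by (simp add: tuple_of_def)
  next
    case False
    then have "x j = undefined" by (intro PiE_arb[OF assms[unfolded tuples_def]]) simp
    then show ?thesis using False by (simp add: tuple_of_def)
  qed
qed

lemma tuple_of_rotate:
  assumes "Suc i < n"
  shows "tuple_of m (rotate_rows i c s X) = diagonal_map m (rotation i c s) (tuple_of m X)"
proof
  fix j
  have "vec (\<lambda>a. rotate_rows i c s X (a, j)) = rotation i c s (vec (\<lambda>a. X (a, j)))"
    unfolding rotation_def by (rule vec_cong) (use assms in \<open>auto simp: rotate_rows_def form_e_vec\<close>)
  then show "tuple_of m (rotate_rows i c s X) j = diagonal_map m (rotation i c s) (tuple_of m X) j"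
    by (simp add: tuple_of_def diagonal_map_def)
qed

lemma coords_rotate:
  assumes "Suc i < n"
  shows "coords m (diagonal_map m (rotation i c s) x) = rotate_rows i c s (coords m x)"
proof
  fix q :: "nat \<times> nat"
  show "coords m (diagonal_map m (rotation i c s) x) q = rotate_rows i c s (coords m x) q"
    using assms by (cases q) (auto simp: coords_def diagonal_map_def rotate_rows_def rotation_coords)
qed

lemma pullback_polys:
  assumes "f \<in> regular_functions scale m" "m \<le> M"
  shows "(\<lambda>X. f (tuple_of m X)) \<in> polys (grid n M)"
  using assms(1)
proof (induction rule: regular_functions.induct)
  case (const c)
  show ?case by (simp add: tuple_of_tuples polys_const)
next
  case (linear_form l i)
  interpret l: Vector_Spaces.linear scale "(*)" l by (rule linear_form(1))
  have "(\<lambda>X. \<Sum>a<n. l (e a) * X (a, i)) \<in> polys (grid n M)"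
    using linear_form(2) assms(2)
    by (intro mspan_sum mspan_cmult coord_polys finite_grid) (auto simp: grid_def)
  moreover have "l (tuple_of m X i) = (\<Sum>a<n. l (e a) * X (a, i))" for X
    using linear_form(2) by (simp add: tuple_of_def vec_def l.sum l.scale mult.commute)
  ultimately show ?case by (simp add: tuple_of_tuples)
qed (simp_all add: tuple_of_tuples mspan_add polys_mult)

lemma restriction_regular:
  assumes "b \<in> polys (grid n M)"
  shows "(\<lambda>x\<in>tuples m. b (coords m x)) \<in> regular_functions scale m"
  using assms
proof (induction rule: mspan.induct)
  case zero
  show ?case by (rule regular_functions.const)
next
  case (step f E c)
  have coord: "(\<lambda>x\<in>tuples m. coords m x q) \<in> regular_functions scale m" for q
  proof (cases q)
    case (Pair a j)
    have "Vector_Spaces.linear scale (*) (\<beta> (e a))"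
      using form by (simp add: symmetric_bilinear_form_def)
    then show ?thesis
      using regular_functions.linear_form[of scale "\<beta> (e a)" j m]
        regular_functions.const[where m = m and c = 0 and scale = scale]
      by (cases "a < n \<and> j < m") (auto simp: coords_def Pair)
  qed
  have "(\<lambda>x\<in>tuples m. mon (grid n M) E (coords m x)) \<in> regular_functions scale m"
    unfolding mon_def by (intro regular_functions_prod regular_functions_power coord finite_grid)
  then have "(\<lambda>x\<in>tuples m. (\<lambda>x\<in>tuples m. (\<lambda>x\<in>tuples m. c) x *
      (\<lambda>x\<in>tuples m. mon (grid n M) E (coords m x)) x) x +
      (\<lambda>x\<in>tuples m. f (coords m x)) x) \<in> regular_functions scale m"
    by (intro regular_functions.add regular_functions.mult regular_functions.const step.IH)
  also have "(\<lambda>x\<in>tuples m. (\<lambda>x\<in>tuples m. (\<lambda>x\<in>tuples m. c) x *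
      (\<lambda>x\<in>tuples m. mon (grid n M) E (coords m x)) x) x + (\<lambda>x\<in>tuples m. f (coords m x)) x) =
      (\<lambda>x\<in>tuples m. c * mon (grid n M) E (coords m x) + f (coords m x))"
    by (rule restrict_ext) simp
  finally show ?case .
qed

lemma rotations_invariant:
  assumes inv: "\<And>i c s X. Suc i < n \<Longrightarrow> c * c + s * s = 1 \<Longrightarrow> b (rotate_rows i c s X) = b X"
    and h: "h \<in> rotations n"
  shows "b (coords m (diagonal_map m h x)) = b (coords m x)"
  using h
proof (induction rule: rotations.induct)
  case id
  have "coords m (diagonal_map m id x) = coords m x"
    by (auto simp: coords_def diagonal_map_def fun_eq_iff)
  then show ?case by (simp only:)
next
  case (step h i c s)
  have "diagonal_map m (rotation i c s \<circ> h) x = diagonal_map m (rotation i c s) (diagonal_map m h x)"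
    by (auto simp: diagonal_map_def)
  then show ?case
    by (simp only: coords_rotate[OF step.hyps(2)] inv[OF step.hyps(2,3)] step.IH)
qed

lemma diagonal_map_comp: "diagonal_map m f (diagonal_map m g x) = diagonal_map m (f \<circ> g) x"
  by (auto simp: diagonal_map_def)

lemma diagonal_map_id: "x \<in> tuples m \<Longrightarrow> diagonal_map m id x = x"
  by (auto simp: diagonal_map_def tuples_def PiE_def extensional_def)

theorem frobenius_split_SO_invariant_ring: "frobenius_split p (SO_invariant_ring scale \<beta> m)"
proof -
  let ?R = "SO_invariant_ring scale \<beta> m" and ?SO = "special_orthogonal scale \<beta>"
  define M where "M = n + m"
  \<comment> \<open>Adding \<open>n\<close> columns guarantees \<open>n\<close> at most
    \<open>M\<close>, as the corner product requires, for every \<open>m\<close>.\<close>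
  let ?I = "grid n M"
  define F where "F = (\<lambda>X :: nat \<times> nat \<Rightarrow> 'k. corner_product n M X ^ (p - 1))"
  define \<Phi> where "\<Phi> f = frob_trace ?I (\<lambda>X. F X * f (tuple_of m X))" for f
  define \<phi> where "\<phi> f = (\<lambda>x\<in>tuples m. \<Phi> f (coords m x))" for f
  interpret R: cring ?R by (rule cring_SO_invariant_ring)
  have two: "(2::'k) \<noteq> 0" using two_neq_0[where 'k = 'k] p2 char by simp
  have sqrt: "\<exists>w. w * w = z" for z :: 'k
    using nth_root_exists[of 2 z] by (auto simp: power2_eq_square)
  then obtain \<iota> :: 'k where iota: "\<iota> * \<iota> = - 1" by blast
  have carrier: "f \<in> carrier ?R \<longleftrightarrow> f \<in> regular_functions scale m \<and> (\<forall>g\<in>?SO. act m g f = f)" for f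
    by (simp add: SO_invariant_ring_def coordinate_ring_def)
  have ops: "f \<oplus>\<^bsub>?R\<^esub> g = (\<lambda>x\<in>tuples m. f x + g x)" "f \<otimes>\<^bsub>?R\<^esub> g = (\<lambda>x\<in>tuples m. f x * g x)"
    "\<one>\<^bsub>?R\<^esub> = (\<lambda>x\<in>tuples m. 1)" for f g
    by (simp_all add: SO_invariant_ring_def coordinate_ring_def function_ring_def)
  have F: "F \<in> polys ?I"
    unfolding F_def M_def by (intro polys_power leading_polys[OF corner_product_leading]) simp
  have pull: "(\<lambda>X. f (tuple_of m X)) \<in> polys ?I" if "f \<in> carrier ?R" for f
    using that by (intro pullback_polys) (auto simp: carrier M_def)
  have pullF: "(\<lambda>X. F X * f (tuple_of m X)) \<in> polys ?I" if "f \<in> carrier ?R" for f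
    by (intro polys_mult F pull that)
  have inv: "f (diagonal_map m g x) = f x" if f: "f \<in> carrier ?R" and g: "g \<in> ?SO" and x: "x \<in> tuples m" for f g x
  proof -
    have "inv_into UNIV g \<circ> g = id" using g by (simp add: special_orthogonal_def bij_is_inj)
    then have "diagonal_map m (inv_into UNIV g) (diagonal_map m g x) = x"
      unfolding diagonal_map_comp by (simp only: diagonal_map_id[OF x])
    then have "act m g f (diagonal_map m g x) = f x"
      by (simp only: act_def restrict_apply' diagonal_map_tuples)
    then show ?thesis using f g by (simp add: carrier)
  qed
  have rot: "\<Phi> f (rotate_rows i c s X) = \<Phi> f X"
    if f: "f \<in> carrier ?R" and i: "Suc i < n" and cs: "c * c + s * s = 1" for f i c s X
  proof -
    \<comment> \<open>Every rotation lies in the torus, so the invariance proved for torus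
      parameters covers all admissible \<open>c\<close> and \<open>s\<close>.\<close>
    obtain t where t: "t \<noteq> 0" "torus_cos t = c" "torus_sin \<iota> t = s"
      using torus_surj[OF iota two cs] by blast
    have "f (tuple_of m (rotate_rows i (torus_cos t) (torus_sin \<iota> t) X)) = f (tuple_of m X)"
      if "t \<noteq> 0" for t X
      unfolding tuple_of_rotate[OF i]
      by (rule inv[OF f rotation_SO[OF i torus_norm[OF iota two that]] tuple_of_tuples])
    then have "\<Phi> f (rotate_rows i (torus_cos t) (torus_sin \<iota> t) X) = \<Phi> f X"
      unfolding \<Phi>_def F_def
      by (intro frob_trace_rotation_invariant[OF iota p2 _ i t(1) pull[OF f]]) (simp_all add: M_def)
    then show ?thesis by (simp only: t)
  qed
  have closed: "\<phi> f \<in> carrier ?R" if f: "f \<in> carrier ?R" for f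
    unfolding carrier
  proof (intro conjI ballI)
    show "\<phi> f \<in> regular_functions scale m"
      unfolding \<phi>_def \<Phi>_def
      by (rule restriction_regular[OF frob_trace_polys[OF finite_grid pullF[OF f]]])
    fix g assume g: "g \<in> ?SO"
    obtain h where h: "h \<in> rotations n" "h \<circ> g = id" using SO_reduce[OF sqrt two g] by blast
    have "g \<circ> inv_into UNIV g = id"
      unfolding surj_iff[symmetric] using g by (simp add: special_orthogonal_def bij_is_surj)
    show "act m g (\<phi> f) = \<phi> f"
    proof
      fix x
      show "act m g (\<phi> f) x = \<phi> f x"
      proof (cases "x \<in> tuples m")
        case True
        let ?y = "diagonal_map m (inv_into UNIV g) x"
        have y: "?y \<in> tuples m" by (rule diagonal_map_tuples)
        have x: "diagonal_map m g ?y = x"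
          unfolding diagonal_map_comp \<open>g \<circ> inv_into UNIV g = id\<close> by (rule diagonal_map_id[OF True])
        \<comment> \<open>Since \<open>h\<close> is the inverse of \<open>g\<close>, it sends
          \<open>x\<close> to \<open>?y\<close>; invariance under products of rotations therefore
          compares the values at \<open>x\<close> and at \<open>?y\<close>.\<close>
        have "\<Phi> f (coords m x) = \<Phi> f (coords m (diagonal_map m h x))"
          by (rule rotations_invariant[OF rot[OF f] h(1), symmetric])
        also have "diagonal_map m h x = diagonal_map m (h \<circ> g) ?y"
          unfolding diagonal_map_comp[symmetric] x ..
        also have "\<dots> = ?y" unfolding h(2) by (rule diagonal_map_id[OF y])
        finally show ?thesis using True y by (simp add: act_def \<phi>_def)
      next
        case False
        then show ?thesis by (simp add: act_def \<phi>_def)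
      qed
    qed
  qed
  have pow: "a [^]\<^bsub>?R\<^esub> k = (\<lambda>x\<in>tuples m. a x ^ k)" if "a \<in> carrier ?R" for a and k :: nat
    by (induction k) (auto simp: ops mult.commute)
  show ?thesis
    unfolding frobenius_split_def
  proof (rule bexI[of _ \<phi>], intro conjI ballI)
    show "\<phi> \<in> carrier ?R \<rightarrow> carrier ?R" using closed by blast
    fix a b assume a: "a \<in> carrier ?R" and b: "b \<in> carrier ?R"
    have "\<Phi> (a \<oplus>\<^bsub>?R\<^esub> b) = (\<lambda>X. \<Phi> a X + \<Phi> b X)"
      unfolding \<Phi>_def ops frob_trace_add[OF finite_grid pullF[OF a] pullF[OF b], symmetric]
      by (simp add: tuple_of_tuples distrib_left)
    then show "\<phi> (a \<oplus>\<^bsub>?R\<^esub> b) = \<phi> a \<oplus>\<^bsub>?R\<^esub> \<phi> b"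
      by (auto simp: \<phi>_def ops)
    have "\<Phi> ((a [^]\<^bsub>?R\<^esub> p) \<otimes>\<^bsub>?R\<^esub> b) = (\<lambda>X. a (tuple_of m X) * \<Phi> b X)"
      unfolding \<Phi>_def pow[OF a] ops frob_trace_frob_mult[OF finite_grid pullF[OF b] pull[OF a], symmetric]
      by (simp add: tuple_of_tuples mult.left_commute)
    \<comment> \<open>Restriction to the first \<open>m\<close> columns returns \<open>a\<close>
      itself, because \<open>tuple_of\<close> is a left inverse of \<open>coords\<close> on
      tuples.\<close>
    then show "\<phi> ((a [^]\<^bsub>?R\<^esub> p) \<otimes>\<^bsub>?R\<^esub> b) = a \<otimes>\<^bsub>?R\<^esub> \<phi> b"
      by (auto simp: \<phi>_def ops tuple_of_coords)
  next
    have "\<Phi> \<one>\<^bsub>?R\<^esub> = (\<lambda>X. 1)"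
      unfolding \<Phi>_def ops F_def M_def
      using frob_trace_corner_product[of n "n + m"] by (simp add: tuple_of_tuples)
    then show "\<phi> \<one>\<^bsub>?R\<^esub> = \<one>\<^bsub>?R\<^esub>"
      by (simp add: \<phi>_def ops)
  qed
qed

end

theorem theorem1p1:
  fixes scale :: "'k::alg_closed_field \<Rightarrow> 'v::ab_group_add \<Rightarrow> 'v"
    and Basis :: "'v set"
    and \<beta> :: "'v \<Rightarrow> 'v \<Rightarrow> 'k"
    and p n :: nat
  assumes "CHAR('k) = p" and "p > 2"
    and "finite_dimensional_vector_space scale Basis"
    and "vector_space.dim scale (UNIV :: 'v set) = n"
    and "symmetric_bilinear_form scale \<beta>"
    and "nondegenerate_form \<beta>"
  shows "\<forall>m\<ge>1. frobenius_split p (SO_invariant_ring scale \<beta> m)"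
proof -
  have two: "(2::'k) \<noteq> 0" using two_neq_0[where 'k = 'k] assms(1,2) by simp
  obtain e N where "orthonormal_space scale \<beta> e N"
    using orthonormal_space_exists[OF assms(3,5,6) two] by blast
  then interpret orthonormal_space scale \<beta> e N .
  have "prime p" using assms(1,2) prime_CHAR_semidom[where 'a = 'k] by simp
  then interpret orthogonal_frobenius scale \<beta> e N p
    using assms(1,2) by unfold_locales auto
  show ?thesis using frobenius_split_SO_invariant_ring by blast
qed

end
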